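(* Let $\Bbbk$ be a field of characteristic $0$, let $n\ge3$, let $\Omega\in\Bbbk^{[n+1]}=\Bbbk[t_1,\dots,t_{n+1}]$ be an i.s. potential of degree $n+1+d_0$ where $d_0\ge2$, and let $\xi\in\Bbbk^\times$. Then $P_{\Omega-\xi}$ has a unique filtration $\mathbb F=\{F_i\}_{i\in\mathbb Z}$ that is a $d_0$-filtration and for which $\mathrm{gr}_{\mathbb F}(P_{\Omega-\xi})$ (with its induced bracket) is a connected $d_0$-graded Nambu-Poisson domain.
   Context: A Nambu-Poisson algebra ($n$-Lie Poisson algebra) is a commutative $\Bbbk$-algebra $P$ with an $n$-ary $\Bbbk$-multilinear bracket $\{-,\dots,-\}$ that vanishes whenever two arguments are equal, satisfies $\{\{u_1,\dots,u_n\},v_1,\dots,v_{n-1}\}=\sum_{s=1}^n\{u_1,\dots,u_{s-1},\{u_s,v_1,\dots,v_{n-1}\},u_{s+1},\dots,u_n\}$, and satisfies the Leibniz rule in each argument. An i.s. potential is a homogeneous element $\Omega\in\Bbbk^{[n+1]}$ (with $\deg t_i=1$ for all $i$) such that $\Bbbk^{[n+1]}/(\Omega_{t_1},\dots,\Omega_{t_{n+1}})$ is finite-dimensional over $\Bbbk$, where $\Omega_{t_i}=\partial\Omega/\partial t_i$. $A_\Omega$ denotes $\Bbbk^{[n+1]}$ with the Nambu-Poisson bracket $\{f_1,\dots,f_n\}=\det\frac{\partial(f_1,\dots,f_n,\Omega)}{\partial(t_1,\dots,t_{n+1})}$ (the Jacobian determinant whose last row is the gradient of $\Omega$). For $\xi\in\Bbbk$,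 $P_{\Omega-\xi}=A_\Omega/(\Omega-\xi)$ with the induced bracket. A filtration of an algebra $A$ is a chain $\mathbb F=\{F_i\}_{i\in\mathbb Z}$ of $\Bbbk$-subspaces with (a) $F_i\supseteq F_{i+1}$ for all $i$ and $1\in F_0\setminus F_1$; (b) $F_iF_j\subseteq F_{i+j}$; (c) $\bigcup_i(F_i\setminus F_{i+1})=A\setminus\{0\}$. For a Nambu-Poisson algebra $A$ and $w\in\mathbb Z$, it is a $w$-filtration if moreover (d) $\{F_{i_1},\dots,F_{i_n}\}\subseteq F_{(\sum_s i_s)-w}$ for all $i_1,\dots,i_n$. Then $\mathrm{gr}_{\mathbb F}A=\bigoplus_iF_i/F_{i+1}$ carries an induced Nambu-Poisson bracket sending the classes of $f_s\in F_{i_s}$ to the class of $\{f_1,\dots,f_n\}$ in degree $(\sum_s i_s)-w$. A Nambu-Poisson algebra $A=\bigoplus_iA_i$ that is a $\mathbb Z$-graded algebra is $w$-graded if $\{A_{i_1},\dots,A_{i_n}\}\subseteq A_{(\sum_s i_s)-w}$. A $\mathbb Z$-graded algebra is connected graded if $A_i=0$ for all $i>0$ and $A_0=\Bbbk$. *)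

theory Defs
  imports
    "Jordan_Normal_Form.VS_Connect"
    "HOL-Algebra.QuotRing"
    "HOL-Library.Poly_Mapping"
begin

section \<open>Nambu-Poisson algebras\<close>

text \<open>
  The bracket takes the list of its arguments; only its values on lists of length \<open>n\<close>
  of carrier elements matter.
\<close>

record ('k, 'a) np_algebra = "('k, 'a) module" +
  nbracket :: "'a list \<Rightarrow> 'a"

locale nambu_poisson_algebra =
  fixes K :: "'k ring" and n :: nat and A :: "('k, 'a) np_algebra" (structure)
  assumes base_field: "field K"
    and algebra: "Module.algebra K A"
    and bracket_closed:
      "\<lbrakk>length us = n; set us \<subseteq> carrier A\<rbrakk> \<Longrightarrow> nbracket A us \<in> carrier A"
    and bracket_add:
      "\<lbrakk>length us = n; set us \<subseteq> carrier A; i < n; a \<in> carrier A; b \<in> carrier A\<rbrakk> \<Longrightarrow>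
        nbracket A (us[i := a \<oplus> b]) = nbracket A (us[i := a]) \<oplus> nbracket A (us[i := b])"
    and bracket_smult:
      "\<lbrakk>length us = n; set us \<subseteq> carrier A; i < n; c \<in> carrier K; a \<in> carrier A\<rbrakk> \<Longrightarrow>
        nbracket A (us[i := c \<odot> a]) = c \<odot> nbracket A (us[i := a])"
    and bracket_alternating:
      "\<lbrakk>length us = n; set us \<subseteq> carrier A; i < j; j < n; us ! i = us ! j\<rbrakk> \<Longrightarrow>
        nbracket A us = \<zero>"
    and fundamental_identity:
      "\<lbrakk>length us = n; set us \<subseteq> carrier A; length vs = n - 1; set vs \<subseteq> carrier A\<rbrakk> \<Longrightarrow>
        nbracket A (nbracket A us # vs) =
          (\<Oplus>s\<in>{..<n}. nbracket A (us[s := nbracket A (us ! s # vs)]))"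
    and leibniz:
      "\<lbrakk>length us = n; set us \<subseteq> carrier A; i < n; a \<in> carrier A; b \<in> carrier A\<rbrakk> \<Longrightarrow>
        nbracket A (us[i := a \<otimes> b]) =
          a \<otimes> nbracket A (us[i := b]) \<oplus> nbracket A (us[i := a]) \<otimes> b"


section \<open>Quotients\<close>

text \<open>
  As for \<^const>\<open>rcoset_mult\<close>, an operation induced on cosets of \<open>I\<close> is the union of the
  cosets of all results on representatives; it is a single coset exactly when the operation
  is well defined on these classes. In the bracket the arguments may be cosets of subspaces other
  than \<open>I\<close>.
\<close>

definition rcoset_smult :: "('k, 'a, 'm) module_scheme \<Rightarrow> 'a set \<Rightarrow> 'k \<Rightarrow> 'a set \<Rightarrow> 'a set"
  where "rcoset_smult A I c X = (\<Union>x\<in>X. I +>\<^bsub>A\<^esub> (c \<odot>\<^bsub>A\<^esub> x))"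

definition rcoset_bracket :: "('k, 'a) np_algebra \<Rightarrow> 'a set \<Rightarrow> 'a set list \<Rightarrow> 'a set"
  where "rcoset_bracket A I Xs = (\<Union>fs\<in>{fs. list_all2 (\<in>) fs Xs}. I +>\<^bsub>A\<^esub> nbracket A fs)"

definition quot_algebra :: "('k, 'a, 'm) module_scheme \<Rightarrow> 'a set \<Rightarrow> ('k, 'a set) module"
  where "quot_algebra A I = ring.extend (A Quot I) (module.fields (rcoset_smult A I))"

definition quot_np_algebra :: "('k, 'a) np_algebra \<Rightarrow> 'a set \<Rightarrow> ('k, 'a set) np_algebra"
  where "quot_np_algebra A I =
    module.extend (quot_algebra A I) (np_algebra.fields (rcoset_bracket A I))"


section \<open>Filtrations and gradings\<close>

locale filtration =
  fixes K :: "'k ring" and A :: "('k, 'a, 'm) module_scheme" (structure)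
    and F :: "int \<Rightarrow> 'a set"
  assumes subspaces: "VectorSpace.subspace K (F i) A"
    and decreasing: "F (i + 1) \<subseteq> F i"
    and one_mem: "\<one> \<in> F 0 - F 1"
    and mult_mem: "\<lbrakk>f \<in> F i; g \<in> F j\<rbrakk> \<Longrightarrow> f \<otimes> g \<in> F (i + j)"
    and exhaustive_separated: "(\<Union>i. F i - F (i + 1)) = carrier A - {\<zero>}"

locale w_filtration =
  nambu_poisson_algebra K n A + filtration K A F
  for K :: "'k ring" and n :: nat and w :: int and A :: "('k, 'a) np_algebra" (structure)
    and F :: "int \<Rightarrow> 'a set" +
  assumes bracket_mem:
    "\<lbrakk>length is = n; list_all2 (\<lambda>f i. f \<in> F i) fs is\<rbrakk> \<Longrightarrow>
      nbracket A fs \<in> F (sum_list is - w)"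

locale graded_algebra =
  fixes K :: "'k ring" and A :: "('k, 'a, 'm) module_scheme" (structure)
    and G :: "int \<Rightarrow> 'a set"
  assumes graded_carrier: "Module.algebra K A"
    and components: "VectorSpace.subspace K (G i) A"
    and direct_sum:
      "a \<in> carrier A \<Longrightarrow>
        \<exists>!g. (\<forall>i. g i \<in> G i) \<and> finite {i. g i \<noteq> \<zero>} \<and> a = (\<Oplus>i\<in>{i. g i \<noteq> \<zero>}. g i)"
    and one_component: "\<one> \<in> G 0"
    and mult_component: "\<lbrakk>f \<in> G i; g \<in> G j\<rbrakk> \<Longrightarrow> f \<otimes> g \<in> G (i + j)"

locale connected_graded_algebra = graded_algebra +
  assumes positive_trivial: "i > 0 \<Longrightarrow> G i = {\<zero>}"
    and degree_zero: "G 0 = {c \<odot> \<one> | c. c \<in> carrier K}" "\<one> \<noteq> \<zero>"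

locale w_graded_np_algebra =
  nambu_poisson_algebra K n A + graded_algebra K A G
  for K :: "'k ring" and n :: nat and w :: int and A :: "('k, 'a) np_algebra" (structure)
    and G :: "int \<Rightarrow> 'a set" +
  assumes bracket_component:
    "\<lbrakk>length is = n; list_all2 (\<lambda>f i. f \<in> G i) fs is\<rbrakk> \<Longrightarrow>
      nbracket A fs \<in> G (sum_list is - w)"


section \<open>The associated graded Nambu-Poisson algebra\<close>

text \<open>
  An element of the direct sum of the spaces \<open>F i / F (i + 1)\<close> is a function \<open>x\<close> sending every
  \<open>i\<close> to a coset \<open>x i\<close> of \<open>F (i + 1)\<close> in \<open>F i\<close>, with \<open>x i\<close> the zero coset for almost all \<open>i\<close>.
  Products and brackets are those of the homogeneous parts, summed degree by degree. The
  sums are formed in \<open>A Quot F (k + 1)\<close>, of which only the additive structure is used (\<open>F (k + 1)\<close>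
  need not be an ideal of \<open>A\<close>).
\<close>

definition gr_support :: "(int \<Rightarrow> 'a set) \<Rightarrow> (int \<Rightarrow> 'a set) \<Rightarrow> int set"
  where "gr_support F x = {i. x i \<noteq> F (i + 1)}"

definition gr ::
  "nat \<Rightarrow> int \<Rightarrow> ('k, 'a) np_algebra \<Rightarrow> (int \<Rightarrow> 'a set) \<Rightarrow> ('k, int \<Rightarrow> 'a set) np_algebra"
  where "gr n w A F =
    \<lparr>carrier = {x. (\<forall>i. x i \<in> (\<lambda>f. F (i + 1) +>\<^bsub>A\<^esub> f) ` F i) \<and> finite (gr_support F x)},
     mult = (\<lambda>x y k. \<Oplus>\<^bsub>A Quot F (k + 1)\<^esub> i \<in> gr_support F x.
               rcoset_mult A (F (k + 1)) (x i) (y (k - i))),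
     one = (\<lambda>i. if i = 0 then F 1 +>\<^bsub>A\<^esub> \<one>\<^bsub>A\<^esub> else F (i + 1)),
     zero = (\<lambda>i. F (i + 1)),
     add = (\<lambda>x y i. x i <+>\<^bsub>A\<^esub> y i),
     smult = (\<lambda>c x i. rcoset_smult A (F (i + 1)) c (x i)),
     nbracket = (\<lambda>xs k. \<Oplus>\<^bsub>A Quot F (k + 1)\<^esub>
        is \<in> {is. length is = n \<and> list_all2 (\<lambda>i x. i \<in> gr_support F x) is xs \<and> sum_list is - w = k}.
               rcoset_bracket A (F (k + 1)) (map2 (\<lambda>x i. x i) xs is))\<rparr>"

definition gr_component ::
  "nat \<Rightarrow> int \<Rightarrow> ('k, 'a) np_algebra \<Rightarrow> (int \<Rightarrow> 'a set) \<Rightarrow> int \<Rightarrow> (int \<Rightarrow> 'a set) set"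
  where "gr_component n w A F i = {x \<in> carrier (gr n w A F). gr_support F x \<subseteq> {i}}"


section \<open>Polynomial rings and potentials\<close>

text \<open>
  The polynomial ring in \<open>N\<close> variables is taken inside the polynomials in countably many
  variables; monomials are exponent vectors. The variables are numbered from \<open>0\<close>, so the
  \<open>t\<^sub>1, \<dots>, t\<^sub>N\<close> of the usual notation have the indices \<open>0, \<dots>, N - 1\<close>.
\<close>

type_synonym 'k mpoly = "(nat \<Rightarrow>\<^sub>0 nat) \<Rightarrow>\<^sub>0 'k"

definition mconst :: "'k::zero \<Rightarrow> 'k mpoly"
  where "mconst c = Poly_Mapping.single 0 c"

definition poly_algebra :: "nat \<Rightarrow> ('k::field, 'k mpoly) module"
  where "poly_algebra N =
    \<lparr>carrier = {p. \<forall>m\<in>Poly_Mapping.keys p. Poly_Mapping.keys m \<subseteq> {..<N}},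
     mult = (*), one = 1, zero = 0, add = (+),
     smult = (\<lambda>c p. mconst c * p)\<rparr>"

definition mon_degree :: "(nat \<Rightarrow>\<^sub>0 nat) \<Rightarrow> nat"
  where "mon_degree m = (\<Sum>i\<in>Poly_Mapping.keys m. Poly_Mapping.lookup m i)"

definition homogeneous :: "nat \<Rightarrow> 'k::zero mpoly \<Rightarrow> bool"
  where "homogeneous d p \<longleftrightarrow> (\<forall>m\<in>Poly_Mapping.keys p. mon_degree m = d)"

text \<open>
  In the summands with exponent \<open>0\<close> of the variable \<open>i\<close>, the subtraction of exponent vectors
  truncates, but the coefficient vanishes.
\<close>

definition partial_deriv :: "nat \<Rightarrow> 'k::comm_semiring_1 mpoly \<Rightarrow> 'k mpoly"
  where "partial_deriv i p = (\<Sum>m\<in>Poly_Mapping.keys p.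
    Poly_Mapping.single (m - Poly_Mapping.single i 1)
      (of_nat (Poly_Mapping.lookup m i) * Poly_Mapping.lookup p m))"

definition jacobian_det :: "'k::comm_ring_1 mpoly list \<Rightarrow> 'k mpoly"
  where "jacobian_det ps =
    Determinant.det (mat (length ps) (length ps) (\<lambda>(i, j). partial_deriv j (ps ! i)))"

text \<open>
  An i.s. potential of degree \<open>d\<close> in \<open>n + 1\<close> variables. The zero polynomial, which is
  homogeneous of every degree, is excluded by the finite-dimensionality.
\<close>

definition is_potential :: "nat \<Rightarrow> nat \<Rightarrow> 'k::field mpoly \<Rightarrow> bool"
  where "is_potential n d \<Omega> \<longleftrightarrow>
    \<Omega> \<in> carrier (poly_algebra (n + 1)) \<and> homogeneous d \<Omega> \<and>
    vectorspace.fin_dim class_ring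
      (quot_algebra (poly_algebra (n + 1))
        (genideal (poly_algebra (n + 1)) {partial_deriv i \<Omega> | i. i < n + 1}))"

definition A_pot :: "nat \<Rightarrow> 'k::field mpoly \<Rightarrow> ('k, 'k mpoly) np_algebra"
  where "A_pot n \<Omega> = module.extend (poly_algebra (n + 1))
    (np_algebra.fields (\<lambda>fs. jacobian_det (fs @ [\<Omega>])))"

definition P_pot :: "nat \<Rightarrow> 'k::field mpoly \<Rightarrow> 'k \<Rightarrow> ('k, 'k mpoly set) np_algebra"
  where "P_pot n \<Omega> \<xi> =
    quot_np_algebra (A_pot n \<Omega>) (genideal (A_pot n \<Omega>) {\<Omega> - mconst \<xi>})"

end

theory Submission
  imports Defs
begin

text \<open>
  The images of the polynomials of degree at most \<open>m\<close> form a filtration whose graded algebra is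
  \<open>k[t] / (\<Omega>)\<close>. It is a domain: a factorization of \<open>\<Omega>\<close> would place powers of all the variables in the
  ideal of two forms, which is impossible in at least three variables, and irreducible polynomials
  are prime.

  Conversely, a filtration as in the theorem is a valuation on \<open>P\<close>; let \<open>a\<close> be the maximum of the
  degrees of the variables. It is positive, as \<open>F\<^sub>0 = k\<close>.
  The brackets \<open>{t\<^sub>i | i \<noteq> j} = \<plusminus> \<Omega>\<^sub>j\<close> have degree at most
  \<open>n a + d\<^sub>0\<close>, whereas the singularity being isolated some \<open>\<Omega>\<^sub>j\<close> attains its expected degree
  \<open>(n + d\<^sub>0) a\<close>; hence \<open>a = 1\<close>. So the filtration contains the standard one, and the two agree once the
  forms whose degree drops are the multiples of \<open>\<Omega>\<close>. These forms generate a prime ideal which is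
  closed under brackets. If it contained a polynomial not divisible by \<open>\<Omega>\<close>, elimination would give a
  form in it free of \<open>t\<^sub>j\<close>; bracketing a form \<open>g\<close> of this kind with coordinates yields
  \<open>\<plusminus> (\<partial>g / \<partial>t\<^sub>i) \<Omega>\<^sub>j\<close>, so the form of minimal degree would have to be a nonzero constant.
\<close>

section \<open>Gradings of polynomial rings\<close>

text \<open>Statements about \<open>P\<close> are moved to the polynomial ring: the members of a
  filtration are replaced by their preimages, which contain the ideal \<open>I\<close> of
  \<open>\<Omega> - \<xi>\<close>, and gr is reached by the map \<open>\<phi>\<close> that takes f
  to the classes of its homogeneous components. This map is onto, respects every operation and kills
  exactly the multiples of \<Omega>, so the axioms of gr are inherited from polynomials instead of
  being verified on families of cosets. The isolated singularity enters in one form: a common power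
  \<open>t\<^sub>i\<^sup>M\<close> of all variables lies in the Jacobian ideal. If every
  \<open>\<Omega>\<^sub>j\<close> fell short of its expected degree, so would
  \<open>t\<^sub>i\<^sup>M\<close> for a variable of maximal degree, although degrees are additive.
  The same additivity explains the descent along derivatives: if
  \<open>(\<partial>g / \<partial>t\<^sub>i) \<Omega>\<^sub>j\<close> has dropped degree and
  \<open>\<Omega>\<^sub>j\<close> has not, the drop belongs to the derivative of g. Characteristic 0
  supplies a nonzero derivative of every nonconstant form.\<close>

lemma mpoly_sum_single:
  fixes p :: "'a \<Rightarrow>\<^sub>0 'k::comm_monoid_add"
  shows "p = (\<Sum>m\<in>Poly_Mapping.keys p. Poly_Mapping.single m (Poly_Mapping.lookup p m))"
  by (rule poly_mapping_eqI)
    (auto simp: lookup_sum lookup_single when_def in_keys_iff sum.delta)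

text \<open>Reduces additive identities to single terms; the summands of the \<open>add\<close> case
  may share monomials.\<close>

lemma mpoly_induct [case_names single add]:
  fixes p :: "'a \<Rightarrow>\<^sub>0 'k::comm_monoid_add"
  assumes "\<And>m c. P (Poly_Mapping.single m c)" "\<And>p q. P p \<Longrightarrow> P q \<Longrightarrow> P (p + q)"
  shows "P p"
proof -
  have "P (\<Sum>m\<in>S. Poly_Mapping.single m (Poly_Mapping.lookup p m))" if "finite S" for S
    using that
  proof (induction S)
    case empty
    show ?case using assms(1)[of undefined 0] by simp
  qed (use assms in auto)
  from this[of "Poly_Mapping.keys p"] show ?thesis
    using mpoly_sum_single[of p] by simp
qed

text \<open>A monomial that cancels in \<open>p + q\<close> is absent on the left, while on the
  right it contributes \<open>f m a + f m b = f m 0 = 0\<close>.\<close>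

lemma mpoly_keys_sum_add:
  assumes "\<And>m. f m 0 = 0" "\<And>m a b. f m (a + b) = f m a + f m b"
  shows "(\<Sum>m\<in>Poly_Mapping.keys (p + q). f m (Poly_Mapping.lookup (p + q) m)) =
    (\<Sum>m\<in>Poly_Mapping.keys p. f m (Poly_Mapping.lookup p m)) +
    (\<Sum>m\<in>Poly_Mapping.keys q. f m (Poly_Mapping.lookup q m))"
  by (rule setsum_keys_plus_distrib) (use assms in auto)

text \<open>An arbitrary set of variables rather than a bound on their number, because elimination
  removes a variable from the middle.\<close>

definition pvars :: "nat set \<Rightarrow> 'k::zero mpoly set"
  where "pvars V = {p. \<forall>m\<in>Poly_Mapping.keys p. Poly_Mapping.keys m \<subseteq> V}"

lemma pvars_iff: "p \<in> pvars V \<longleftrightarrow> (\<forall>m i. Poly_Mapping.lookup p m \<noteq> 0 \<longrightarrow> i \<notin> V \<longrightarrow> Poly_Mapping.lookup m i = 0)"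
  unfolding pvars_def subset_iff by (auto simp: in_keys_iff) (metis neq0_conv)

lemma pvarsD: "p \<in> pvars V \<Longrightarrow> Poly_Mapping.lookup p m \<noteq> 0 \<Longrightarrow> i \<notin> V \<Longrightarrow> Poly_Mapping.lookup m i = 0"
  by (simp add: pvars_iff)

lemma pvars_zero [simp]: "0 \<in> pvars V"
  by (simp add: pvars_def)

lemma pvars_add: "p \<in> pvars V \<Longrightarrow> q \<in> pvars V \<Longrightarrow> p + q \<in> pvars V"
  for p :: "'k::monoid_add mpoly"
  unfolding pvars_def using Poly_Mapping.keys_add[of p q] by blast

lemma pvars_uminus: "p \<in> pvars V \<Longrightarrow> - p \<in> pvars V"
  for p :: "'k::ab_group_add mpoly"
  by (simp add: pvars_iff)

lemma pvars_diff: "p \<in> pvars V \<Longrightarrow> q \<in> pvars V \<Longrightarrow> p - q \<in> pvars V"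
  for p :: "'k::ab_group_add mpoly"
  using pvars_add[of p V "-q"] pvars_uminus[of q V] by simp

lemma pvars_mult: "p \<in> pvars V \<Longrightarrow> q \<in> pvars V \<Longrightarrow> p * q \<in> pvars V"
  for p :: "'k::semiring_0 mpoly"
proof -
  assume pq: "p \<in> pvars V" "q \<in> pvars V"
  have "Poly_Mapping.keys m \<subseteq> V" if m: "m \<in> Poly_Mapping.keys (p * q)" for m
  proof -
    obtain a b where "m = a + b" "a \<in> Poly_Mapping.keys p" "b \<in> Poly_Mapping.keys q"
      using keys_mult[of p q] m by blast
    then show ?thesis using pq Poly_Mapping.keys_add[of a b] unfolding pvars_def by blast
  qed
  then show ?thesis by (simp add: pvars_def)
qed

lemma pvars_single: "Poly_Mapping.keys m \<subseteq> V \<Longrightarrow> Poly_Mapping.single m c \<in> pvars V"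
  by (auto simp: pvars_def)

lemma pvars_mconst [simp]: "mconst c \<in> pvars V"
  by (auto simp: pvars_def mconst_def)

lemma pvars_one [simp]: "1 \<in> pvars V"
  by (auto simp: pvars_def)

lemma pvars_sum: "(\<And>i. i \<in> S \<Longrightarrow> f i \<in> pvars V) \<Longrightarrow> sum f S \<in> pvars V"
  for f :: "'b \<Rightarrow> 'k::comm_monoid_add mpoly"
  by (induction S rule: infinite_finite_induct) (auto intro: pvars_add)

lemma pvars_power: "p \<in> pvars V \<Longrightarrow> p ^ i \<in> pvars V"
  for p :: "'k::comm_semiring_1 mpoly"
  by (induction i) (auto intro: pvars_mult)

lemma pvars_mono: "V \<subseteq> W \<Longrightarrow> p \<in> pvars V \<Longrightarrow> p \<in> pvars W"
  by (auto simp: pvars_def)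

section \<open>Variables and constants\<close>

definition tvar :: "nat \<Rightarrow> 'k::comm_semiring_1 mpoly"
  where "tvar i = Poly_Mapping.single (Poly_Mapping.single i 1) 1"

lemma pvars_tvar: "i \<in> V \<Longrightarrow> tvar i \<in> pvars V"
  by (auto simp: tvar_def pvars_def)

lemma tvar_nonzero [simp]: "tvar i \<noteq> (0 :: 'k::comm_semiring_1 mpoly)"
proof
  assume "tvar i = (0 :: 'k mpoly)"
  then have "Poly_Mapping.lookup (tvar i :: 'k mpoly) (Poly_Mapping.single i 1) = 0" by simp
  then show False by (simp add: tvar_def)
qed

lemma tvar_power: "tvar i ^ e = Poly_Mapping.single (Poly_Mapping.single i e) 1"
  by (induction e) (auto simp: tvar_def mult_single single_add[symmetric])

lemma mconst_add: "mconst (a + b) = mconst a + mconst b"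
  by (simp add: mconst_def single_add)

lemma mconst_mult: "mconst (a * b) = mconst a * mconst b"
  by (simp add: mconst_def mult_single)

lemma mconst_0 [simp]: "mconst 0 = 0"
  by (simp add: mconst_def)

lemma mconst_1 [simp]: "mconst 1 = 1"
  by (simp add: mconst_def)

lemma mconst_eq_0 [simp]: "mconst c = 0 \<longleftrightarrow> c = 0"
  unfolding mconst_def by (metis lookup_single_eq single_zero lookup_zero)

lemma mconst_minus: "mconst (- a) = - mconst (a::'k::ab_group_add)"
  by (simp add: mconst_def single_uminus)

lemma lookup_mconst_mult: "Poly_Mapping.lookup (mconst c * p) m = c * Poly_Mapping.lookup p m"
  unfolding mconst_def
  by (simp add: mult_map_scale_conv_mult[symmetric] Poly_Mapping.map.rep_eq when_def)

lemma is_unit_mconst: "c \<noteq> 0 \<Longrightarrow> mconst (c::'k::field) dvd 1"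
  by (rule dvdI[of _ _ "mconst (inverse c)"]) (simp flip: mconst_mult)

text \<open>The weight \<open>w m\<close> of a monomial becomes the exponent of an extra variable, which reduces gradings to
  univariate polynomials. The total degree with \<open>\<mu> = id\<close> yields homogeneous components; the exponent
  of \<open>t\<^sub>j\<close> with \<open>\<mu>\<close> deleting \<open>t\<^sub>j\<close> yields polynomials in \<open>t\<^sub>j\<close>.\<close>

definition gmap :: "((nat \<Rightarrow>\<^sub>0 nat) \<Rightarrow> nat) \<Rightarrow> ((nat \<Rightarrow>\<^sub>0 nat) \<Rightarrow> (nat \<Rightarrow>\<^sub>0 nat)) \<Rightarrow>
    'k::comm_ring_1 mpoly \<Rightarrow> 'k mpoly poly"
  where "gmap w \<mu> p = (\<Sum>m\<in>Poly_Mapping.keys p.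
    Polynomial.monom (Poly_Mapping.single (\<mu> m) (Poly_Mapping.lookup p m)) (w m))"

locale monomial_grading =
  fixes w :: "(nat \<Rightarrow>\<^sub>0 nat) \<Rightarrow> nat" and \<mu> :: "(nat \<Rightarrow>\<^sub>0 nat) \<Rightarrow> (nat \<Rightarrow>\<^sub>0 nat)"
  assumes w_zero: "w 0 = 0" and w_add: "w (m + m') = w m + w m'"
    and mu_zero: "\<mu> 0 = 0" and mu_add: "\<mu> (m + m') = \<mu> m + \<mu> m'"
begin

lemma gmap_zero [simp]: "gmap w \<mu> 0 = 0"
  by (simp add: gmap_def)

lemma gmap_single: "gmap w \<mu> (Poly_Mapping.single m c) = Polynomial.monom (Poly_Mapping.single (\<mu> m) c) (w m)"
  by (simp add: gmap_def)

lemma gmap_add: "gmap w \<mu> (p + q) = gmap w \<mu> p + gmap w \<mu> q"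
  unfolding gmap_def
  by (rule mpoly_keys_sum_add[where f="\<lambda>m c. Polynomial.monom (Poly_Mapping.single (\<mu> m) c) (w m)"])
    (simp_all add: single_add add_monom)

lemma gmap_mult: "gmap w \<mu> (p * q) = gmap w \<mu> p * gmap w \<mu> q"
proof (induction p rule: mpoly_induct)
  case (single m c)
  show ?case
    by (induction q rule: mpoly_induct)
      (simp_all add: mult_single gmap_single gmap_add distrib_left mult_monom w_add mu_add)
qed (simp add: gmap_add distrib_right)

lemma gmap_mconst: "gmap w \<mu> (mconst c) = [:mconst c:]"
  by (simp add: mconst_def gmap_single w_zero mu_zero monom_0)

lemma gmap_uminus: "gmap w \<mu> (- p) = - gmap w \<mu> p"
  using gmap_add[of p "-p"] by (simp add: eq_neg_iff_add_eq_0 add.commute)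

lemma gmap_diff: "gmap w \<mu> (p - q) = gmap w \<mu> p - gmap w \<mu> q"
  using gmap_add[of p "-q"] by (simp add: gmap_uminus)

lemma gmap_sum: "gmap w \<mu> (sum f S) = (\<Sum>i\<in>S. gmap w \<mu> (f i))"
  by (induction S rule: infinite_finite_induct) (auto simp: gmap_add)

lemma coeff_gmap: "coeff (gmap w \<mu> p) d =
  (\<Sum>m | m \<in> Poly_Mapping.keys p \<and> w m = d. Poly_Mapping.single (\<mu> m) (Poly_Mapping.lookup p m))"
  unfolding gmap_def
  by (simp add: coeff_sum sum.inter_filter)

end

section \<open>Homogeneous components and total degree\<close>

lemma mon_degree_superset: "finite S \<Longrightarrow> Poly_Mapping.keys m \<subseteq> S \<Longrightarrow> mon_degree m = (\<Sum>i\<in>S. Poly_Mapping.lookup m i)"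
  unfolding mon_degree_def by (rule sum.mono_neutral_left) (auto simp: in_keys_iff)

lemma mon_degree_add: "mon_degree (m + m') = mon_degree m + mon_degree m'"
proof -
  let ?S = "Poly_Mapping.keys m \<union> Poly_Mapping.keys m'"
  have "mon_degree (m + m') = (\<Sum>i\<in>?S. Poly_Mapping.lookup (m + m') i)"
    using Poly_Mapping.keys_add[of m m'] by (intro mon_degree_superset) auto
  also have "\<dots> = mon_degree m + mon_degree m'"
    by (simp add: lookup_add sum.distrib mon_degree_superset[of ?S m] mon_degree_superset[of ?S m'])
  finally show ?thesis .
qed

lemma mon_degree_single [simp]: "mon_degree (Poly_Mapping.single i e) = e"
  by (simp add: mon_degree_def)

lemma mon_degree_0 [simp]: "mon_degree 0 = 0"
  by (simp add: mon_degree_def)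

lemma mon_degree_eq_0 [simp]: "mon_degree m = 0 \<longleftrightarrow> m = 0"
  by (auto simp: mon_degree_def in_keys_iff intro!: poly_mapping_eqI)

interpretation tgr: monomial_grading mon_degree "\<lambda>m. m"
  by unfold_locales (simp_all add: mon_degree_add)

interpretation xgr: monomial_grading "\<lambda>m. Poly_Mapping.lookup m j" "\<lambda>m. m - Poly_Mapping.single j (Poly_Mapping.lookup m j)" for j
  by unfold_locales (auto simp: lookup_add lookup_minus lookup_single when_def intro!: poly_mapping_eqI)

definition hcomp :: "nat \<Rightarrow> 'k::comm_ring_1 mpoly \<Rightarrow> 'k mpoly"
  where "hcomp d p = coeff (gmap mon_degree (\<lambda>m. m) p) d"

text \<open>As for univariate polynomials \<open>tdeg 0 = 0\<close>, whence the hypotheses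
  \<open>p \<noteq> 0\<close> in the rules on degrees of products.\<close>

definition tdeg :: "'k::comm_ring_1 mpoly \<Rightarrow> nat"
  where "tdeg p = Polynomial.degree (gmap mon_degree (\<lambda>m. m) p)"

definition xpoly :: "nat \<Rightarrow> 'k::comm_ring_1 mpoly \<Rightarrow> 'k mpoly poly"
  where "xpoly j = gmap (\<lambda>m. Poly_Mapping.lookup m j) (\<lambda>m. m - Poly_Mapping.single j (Poly_Mapping.lookup m j))"

lemma lookup_hcomp: "Poly_Mapping.lookup (hcomp d p) m = (if mon_degree m = d then Poly_Mapping.lookup p m else 0)"
  unfolding hcomp_def tgr.coeff_gmap
  by (auto simp: lookup_sum lookup_single when_def in_keys_iff sum.delta)

lemma hcomp_zero [simp]: "hcomp d 0 = 0"
  by (simp add: hcomp_def)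

lemma hcomp_add: "hcomp d (p + q) = hcomp d p + hcomp d q"
  by (simp add: hcomp_def tgr.gmap_add)

lemma hcomp_uminus: "hcomp d (- p) = - hcomp d p"
  by (simp add: hcomp_def tgr.gmap_uminus)

lemma hcomp_diff: "hcomp d (p - q) = hcomp d p - hcomp d q"
  by (simp add: hcomp_def tgr.gmap_diff)

lemma hcomp_sum: "hcomp d (sum f S) = (\<Sum>i\<in>S. hcomp d (f i))"
  by (simp add: hcomp_def tgr.gmap_sum coeff_sum)

lemma hcomp_mult: "hcomp d (p * q) = (\<Sum>i\<le>d. hcomp i p * hcomp (d - i) q)"
  by (simp add: hcomp_def tgr.gmap_mult coeff_mult)

lemma homogeneous_iff: "homogeneous d p \<longleftrightarrow> (\<forall>m. Poly_Mapping.lookup p m \<noteq> 0 \<longrightarrow> mon_degree m = d)"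
  by (auto simp: homogeneous_def in_keys_iff)

lemma homogeneous_hcomp [simp]: "homogeneous d (hcomp d p)"
  by (auto simp: homogeneous_iff lookup_hcomp split: if_splits)

lemma hcomp_homogeneous: "homogeneous d p \<Longrightarrow> hcomp e p = (if e = d then p else 0)"
  by (auto simp: homogeneous_iff lookup_hcomp intro!: poly_mapping_eqI)

lemma homogeneousI_hcomp: "hcomp d p = p \<Longrightarrow> homogeneous d p"
  by (metis homogeneous_hcomp)

lemma homogeneous_mult: "homogeneous a p \<Longrightarrow> homogeneous b q \<Longrightarrow> homogeneous (a + b) (p * q)"
proof -
  assume pq: "homogeneous a p" "homogeneous b q"
  have "mon_degree m = a + b" if m: "m \<in> Poly_Mapping.keys (p * q)" for m
  proof -
    obtain x y where "m = x + y" "x \<in> Poly_Mapping.keys p" "y \<in> Poly_Mapping.keys q"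
      using keys_mult[of p q] m by blast
    then show ?thesis using pq by (simp add: mon_degree_add homogeneous_def)
  qed
  then show ?thesis by (simp add: homogeneous_def)
qed

lemma homogeneous_tvar [simp]: "homogeneous 1 (tvar i)"
  by (auto simp: tvar_def homogeneous_def)

lemma homogeneous_mconst [simp]: "homogeneous 0 (mconst c)"
  by (auto simp: mconst_def homogeneous_def)

lemma homogeneous_power: "homogeneous a p \<Longrightarrow> homogeneous (e * a) (p ^ e)"
  for p :: "'k::comm_semiring_1 mpoly"
proof (induction e)
  case 0
  then show ?case using homogeneous_mconst[of "1::'k"] by simp
qed (simp add: homogeneous_mult)

lemma homogeneous_0_mconst: "homogeneous 0 p \<Longrightarrow> p = mconst (Poly_Mapping.lookup p 0)"
  by (rule poly_mapping_eqI) (auto simp: homogeneous_iff mconst_def lookup_single when_def)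

lemma hcomp_above_tdeg: "tdeg p < d \<Longrightarrow> hcomp d p = 0"
  by (simp add: tdeg_def hcomp_def coeff_eq_0)

lemma sum_hcomp: "tdeg p \<le> D \<Longrightarrow> (\<Sum>d\<le>D. hcomp d p) = p"
proof (rule poly_mapping_eqI)
  fix m assume D: "tdeg p \<le> D"
  have "Poly_Mapping.lookup p m = 0" if "mon_degree m > D"
    using hcomp_above_tdeg[of p "mon_degree m"] lookup_hcomp[of "mon_degree m" p m] D that by auto
  then show "Poly_Mapping.lookup (\<Sum>d\<le>D. hcomp d p) m = Poly_Mapping.lookup p m"
    by (auto simp: lookup_sum lookup_hcomp)
qed

lemma tdeg_le_iff: "tdeg p \<le> d \<longleftrightarrow> (\<forall>e>d. hcomp e p = 0)"
  unfolding tdeg_def hcomp_def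
  using coeff_eq_0 degree_le order_le_less_trans by blast

lemma gmap_mon_degree_eq_0 [simp]: "gmap mon_degree (\<lambda>m. m) p = 0 \<longleftrightarrow> p = 0"
proof
  assume "gmap mon_degree (\<lambda>m. m) p = 0"
  then have "hcomp d p = 0" for d by (simp add: hcomp_def)
  then show "p = 0" using sum_hcomp[of p "tdeg p"] by simp
qed simp

lemma hcomp_tdeg_nonzero: "p \<noteq> 0 \<Longrightarrow> hcomp (tdeg p) p \<noteq> 0"
  by (metis gmap_mon_degree_eq_0 hcomp_def leading_coeff_0_iff tdeg_def)

lemma tdeg_mult: "p \<noteq> 0 \<Longrightarrow> q \<noteq> 0 \<Longrightarrow> tdeg (p * q) = tdeg p + tdeg q"
  for p :: "'k::idom mpoly"
  by (simp add: tdeg_def tgr.gmap_mult degree_mult_eq)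

lemma hcomp_tdeg_mult: "hcomp (tdeg p + tdeg q) (p * q) = hcomp (tdeg p) p * hcomp (tdeg q) q"
  by (simp add: hcomp_def tdeg_def tgr.gmap_mult coeff_mult_degree_sum)

lemma tdeg_homogeneous: "homogeneous d p \<Longrightarrow> p \<noteq> 0 \<Longrightarrow> tdeg p = d"
  by (metis hcomp_homogeneous hcomp_tdeg_nonzero)

lemma tdeg_eq_0_mconst: "tdeg p = 0 \<Longrightarrow> p = mconst (Poly_Mapping.lookup p 0)"
  using sum_hcomp[of p 0] homogeneous_0_mconst[of p] homogeneous_hcomp[of 0 p] by simp

lemma tdeg_mconst [simp]: "tdeg (mconst c) = 0"
  by (simp add: tdeg_def tgr.gmap_mconst)

lemma pvars_hcomp: "p \<in> pvars V \<Longrightarrow> hcomp d p \<in> pvars V"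
  by (auto simp: pvars_iff lookup_hcomp split: if_splits)

lemma is_unit_mpoly_iff: "p dvd 1 \<longleftrightarrow> p \<noteq> 0 \<and> tdeg p = 0"
  for p :: "'k::field mpoly"
proof
  assume "p dvd 1"
  then obtain q where q: "1 = p * q" by (auto elim: dvdE)
  then have "p \<noteq> 0" "q \<noteq> 0" by auto
  then have "tdeg p + tdeg q = tdeg (1::'k mpoly)" using q by (simp flip: tdeg_mult)
  then show "p \<noteq> 0 \<and> tdeg p = 0" using \<open>p \<noteq> 0\<close> tdeg_mconst[of "1::'k"] by simp
next
  assume p: "p \<noteq> 0 \<and> tdeg p = 0"
  then have *: "p = mconst (Poly_Mapping.lookup p 0)" by (intro tdeg_eq_0_mconst) auto
  then have "Poly_Mapping.lookup p 0 \<noteq> 0" using p by (metis mconst_0)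
  then show "p dvd 1" using is_unit_mconst * by metis
qed

section \<open>Polynomials in one variable over the remaining ones\<close>

lemma xpoly_single: "xpoly j (Poly_Mapping.single m c) =
    Polynomial.monom (Poly_Mapping.single (m - Poly_Mapping.single j (Poly_Mapping.lookup m j)) c) (Poly_Mapping.lookup m j)"
  by (simp add: xpoly_def xgr.gmap_single)

lemma xpoly_zero [simp]: "xpoly j 0 = 0"
  by (simp add: xpoly_def)

lemma xpoly_add: "xpoly j (p + q) = xpoly j p + xpoly j q"
  by (simp add: xpoly_def xgr.gmap_add)

lemma xpoly_diff: "xpoly j (p - q) = xpoly j p - xpoly j q"
  by (simp add: xpoly_def xgr.gmap_diff)

lemma xpoly_mult: "xpoly j (p * q) = xpoly j p * xpoly j q"
  by (simp add: xpoly_def xgr.gmap_mult)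

text \<open>Substituting the variable back undoes the splitting; this is why \<open>xpoly j\<close>
  is injective.\<close>

lemma poly_xpoly: "poly (xpoly j p) (tvar j) = p"
proof (induction p rule: mpoly_induct)
  case (single m c)
  have "m - Poly_Mapping.single j (Poly_Mapping.lookup m j) + Poly_Mapping.single j (Poly_Mapping.lookup m j) = m"
    by (auto simp: lookup_add lookup_minus lookup_single when_def intro!: poly_mapping_eqI)
  then show ?case
    by (simp add: xpoly_single poly_monom tvar_power mult_single)
qed (simp add: xpoly_add)

lemma xpoly_eq_0 [simp]: "xpoly j p = 0 \<longleftrightarrow> p = 0"
  by (metis poly_xpoly poly_0 xpoly_zero)

lemma xpoly_const: "p \<in> pvars (- {j}) \<Longrightarrow> xpoly j p = [:p:]"
proof -
  assume p: "p \<in> pvars (- {j})"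
  have "xpoly j p = (\<Sum>m\<in>Poly_Mapping.keys p. Polynomial.monom (Poly_Mapping.single m (Poly_Mapping.lookup p m)) 0)"
    unfolding xpoly_def gmap_def
  proof (rule sum.cong)
    fix m assume "m \<in> Poly_Mapping.keys p"
    then have "Poly_Mapping.lookup m j = 0" using p by (auto simp: pvars_iff in_keys_iff)
    then show "Polynomial.monom (Poly_Mapping.single (m - Poly_Mapping.single j (Poly_Mapping.lookup m j)) (Poly_Mapping.lookup p m)) (Poly_Mapping.lookup m j)
        = Polynomial.monom (Poly_Mapping.single m (Poly_Mapping.lookup p m)) 0" by simp
  qed simp
  also have "\<dots> = [:\<Sum>m\<in>Poly_Mapping.keys p. Poly_Mapping.single m (Poly_Mapping.lookup p m):]"
    by (simp add: monom_0 sum_to_poly)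
  finally show ?thesis using mpoly_sum_single[of p] by simp
qed

lemma coeff_xpoly_pvars: "p \<in> pvars V \<Longrightarrow> coeff (xpoly j p) i \<in> pvars (V - {j})"
proof -
  assume p: "p \<in> pvars V"
  show ?thesis unfolding xpoly_def xgr.coeff_gmap
  proof (intro pvars_sum pvars_single subsetI)
    fix m x assume "m \<in> {m \<in> Poly_Mapping.keys p. Poly_Mapping.lookup m j = i}"
      "x \<in> Poly_Mapping.keys (m - Poly_Mapping.single j (Poly_Mapping.lookup m j))"
    then show "x \<in> V - {j}" using p
      unfolding pvars_iff in_keys_iff lookup_minus lookup_single when_def
      by (cases "x = j") (auto, metis less_not_refl)
  qed
qed

lemma xpoly_degree_0:
  assumes "Polynomial.degree (xpoly j p) = 0" "p \<in> pvars V"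
  shows "p \<in> pvars (V - {j})"
proof -
  have "xpoly j p = [:coeff (xpoly j p) 0:]"
    using assms(1) by (metis degree_0_id)
  then have "p = coeff (xpoly j p) 0"
    using poly_xpoly[of j p] by (metis mult_zero_right add.right_neutral poly_0 poly_pCons)
  then show ?thesis using coeff_xpoly_pvars[OF assms(2), of j 0] by simp
qed

section \<open>Irreducible polynomials are prime\<close>

text \<open>Only the factors are confined to V, while divisibility is that of the ring in all
  variables. V is the parameter of the induction in \<open>irreducible_imp_prime_in\<close>.\<close>

definition prime_in :: "nat set \<Rightarrow> 'k::field mpoly \<Rightarrow> bool"
  where "prime_in V p \<longleftrightarrow> (\<forall>a\<in>pvars V. \<forall>b\<in>pvars V. p dvd a * b \<longrightarrow> p dvd a \<or> p dvd b)"

text \<open>A polynomial free of \<open>t\<^sub>j\<close> becomes a constant under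
  \<open>xpoly j\<close>, and constants divide coefficientwise.\<close>

lemma dvd_iff_coeff_xpoly:
  fixes p :: "'k::field mpoly"
  assumes "p \<in> pvars (- {j})"
  shows "p dvd a \<longleftrightarrow> (\<forall>i. p dvd coeff (xpoly j a) i)"
proof
  assume "p dvd a"
  then obtain u where "a = p * u" by (auto elim: dvdE)
  then have "xpoly j a = Polynomial.smult p (xpoly j u)" by (simp add: xpoly_mult xpoly_const[OF assms])
  then show "\<forall>i. p dvd coeff (xpoly j a) i" by simp
next
  assume "\<forall>i. p dvd coeff (xpoly j a) i"
  then have "[:p:] dvd xpoly j a" by (simp add: const_poly_dvd_iff)
  then obtain q where "xpoly j a = [:p:] * q" by (auto elim: dvdE)
  then have "poly (xpoly j a) (tvar j) = p * poly q (tvar j)" by simp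
  then show "p dvd a" by (simp add: poly_xpoly)
qed

text \<open>The argument of Gauss: if p divides neither a nor b, let \<open>A i0\<close> and
  \<open>B j0\<close> be their first coefficients in \<open>t\<^sub>j\<close> that p does not
  divide. In the coefficient of \<open>a * b\<close> at \<open>i0 + j0\<close> every term other than
  \<open>A i0 * B j0\<close> is divisible by p.\<close>

lemma prime_in_extend:
  fixes p :: "'k::field mpoly"
  assumes p: "p \<in> pvars (V - {j})" and prime: "prime_in (V - {j}) p"
  shows "prime_in V p"
  unfolding prime_in_def
proof (intro ballI impI)
  fix a b assume a: "a \<in> pvars V" and b: "b \<in> pvars V" and ab: "p dvd a * b"
  have pj: "p \<in> pvars (- {j})" using p by (rule pvars_mono[rotated]) auto
  note iff = dvd_iff_coeff_xpoly[OF pj]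
  show "p dvd a \<or> p dvd b"
  proof (rule ccontr)
    assume neg: "\<not> (p dvd a \<or> p dvd b)"
    define A where "A = coeff (xpoly j a)"
    define B where "B = coeff (xpoly j b)"
    define i0 where "i0 = (LEAST i. \<not> p dvd A i)"
    define j0 where "j0 = (LEAST i. \<not> p dvd B i)"
    have i0: "\<not> p dvd A i0" "\<And>i. i < i0 \<Longrightarrow> p dvd A i"
      using neg iff[of a] not_less_Least LeastI_ex[of "\<lambda>i. \<not> p dvd A i"] unfolding i0_def A_def by blast+
    have j0: "\<not> p dvd B j0" "\<And>i. i < j0 \<Longrightarrow> p dvd B i"
      using neg iff[of b] not_less_Least LeastI_ex[of "\<lambda>i. \<not> p dvd B i"] unfolding j0_def B_def by blast+
    have "coeff (xpoly j (a * b)) (i0 + j0) = (\<Sum>i\<le>i0 + j0. A i * B (i0 + j0 - i))"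
      by (simp add: xpoly_mult coeff_mult A_def B_def)
    also have "\<dots> = A i0 * B j0 + (\<Sum>i\<in>{..i0 + j0} - {i0}. A i * B (i0 + j0 - i))"
      by (subst sum.remove[of _ i0]) auto
    finally have eq: "coeff (xpoly j (a * b)) (i0 + j0) = \<dots>" .
    have "p dvd (\<Sum>i\<in>{..i0 + j0} - {i0}. A i * B (i0 + j0 - i))"
    proof (rule dvd_sum)
      fix i assume i: "i \<in> {..i0 + j0} - {i0}"
      show "p dvd A i * B (i0 + j0 - i)"
      proof (cases "i < i0")
        case False
        then have "i0 + j0 - i < j0" using i by auto
        then show ?thesis using j0(2) by auto
      qed (use i0(2) in auto)
    qed
    moreover have "p dvd coeff (xpoly j (a * b)) (i0 + j0)" using ab iff by blast
    ultimately have "p dvd A i0 * B j0" unfolding eq by (simp only: dvd_add_left_iff)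
    then show False
      using prime i0(1) j0(1) coeff_xpoly_pvars[OF a] coeff_xpoly_pvars[OF b]
      unfolding prime_in_def A_def B_def by blast
  qed
qed

text \<open>Degrees in each single variable add up, so a factor of a nonzero polynomial of degree 0
  in \<open>t\<^sub>j\<close> has degree 0 in \<open>t\<^sub>j\<close>.\<close>

lemma pvars_factor:
  fixes a b :: "'k::field mpoly"
  assumes "a * b \<in> pvars V" "a * b \<noteq> 0"
  shows "a \<in> pvars V"
proof -
  have "a \<in> pvars (- {j})" if "j \<notin> V" for j
  proof -
    have "a * b \<in> pvars (- {j})" using assms(1) by (rule pvars_mono[rotated]) (use that in auto)
    then have "Polynomial.degree (xpoly j a * xpoly j b) = 0"
      by (simp add: xpoly_const flip: xpoly_mult)
    then have "Polynomial.degree (xpoly j a) = 0" using assms(2) by (simp add: degree_mult_eq)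
    then have "a \<in> pvars (UNIV - {j})" by (intro xpoly_degree_0) (auto simp: pvars_def)
    then show ?thesis by (simp add: Compl_eq_Diff_UNIV)
  qed
  then show ?thesis unfolding pvars_iff by blast
qed

lemma pvars_factor': "a * b \<in> pvars V \<Longrightarrow> a * b \<noteq> 0 \<Longrightarrow> b \<in> pvars V"
  for a b :: "'k::field mpoly"
  using pvars_factor[of b a V] by (simp add: mult.commute)

lemma irreducible_factor_exists:
  fixes r :: "'k::field mpoly"
  assumes "r \<noteq> 0" "\<not> r dvd 1"
  shows "\<exists>q u. irreducible q \<and> r = q * u"
  using assms
proof (induction "tdeg r" arbitrary: r rule: less_induct)
  case less
  show ?case
  proof (cases "irreducible r")
    case True
    then show ?thesis by (metis mult.right_neutral)
  next
    case False
    then obtain a b where ab: "r = a * b" "\<not> a dvd 1" "\<not> b dvd 1"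
      using less.prems unfolding irreducible_def by blast
    then have nz: "a \<noteq> 0" "b \<noteq> 0" using less.prems by auto
    then have "tdeg a < tdeg r" using ab by (simp add: tdeg_mult is_unit_mpoly_iff)
    then obtain q u where "irreducible q" "a = q * u" using less.hyps[of a] ab(2) nz by blast
    then have "irreducible q \<and> r = q * (u * b)" using ab(1) by (simp add: mult.assoc)
    then show ?thesis by blast
  qed
qed

lemma irreducible_factor_pvars:
  fixes r :: "'k::field mpoly"
  assumes "r \<noteq> 0" "\<not> r dvd 1" "r \<in> pvars W"
  obtains q u where "irreducible q" "r = q * u" "q \<in> pvars W" "u \<in> pvars W" "u \<noteq> 0" "tdeg u < tdeg r"
proof -
  obtain q u where q: "irreducible q" "r = q * u" using irreducible_factor_exists assms(1,2) by blast
  have nz: "q \<noteq> 0" "u \<noteq> 0" using assms(1) q(2) by auto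
  have "\<not> q dvd 1" using q(1) by (simp add: irreducible_def)
  then have "tdeg u < tdeg r" using q(2) nz by (simp add: tdeg_mult is_unit_mpoly_iff)
  then show thesis
    using that q nz pvars_factor[of q u W] pvars_factor'[of q u W] assms(1,3) by blast
qed

section \<open>Cancelling polynomials in fewer variables\<close>

context
  fixes W V :: "nat set" and K :: "'k::field itself"
  assumes WV: "W \<subseteq> V"
    and primes: "\<And>q :: 'k mpoly. q \<in> pvars W \<Longrightarrow> irreducible q \<Longrightarrow> prime_in V q"
begin

text \<open>The irreducible factors of r are removed one by one: each of them is prime, divides
  \<open>p * y\<close> but not p, and hence can be cancelled from y.\<close>

lemma dvd_cancel_coprime:
  fixes p :: "'k mpoly"
  assumes p: "p \<in> pvars V" "\<And>q. q \<in> pvars W \<Longrightarrow> irreducible q \<Longrightarrow> \<not> q dvd p"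
  shows "r \<in> pvars W \<Longrightarrow> r \<noteq> 0 \<Longrightarrow> a \<in> pvars V \<Longrightarrow> p dvd r * a \<Longrightarrow> p dvd a"
proof (induction "tdeg r" arbitrary: r rule: less_induct)
  case less
  show ?case
  proof (cases "r dvd 1 \<or> a = 0")
    case True
    then show ?thesis
    proof
      assume "r dvd 1"
      then obtain s where "1 = r * s" by (auto elim: dvdE)
      then have "a = s * (r * a)" by (metis mult.assoc mult.commute mult_1)
      then show ?thesis using less.prems(4) by (metis dvd_mult)
    qed simp
  next
    case False
    obtain q u where qu: "irreducible q" "r = q * u" "q \<in> pvars W" "u \<in> pvars W" "u \<noteq> 0" "tdeg u < tdeg r"
      using irreducible_factor_pvars less.prems(1,2) False by blast
    obtain y where y: "r * a = p * y" using less.prems(4) by (auto elim: dvdE)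
    have "p * y \<in> pvars V"
      using less.prems(1,3) WV pvars_mono pvars_mult y by metis
    then have yV: "y \<in> pvars V" using pvars_factor' y False less.prems(2) by (metis mult_eq_0_iff)
    have "q dvd p * y" using y qu(2) by (metis dvd_triv_left mult.assoc)
    then have "q dvd y" using primes[OF qu(3,1)] p qu(1,3) yV unfolding prime_in_def by blast
    then obtain z where z: "y = q * z" by (auto elim: dvdE)
    have "q \<noteq> 0" using less.prems(2) qu(2) by auto
    moreover have "q * (u * a) = q * (p * z)" using y qu(2) z by (simp add: ac_simps)
    ultimately have "u * a = p * z" by simp
    then show ?thesis using less.hyps[OF qu(6,4,5) less.prems(3)] by simp
  qed
qed

text \<open>Clearing denominators: every irreducible factor of r divides q or c and is cancelled
  there, and those taken out of c are collected in u. So c differs from a true factor c' of p only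
  by a polynomial in the variables W.\<close>

lemma factor_split:
  fixes p :: "'k mpoly"
  assumes p: "p \<in> pvars V" "p \<noteq> 0"
  shows "r \<in> pvars W \<Longrightarrow> r \<noteq> 0 \<Longrightarrow> r * p = q * c \<Longrightarrow>
    \<exists>q' c' u. p = q' * c' \<and> c = u * c' \<and> u \<in> pvars W"
proof (induction "tdeg r" arbitrary: r q c rule: less_induct)
  case less
  have "r * p \<in> pvars V" using less.prems(1) p(1) WV pvars_mono pvars_mult by metis
  then have qc: "q \<in> pvars V" "c \<in> pvars V"
    using pvars_factor pvars_factor' less.prems(2,3) p(2) by (metis mult_eq_0_iff)+
  show ?case
  proof (cases "r dvd 1")
    case True
    then obtain s where "1 = r * s" by (auto elim: dvdE)
    then have "p = (s * q) * c" using less.prems(3) by (metis mult.assoc mult.commute mult_1)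
    then show ?thesis using pvars_one by (metis mult_1)
  next
    case False
    obtain x u where xu: "irreducible x" "r = x * u" "x \<in> pvars W" "u \<in> pvars W" "u \<noteq> 0" "tdeg u < tdeg r"
      using irreducible_factor_pvars less.prems(1,2) False by blast
    have x0: "x \<noteq> 0" using less.prems(2) xu(2) by auto
    have "x dvd q * c" using less.prems(3) xu(2) by (metis dvd_triv_left mult.assoc)
    then consider "x dvd q" | "x dvd c" using primes[OF xu(3,1)] qc unfolding prime_in_def by blast
    then show ?thesis
    proof cases
      case 1
      then obtain z where "q = x * z" by (auto elim: dvdE)
      then have "x * (u * p) = x * (z * c)" using less.prems(3) xu(2) by (simp add: ac_simps)
      then have "u * p = z * c" using x0 by simp
      then show ?thesis using less.hyps[OF xu(6,4,5)] by blast
    next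
      case 2
      then obtain z where z: "c = x * z" by (auto elim: dvdE)
      then have "x * (u * p) = x * (q * z)" using less.prems(3) xu(2) by (simp add: ac_simps)
      then have "u * p = q * z" using x0 by simp
      then obtain q' c' v where *: "p = q' * c'" "z = v * c'" "v \<in> pvars W"
        using less.hyps[OF xu(6,4,5)] by blast
      then have "c = (x * v) * c'" using z by (simp add: mult.assoc)
      then show ?thesis using * xu(3) pvars_mult by blast
    qed
  qed
qed

end

lemma tdeg_0_pvars: "tdeg p = 0 \<Longrightarrow> p \<in> pvars V"
  using tdeg_eq_0_mconst[of p] pvars_mconst by metis

lemma xpoly_tvar_power: "xpoly j (tvar j ^ e) = Polynomial.monom 1 e"
  by (simp add: tvar_power xpoly_single)

text \<open>The cofactor of q in the irreducible p would be a constant, which would make p as free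
  of \<open>t\<^sub>j\<close> as q is.\<close>

lemma no_const_factor:
  fixes p q :: "'k::field mpoly"
  assumes "irreducible p" "Polynomial.degree (xpoly j p) > 0" "q \<in> pvars (V - {j})" "irreducible q"
  shows "\<not> q dvd p"
proof
  assume "q dvd p"
  then obtain y where y: "p = q * y" by (auto elim: dvdE)
  have "\<not> q dvd 1" using assms(4) by (simp add: irreducible_def)
  then have "y dvd 1" using assms(1) y by (auto simp: irreducible_def)
  then have "y \<in> pvars (V - {j})" using is_unit_mpoly_iff tdeg_0_pvars by blast
  then have "p \<in> pvars (V - {j})" using y assms(3) pvars_mult by blast
  then have "p \<in> pvars (- {j})" by (rule pvars_mono[rotated]) auto
  then show False using assms(2) by (simp add: xpoly_const)
qed

text \<open>Pseudo-division by an element \<open>c\<close> of minimal degree in \<open>t\<^sub>j\<close> of the ideal \<open>(p, f)\<close> shows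
  that \<open>c\<close> divides multiples \<open>r p\<close> and \<open>s f\<close> with \<open>r\<close>, \<open>s\<close> free of \<open>t\<^sub>j\<close>.\<close>

lemma elimination_step:
  fixes p f :: "'k::field mpoly"
  assumes primes: "\<And>q :: 'k mpoly. q \<in> pvars (V - {j}) \<Longrightarrow> irreducible q \<Longrightarrow> prime_in V q"
    and p: "p \<in> pvars V" "irreducible p" "Polynomial.degree (xpoly j p) > 0"
    and f: "f \<in> pvars V" "\<not> p dvd f" and j: "j \<in> V"
  shows "\<exists>c \<alpha> \<beta>. c = \<alpha> * p + \<beta> * f \<and> c \<noteq> 0 \<and> c \<in> pvars (V - {j}) \<and> \<alpha> \<in> pvars V \<and> \<beta> \<in> pvars V"
proof -
  define J where "J = {\<alpha> * p + \<beta> * f | \<alpha> \<beta>. \<alpha> \<in> pvars V \<and> \<beta> \<in> pvars V}"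
  have JI: "\<alpha> * p + \<beta> * f \<in> J" if "\<alpha> \<in> pvars V" "\<beta> \<in> pvars V" for \<alpha> \<beta>
    using that unfolding J_def by blast
  have p0: "p \<noteq> 0" using p(2) by (simp add: irreducible_def)
  have pJ: "p \<in> J" using JI[of 1 0] by simp
  have fJ: "f \<in> J" using JI[of 0 1] by simp
  have Jmult: "x * e \<in> J" if xV: "x \<in> pvars V" and eJ: "e \<in> J" for x e
  proof -
    obtain \<alpha> \<beta> where "e = \<alpha> * p + \<beta> * f" "\<alpha> \<in> pvars V" "\<beta> \<in> pvars V" using eJ unfolding J_def by blast
    then have "x * e = (x * \<alpha>) * p + (x * \<beta>) * f" by (simp add: algebra_simps)
    then show ?thesis using JI pvars_mult xV \<open>\<alpha> \<in> pvars V\<close> \<open>\<beta> \<in> pvars V\<close> by metis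
  qed
  have Jdiff: "x - y \<in> J" if xJ: "x \<in> J" and yJ: "y \<in> J" for x y
  proof -
    obtain \<alpha> \<beta> where 1: "x = \<alpha> * p + \<beta> * f" "\<alpha> \<in> pvars V" "\<beta> \<in> pvars V" using xJ unfolding J_def by blast
    obtain \<alpha>' \<beta>' where 2: "y = \<alpha>' * p + \<beta>' * f" "\<alpha>' \<in> pvars V" "\<beta>' \<in> pvars V" using yJ unfolding J_def by blast
    have "x - y = (\<alpha> - \<alpha>') * p + (\<beta> - \<beta>') * f" using 1 2 by (simp add: algebra_simps)
    then show ?thesis using JI pvars_diff 1 2 by metis
  qed
  have JV: "e \<in> pvars V" if "e \<in> J" for e
    using that p(1) f(1) unfolding J_def by (auto intro: pvars_add pvars_mult)
  let ?deg = "\<lambda>e. Polynomial.degree (xpoly j e)"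
  obtain c where c: "c \<in> J" "c \<noteq> 0" and cmin: "\<And>e. e \<in> J \<Longrightarrow> e \<noteq> 0 \<Longrightarrow> ?deg c \<le> ?deg e"
    using ex_has_least_nat[of "\<lambda>c. c \<in> J \<and> c \<noteq> 0" p ?deg] pJ p0 by blast
  \<comment> \<open>The multiplier is a power of the leading coefficient of c in
    \<open>t\<^sub>j\<close>.\<close>
  have cdvd: "\<exists>r\<in>pvars (V - {j}). r \<noteq> 0 \<and> c dvd r * e" if "e \<in> J" for e
    using that
  proof (induction "?deg e" arbitrary: e rule: less_induct)
    case less
    show ?case
    proof (cases "e = 0")
      case True
      then show ?thesis by (intro bexI[of _ 1]) auto
    next
      case False
      define lc where "lc = lead_coeff (xpoly j c)"
      define ld where "ld = lead_coeff (xpoly j e)"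
      define k where "k = ?deg e - ?deg c"
      have de: "?deg e = ?deg c + k" using cmin[OF less.prems False] by (simp add: k_def)
      have lcW: "lc \<in> pvars (V - {j})" "lc \<noteq> 0" using coeff_xpoly_pvars[OF JV[OF c(1)]] c(2) by (simp_all add: lc_def)
      have ldW: "ld \<in> pvars (V - {j})" using coeff_xpoly_pvars[OF JV[OF less.prems]] by (simp add: ld_def)
      have sub: "x \<in> pvars V" if "x \<in> pvars (V - {j})" for x :: "'k mpoly"
        using that by (rule pvars_mono[rotated]) auto
      have sub': "x \<in> pvars (- {j})" if "x \<in> pvars (V - {j})" for x :: "'k mpoly"
        using that by (rule pvars_mono[rotated]) auto
      \<comment> \<open>One step of pseudo-division: the leading coefficients are cross-multiplied
        so that the top terms in \<open>t\<^sub>j\<close> cancel without any division.\<close>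
      define e' where "e' = lc * e - (ld * tvar j ^ k) * c"
      have e'J: "e' \<in> J" unfolding e'_def
        by (intro Jdiff Jmult sub[OF lcW(1)] pvars_mult sub[OF ldW] less.prems c(1) pvars_power[OF pvars_tvar[OF j]])
      have xe': "xpoly j e' = Polynomial.smult lc (xpoly j e) - Polynomial.monom ld k * xpoly j c"
        by (simp add: e'_def xpoly_diff xpoly_mult xpoly_const sub'[OF lcW(1)] sub'[OF ldW] xpoly_tvar_power
            smult_monom)
      have "?deg e' \<le> ?deg e" unfolding xe'
        by (intro degree_diff_le degree_smult_le order_trans[OF degree_mult_le])
          (use degree_monom_le[of ld k] de in auto)
      moreover have "coeff (xpoly j e') (?deg e) = 0"
        using coeff_monom_mult[of ld k "xpoly j c" "?deg e"] by (simp add: xe' de lc_def ld_def)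
      ultimately have "e' = 0 \<or> ?deg e' < ?deg e" using eq_zero_or_degree_less[of "xpoly j e'" "?deg e"] by simp
      then show ?thesis
      proof
        assume "e' = 0"
        then have "c dvd lc * e" by (simp add: e'_def)
        then show ?thesis using lcW by blast
      next
        assume "?deg e' < ?deg e"
        then obtain r where r: "r \<in> pvars (V - {j})" "r \<noteq> 0" "c dvd r * e'"
          using less.hyps e'J by blast
        have eq: "(r * lc) * e = r * e' + (r * ld * tvar j ^ k) * c" by (simp add: e'_def algebra_simps)
        have "c dvd (r * lc) * e" unfolding eq by (intro dvd_add r(3) dvd_triv_right)
        then show ?thesis using r(1,2) lcW by (intro bexI[of _ "r * lc"]) (auto intro: pvars_mult)
      qed
    qed
  qed
  obtain r where r: "r \<in> pvars (V - {j})" "r \<noteq> 0" "c dvd r * p"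
    using cdvd[OF pJ] by blast
  obtain q where q: "r * p = q * c"
    using r(3) unfolding dvd_def by (metis mult.commute)
  obtain q' c' u where s: "p = q' * c'" "c = u * c'" "u \<in> pvars (V - {j})"
    using factor_split[of "V - {j}" V p r q c] primes p(1) p0 r q by blast
  \<comment> \<open>As p is irreducible, c' or q' is a unit. In the first case c is u up to a
    constant. In the second p divides c, hence a multiple \<open>r' * f\<close> with r' free of
    \<open>t\<^sub>j\<close>; cancelling r' would give \<open>p dvd f\<close>.\<close>
  have "c \<in> pvars (V - {j})"
  proof -
    have "q' dvd 1 \<or> c' dvd 1" using p(2) s(1) by (auto simp: irreducible_def)
    then show ?thesis
    proof
      assume "c' dvd 1"
      then show ?thesis using s is_unit_mpoly_iff tdeg_0_pvars pvars_mult by blast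
    next
      assume "q' dvd 1"
      then obtain z where z: "1 = q' * z" by (auto elim: dvdE)
      have "z * p = (q' * z) * c'" using s(1) by (simp only: ac_simps)
      then have "c = p * (u * z)" using s(2) z by (simp add: ac_simps)
      then have "p dvd c" by simp
      moreover obtain r' where r': "r' \<in> pvars (V - {j})" "r' \<noteq> 0" "c dvd r' * f" using cdvd[OF fJ] by blast
      ultimately have "p dvd r' * f" by (rule_tac dvd_trans)
      then have "p dvd f"
        using dvd_cancel_coprime[of "V - {j}" V p r' f] primes p(1) no_const_factor[OF p(2,3)] r' f(1) by blast
      then show ?thesis using f(2) by simp
    qed
  qed
  then show ?thesis using c unfolding J_def by blast
qed

lemma pvars_empty: "p \<in> pvars {} \<Longrightarrow> tdeg p = 0"
proof -
  assume "p \<in> pvars {}"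
  then have "homogeneous 0 p" unfolding pvars_def homogeneous_def by auto
  then have "p = mconst (Poly_Mapping.lookup p 0)" by (rule homogeneous_0_mconst)
  then show ?thesis using tdeg_mconst by metis
qed

text \<open>Induction on the number of variables. If p is free of \<open>t\<^sub>j\<close>,
  primality extends by \<open>prime_in_extend\<close>. Otherwise, when p does not divide a,
  elimination yields a nonzero \<open>c = \<alpha> * p + \<beta> * a\<close> free of
  \<open>t\<^sub>j\<close>; then p divides \<open>c * b\<close>, and c can be cancelled since p has
  no irreducible factor free of \<open>t\<^sub>j\<close>.\<close>

theorem irreducible_imp_prime_in:
  fixes p :: "'k::field mpoly"
  assumes "finite V" "p \<in> pvars V" "irreducible p"
  shows "prime_in V p"
  using assms
proof (induction V arbitrary: p rule: finite_induct)
  case empty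
  then show ?case using pvars_empty is_unit_mpoly_iff by (auto simp: irreducible_def)
next
  case (insert j W)
  let ?V = "insert j W"
  have W: "?V - {j} = W" using insert.hyps by auto
  have primes: "prime_in ?V q" if "q \<in> pvars (?V - {j})" "irreducible q" for q :: "'k mpoly"
    using prime_in_extend[OF that(1)] insert.IH[of q] that W by simp
  show ?case
  proof (cases "Polynomial.degree (xpoly j p) = 0")
    case True
    then show ?thesis using xpoly_degree_0 insert.prems primes by blast
  next
    case False
    show ?thesis unfolding prime_in_def
    proof (intro ballI impI)
      fix a b assume a: "a \<in> pvars ?V" and b: "b \<in> pvars ?V" and ab: "p dvd a * b"
      show "p dvd a \<or> p dvd b"
      proof (cases "p dvd a")
        case na: False
        obtain c \<alpha> \<beta> where c: "c = \<alpha> * p + \<beta> * a" "c \<noteq> 0" "c \<in> pvars (?V - {j})"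
          using elimination_step[of ?V j p a] primes insert.prems False a na by blast
        have "c * b = p * (\<alpha> * b) + \<beta> * (a * b)" by (simp add: c(1) algebra_simps)
        then have "p dvd c * b" using ab by simp
        then show ?thesis
          using dvd_cancel_coprime[of "?V - {j}" ?V p c b] primes insert.prems
            no_const_factor[of p j] False c b by blast
      qed simp
    qed
  qed
qed

text \<open>The step of the induction, now freed of its primality hypothesis. It will be applied to
  \<open>p = \<Omega>\<close> and a form f whose degree drops.\<close>

theorem elimination:
  fixes p f :: "'k::field mpoly"
  assumes "finite V" "j \<in> V" "p \<in> pvars V" "irreducible p" "Polynomial.degree (xpoly j p) > 0"
    and "f \<in> pvars V" "\<not> p dvd f"
  shows "\<exists>c \<alpha> \<beta>. c = \<alpha> * p + \<beta> * f \<and> c \<noteq> 0 \<and> c \<in> pvars (V - {j}) \<and> \<alpha> \<in> pvars V \<and> \<beta> \<in> pvars V"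
proof (rule elimination_step)
  fix q :: "'k mpoly" assume "q \<in> pvars (V - {j})" "irreducible q"
  then show "prime_in V q"
    using irreducible_imp_prime_in[of V q] assms(1) pvars_mono[of "V - {j}" V q] by blast
qed (use assms in auto)

section \<open>Partial derivatives and irreducibility of potentials\<close>

lemma partial_deriv_single:
  "partial_deriv i (Poly_Mapping.single m c) =
    Poly_Mapping.single (m - Poly_Mapping.single i 1) (of_nat (Poly_Mapping.lookup m i) * c)"
  by (simp add: partial_deriv_def)

lemma partial_deriv_zero [simp]: "partial_deriv i 0 = 0"
  by (simp add: partial_deriv_def)

lemma partial_deriv_add: "partial_deriv i (p + q) = partial_deriv i p + partial_deriv i q"
  unfolding partial_deriv_def
  by (rule mpoly_keys_sum_add[where f="\<lambda>m c. Poly_Mapping.single (m - Poly_Mapping.single i 1)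
      (of_nat (Poly_Mapping.lookup m i) * c)"]) (simp_all add: single_add algebra_simps)

lemma partial_deriv_sum: "partial_deriv i (sum f S) = (\<Sum>x\<in>S. partial_deriv i (f x))"
  by (induction S rule: infinite_finite_induct) (auto simp: partial_deriv_add)

lemma partial_deriv_mult: "partial_deriv i (p * q) = p * partial_deriv i q + partial_deriv i p * q"
proof (induction p rule: mpoly_induct)
  case (single m c)
  show ?case
  proof (induction q rule: mpoly_induct)
    case (single m' c')
    let ?e = "Poly_Mapping.single i (1::nat)"
    \<comment> \<open>Truncated subtraction commutes with adding exponents only where the exponent
      of \<open>t\<^sub>i\<close> is positive; where it is 0 the coefficient vanishes.\<close>
    have l: "m - ?e + m' = m + m' - ?e" if "Poly_Mapping.lookup m i \<noteq> 0"
      using that by (intro poly_mapping_eqI) (auto simp: lookup_add lookup_minus lookup_single when_def)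
    have r: "m + (m' - ?e) = m + m' - ?e" if "Poly_Mapping.lookup m' i \<noteq> 0"
      using that by (intro poly_mapping_eqI) (auto simp: lookup_add lookup_minus lookup_single when_def)
    have 1: "Poly_Mapping.single (m - ?e + m') (of_nat (Poly_Mapping.lookup m i) * c * c') =
        Poly_Mapping.single (m + m' - ?e) (of_nat (Poly_Mapping.lookup m i) * c * c')"
      by (cases "Poly_Mapping.lookup m i = 0") (simp, subst l, simp_all)
    have 2: "Poly_Mapping.single (m + (m' - ?e)) (c * (of_nat (Poly_Mapping.lookup m' i) * c')) =
        Poly_Mapping.single (m + m' - ?e) (c * (of_nat (Poly_Mapping.lookup m' i) * c'))"
      by (cases "Poly_Mapping.lookup m' i = 0") (simp, subst r, simp_all)
    show ?case
      unfolding mult_single partial_deriv_single 1 2 single_add[symmetric]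
      by (simp add: lookup_add algebra_simps)
  qed (simp add: partial_deriv_add algebra_simps)
qed (simp add: partial_deriv_add algebra_simps)

lemma partial_deriv_commute: "partial_deriv i (partial_deriv j p) = partial_deriv j (partial_deriv i p)"
proof (induction p rule: mpoly_induct)
  case (single m c)
  show ?case
    by (cases "i = j")
      (simp_all add: partial_deriv_single lookup_minus lookup_single_not_eq diff_diff_eq ac_simps)
qed (simp add: partial_deriv_add)

lemma partial_deriv_mconst [simp]: "partial_deriv i (mconst c) = 0"
  by (simp add: mconst_def partial_deriv_single)

lemma partial_deriv_one [simp]: "partial_deriv i 1 = 0"
  using partial_deriv_mconst[of i 1] by simp

lemma partial_deriv_smult: "partial_deriv i (mconst c * p) = mconst c * partial_deriv i p"
  by (simp add: partial_deriv_mult)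

lemma partial_deriv_uminus: "partial_deriv i (- p) = - partial_deriv i p"
  for p :: "'k::comm_ring_1 mpoly"
  using partial_deriv_add[of i p "-p"] by (simp add: eq_neg_iff_add_eq_0 add.commute)

lemma partial_deriv_diff: "partial_deriv i (p - q) = partial_deriv i p - partial_deriv i q"
  for p :: "'k::comm_ring_1 mpoly"
  using partial_deriv_add[of i p "-q"] by (simp add: partial_deriv_uminus)

lemma partial_deriv_tvar: "partial_deriv i (tvar j) = (if i = j then 1 else 0)"
  by (simp add: tvar_def partial_deriv_single lookup_single when_def)

text \<open>A description by coefficients without truncated subtraction, from which the variables
  and degrees of derivatives are read off.\<close>

lemma lookup_partial_deriv: "Poly_Mapping.lookup (partial_deriv i p) m =
  of_nat (Poly_Mapping.lookup m i + 1) * Poly_Mapping.lookup p (m + Poly_Mapping.single i 1)"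
proof (induction p rule: mpoly_induct)
  case (single m' c)
  show ?case
  proof (cases "m' = m + Poly_Mapping.single i 1")
    case True
    then show ?thesis by (simp add: partial_deriv_single lookup_add)
  next
    case False
    have "m' - Poly_Mapping.single i 1 \<noteq> m" if "Poly_Mapping.lookup m' i \<noteq> 0"
    proof
      assume "m' - Poly_Mapping.single i 1 = m"
      then have "m' = m + Poly_Mapping.single i 1"
        using that by (intro poly_mapping_eqI) (auto simp: lookup_add lookup_minus lookup_single when_def)
      then show False using False by simp
    qed
    then show ?thesis using False
      by (cases "Poly_Mapping.lookup m' i = 0") (auto simp: partial_deriv_single lookup_single when_def)
  qed
qed (simp add: partial_deriv_add lookup_add algebra_simps)

lemma pvars_partial_deriv: "p \<in> pvars V \<Longrightarrow> partial_deriv i p \<in> pvars V"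
proof -
  assume p: "p \<in> pvars V"
  have "Poly_Mapping.lookup m j = 0" if "Poly_Mapping.lookup (partial_deriv i p) m \<noteq> 0" "j \<notin> V" for m j
  proof -
    have "Poly_Mapping.lookup p (m + Poly_Mapping.single i 1) \<noteq> 0"
      using that(1) by (auto simp: lookup_partial_deriv)
    then have "Poly_Mapping.lookup (m + Poly_Mapping.single i 1) j = 0"
      using p that(2) unfolding pvars_iff by blast
    then show ?thesis by (simp add: lookup_add)
  qed
  then show ?thesis unfolding pvars_iff by blast
qed

lemma hcomp_partial_deriv: "hcomp d (partial_deriv i p) = partial_deriv i (hcomp (Suc d) p)"
  by (rule poly_mapping_eqI) (simp add: lookup_hcomp lookup_partial_deriv mon_degree_add)

lemma homogeneous_partial_deriv: "homogeneous d p \<Longrightarrow> homogeneous (d - 1) (partial_deriv i p)"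
  unfolding homogeneous_iff lookup_partial_deriv
  by (metis add_diff_cancel_right' mon_degree_add mon_degree_single mult_zero_right)

lemma partial_deriv_pvars_0: "p \<in> pvars (- {i}) \<Longrightarrow> partial_deriv i p = 0"
proof (rule poly_mapping_eqI)
  fix m assume p: "p \<in> pvars (- {i})"
  have "Poly_Mapping.lookup p (m + Poly_Mapping.single i 1) = 0"
  proof (rule ccontr)
    assume "Poly_Mapping.lookup p (m + Poly_Mapping.single i 1) \<noteq> 0"
    then have "Poly_Mapping.lookup (m + Poly_Mapping.single i 1) i = 0" using p unfolding pvars_iff by blast
    then show False by (simp add: lookup_add)
  qed
  then show "Poly_Mapping.lookup (partial_deriv i p) m = Poly_Mapping.lookup 0 m"
    by (simp add: lookup_partial_deriv)
qed

lemma degree_xpoly_pos: "partial_deriv j p \<noteq> 0 \<Longrightarrow> Polynomial.degree (xpoly j p) > 0"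
  using xpoly_degree_0[of j p UNIV] partial_deriv_pvars_0[of p j]
  by (auto simp: Compl_eq_Diff_UNIV pvars_def)

text \<open>A monomial of positive degree contains some variable, and in characteristic 0 its
  exponent is still nonzero as a scalar.\<close>

lemma partial_deriv_nonzero:
  fixes p :: "'k::field_char_0 mpoly"
  assumes "p \<in> pvars V" "homogeneous d p" "d > 0" "p \<noteq> 0"
  obtains i where "i \<in> V" "partial_deriv i p \<noteq> 0"
proof -
  obtain m where m: "Poly_Mapping.lookup p m \<noteq> 0" using assms(4) poly_mapping_eqI[of p 0] by auto
  then have "mon_degree m = d" using assms(2) by (simp add: homogeneous_iff)
  then have "m \<noteq> 0" using assms(3) by auto
  then obtain i where i: "Poly_Mapping.lookup m i \<noteq> 0" using poly_mapping_eqI[of m 0] by auto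
  have "i \<in> V" using pvarsD[OF assms(1) m, of i] i by blast
  have eq: "m - Poly_Mapping.single i 1 + Poly_Mapping.single i 1 = m"
    using i by (intro poly_mapping_eqI) (auto simp: lookup_add lookup_minus lookup_single when_def)
  have "Poly_Mapping.lookup (partial_deriv i p) (m - Poly_Mapping.single i 1) \<noteq> 0"
    unfolding lookup_partial_deriv eq using m by (simp del: of_nat_add of_nat_Suc)
  then have "partial_deriv i p \<noteq> 0" by auto
  with \<open>i \<in> V\<close> that show thesis by blast
qed

lemma hcomp_mult_homogeneous:
  assumes "homogeneous a f"
  shows "hcomp d (x * f) = (if a \<le> d then hcomp (d - a) x * f else 0)"
proof -
  have "hcomp d (x * f) = (\<Sum>i\<le>d. hcomp i f * hcomp (d - i) x)"
    by (simp add: mult.commute[of x f] hcomp_mult)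
  also have "\<dots> = (\<Sum>i\<le>d. if a = i then f * hcomp (d - i) x else 0)"
    by (rule sum.cong) (auto simp: hcomp_homogeneous[OF assms])
  finally show ?thesis by (simp add: mult.commute)
qed

text \<open>The lowest components of f and g multiply to a nonzero component of
  \<open>f * g\<close>, and so do the highest. Both products sit in degree d, so lowest and highest
  degree coincide.\<close>

lemma homogeneous_factor:
  fixes f g :: "'k::field mpoly"
  assumes "homogeneous d (f * g)" "f * g \<noteq> 0"
  shows "homogeneous (tdeg f) f"
proof -
  have nz: "f \<noteq> 0" "g \<noteq> 0" using assms(2) by auto
  define i0 where "i0 = (LEAST i. hcomp i f \<noteq> 0)"
  define j0 where "j0 = (LEAST i. hcomp i g \<noteq> 0)"
  have i0: "hcomp i0 f \<noteq> 0" "\<And>i. i < i0 \<Longrightarrow> hcomp i f = 0" "i0 \<le> tdeg f"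
    using LeastI[of "\<lambda>i. hcomp i f \<noteq> 0" "tdeg f"] not_less_Least[of _ "\<lambda>i. hcomp i f \<noteq> 0"]
      Least_le[of "\<lambda>i. hcomp i f \<noteq> 0" "tdeg f"] hcomp_tdeg_nonzero[OF nz(1)] unfolding i0_def by blast+
  have j0: "hcomp j0 g \<noteq> 0" "\<And>i. i < j0 \<Longrightarrow> hcomp i g = 0" "j0 \<le> tdeg g"
    using LeastI[of "\<lambda>i. hcomp i g \<noteq> 0" "tdeg g"] not_less_Least[of _ "\<lambda>i. hcomp i g \<noteq> 0"]
      Least_le[of "\<lambda>i. hcomp i g \<noteq> 0" "tdeg g"] hcomp_tdeg_nonzero[OF nz(2)] unfolding j0_def by blast+
  have "hcomp (i0 + j0) (f * g) = hcomp i0 f * hcomp j0 g + (\<Sum>i\<in>{..i0 + j0} - {i0}. hcomp i f * hcomp (i0 + j0 - i) g)"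
    by (simp add: hcomp_mult sum.remove[of _ i0])
  also have "(\<Sum>i\<in>{..i0 + j0} - {i0}. hcomp i f * hcomp (i0 + j0 - i) g) = 0"
  proof (rule sum.neutral, intro ballI)
    fix i assume i: "i \<in> {..i0 + j0} - {i0}"
    show "hcomp i f * hcomp (i0 + j0 - i) g = 0"
    proof (cases "i < i0")
      case False
      then have "i0 + j0 - i < j0" using i by auto
      then show ?thesis by (simp add: j0(2))
    qed (simp add: i0(2))
  qed
  finally have "hcomp (i0 + j0) (f * g) \<noteq> 0" using i0(1) j0(1) by simp
  then have "i0 + j0 = d" using hcomp_homogeneous[OF assms(1)] by metis
  moreover have "tdeg f + tdeg g = d" using tdeg_homogeneous[OF assms] tdeg_mult[OF nz] by simp
  ultimately have eq: "i0 = tdeg f" using i0(3) j0(3) by linarith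
  have "(\<Sum>i\<le>tdeg f. hcomp i f) = (\<Sum>i\<le>tdeg f. if i = tdeg f then hcomp i f else 0)"
    using i0(2) by (intro sum.cong) (auto simp: eq)
  then have "hcomp (tdeg f) f = f" using sum_hcomp[of f "tdeg f"] by simp
  then show ?thesis by (rule homogeneousI_hcomp)
qed

section \<open>Dimension counts for polynomials\<close>

interpretation mpv: vector_space "\<lambda>(c::'k::field) (p::'k mpoly). mconst c * p"
  by unfold_locales (simp_all add: algebra_simps mconst_add mconst_mult)

lemma independent_monomials: "mpv.independent ((\<lambda>m. Poly_Mapping.single m (1::'k::field)) ` X)"
proof -
  have False if t: "finite t" "t \<subseteq> (\<lambda>m. Poly_Mapping.single m 1) ` X" "(\<Sum>v\<in>t. mconst (u v) * v) = 0"
    "v \<in> t" "u v \<noteq> (0::'k)" for t u and v :: "'k mpoly"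
  proof -
    obtain m where m: "v = Poly_Mapping.single m 1" using t(2,4) by auto
    have "u w * Poly_Mapping.lookup w m = (if w = v then u v else 0)" if w: "w \<in> t" for w
    proof -
      obtain m' where w': "w = Poly_Mapping.single m' 1" using t(2) w by blast
      show ?thesis
      proof (cases "m' = m")
        case False
        then have "Poly_Mapping.lookup w m = 0" by (simp add: w' lookup_single_not_eq)
        moreover from this have "w \<noteq> v" by (auto simp: m)
        ultimately show ?thesis by simp
      qed (simp add: m w')
    qed
    then have "Poly_Mapping.lookup (\<Sum>v\<in>t. mconst (u v) * v) m = u v"
      using t(1,4) by (simp add: lookup_sum lookup_mconst_mult)
    then show False using t(3,5) by simp
  qed
  then show ?thesis unfolding mpv.dependent_explicit by blast
qed

lemma tvar_power_mult_single:
  assumes "M \<le> Poly_Mapping.lookup \<alpha> i"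
  shows "tvar i ^ M * Poly_Mapping.single (\<alpha> - Poly_Mapping.single i M) c = Poly_Mapping.single \<alpha> c"
proof -
  have "Poly_Mapping.single i M + (\<alpha> - Poly_Mapping.single i M) = \<alpha>"
    using assms by (intro poly_mapping_eqI) (auto simp: lookup_add lookup_minus lookup_single when_def)
  then show ?thesis by (simp add: tvar_power mult_single)
qed

lemma bounded_monomials:
  "finite {\<gamma> :: nat \<Rightarrow>\<^sub>0 nat. Poly_Mapping.keys \<gamma> \<subseteq> {..<N} \<and> (\<forall>i. Poly_Mapping.lookup \<gamma> i < M)}" (is "finite ?G")
  "card {\<gamma> :: nat \<Rightarrow>\<^sub>0 nat. Poly_Mapping.keys \<gamma> \<subseteq> {..<N} \<and> (\<forall>i. Poly_Mapping.lookup \<gamma> i < M)} \<le> M ^ N"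
proof -
  let ?r = "\<lambda>\<gamma>. restrict (Poly_Mapping.lookup \<gamma>) {..<N}"
  have inj: "inj_on ?r ?G"
  proof (rule inj_onI, rule poly_mapping_eqI)
    fix a b k assume ab: "a \<in> ?G" "b \<in> ?G" and r: "?r a = ?r b"
    show "Poly_Mapping.lookup a k = Poly_Mapping.lookup b k"
    proof (cases "k < N")
      case True
      then show ?thesis using fun_cong[OF r, of k] by simp
    next
      case False
      then have "k \<notin> Poly_Mapping.keys a" "k \<notin> Poly_Mapping.keys b" using ab by auto
      then show ?thesis by (simp add: in_keys_iff)
    qed
  qed
  have sub: "?r ` ?G \<subseteq> PiE {..<N} (\<lambda>_. {..<M})"
    by (rule image_subsetI, rule PiE_I) (auto simp: restrict_def)
  have fin: "finite (PiE {..<N} (\<lambda>_. {..<M}))" by (intro finite_PiE) auto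
  show "finite ?G" using finite_imageD[OF finite_subset[OF sub fin] inj] .
  have "card ?G \<le> card (PiE {..<N} (\<lambda>_. {..<M}))" using card_inj_on_le[OF inj sub fin] .
  then show "card ?G \<le> M ^ N" by (simp add: card_PiE)
qed

text \<open>Modulo two forms of positive degree all large powers of the variables cannot vanish when there
  are at least three variables: otherwise the polynomials of degree at most \<open>D\<close> would be spanned by
  \<open>O(D\<^sup>2)\<close> products \<open>f\<^sup>a g\<^sup>b t\<^sup>\<gamma>\<close> with \<open>\<gamma>\<close> bounded.\<close>

lemma two_forms_not_primary:
  fixes f g :: "'k::field mpoly"
  assumes N: "N \<ge> 3"
    and f: "homogeneous a f" "a > 0" and g: "homogeneous b g" "b > 0"
    and fg: "f \<in> pvars {..<N}" "g \<in> pvars {..<N}"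
    and pow: "\<And>i. i < N \<Longrightarrow> \<exists>u\<in>pvars {..<N}. \<exists>v\<in>pvars {..<N}. tvar i ^ M = u * f + v * g"
  shows False
proof -
  define G where "G = {\<gamma> :: nat \<Rightarrow>\<^sub>0 nat. Poly_Mapping.keys \<gamma> \<subseteq> {..<N} \<and> (\<forall>i. Poly_Mapping.lookup \<gamma> i < M)}"
  \<comment> \<open>A candidate spanning set for the forms of degree at most D. Exponents up to D
    suffice because f and g have positive degree.\<close>
  define B where "B = (\<lambda>D. (\<lambda>(x, y, \<gamma>). f ^ x * g ^ y * Poly_Mapping.single \<gamma> 1) ` ({..D} \<times> {..D} \<times> G))"
  have finG: "finite G" and cardG: "card G \<le> M ^ N"
    using bounded_monomials[of N M] unfolding G_def by simp_all
  have finB: "finite (B D)" for D unfolding B_def using finG by auto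
  have cardB: "card (B D) \<le> (D + 1) ^ 2 * M ^ N" for D
  proof -
    have "card (B D) \<le> card ({..D} \<times> {..D} \<times> G)" unfolding B_def by (intro card_image_le) (use finG in auto)
    also have "\<dots> = (D + 1) ^ 2 * card G" by (simp add: card_cartesian_product power2_eq_square algebra_simps)
    finally show ?thesis using cardG by (meson le_trans mult_le_mono2)
  qed
  have Bmono: "B D \<subseteq> B D'" if "D \<le> D'" for D D' unfolding B_def using that by (intro image_mono) auto
  have fB: "f * p \<in> mpv.span (B D)" and gB: "g * p \<in> mpv.span (B D)"
    if p: "p \<in> mpv.span (B D')" and D': "D' < D" for p D D'
  proof -
    have gen: "h * x \<in> mpv.span (B D)" if h: "h = f \<or> h = g" and x: "x \<in> B D'" for h x
    proof -
      obtain i j \<gamma> where xe: "x = f ^ i * g ^ j * Poly_Mapping.single \<gamma> 1" "i \<le> D'" "j \<le> D'" "\<gamma> \<in> G"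
        using x unfolding B_def by auto
      have fx: "f * x = f ^ Suc i * g ^ j * Poly_Mapping.single \<gamma> 1" "g * x = f ^ i * g ^ Suc j * Poly_Mapping.single \<gamma> 1"
        using xe(1) by (simp_all add: ac_simps)
      have "f * x \<in> B D" unfolding B_def
        by (rule image_eqI[of _ _ "(Suc i, j, \<gamma>)"]) (simp only: fx prod.case, use xe D' in auto)
      moreover have "g * x \<in> B D" unfolding B_def
        by (rule image_eqI[of _ _ "(i, Suc j, \<gamma>)"]) (simp only: fx prod.case, use xe D' in auto)
      ultimately have "h * x \<in> B D" using h by blast
      then show ?thesis by (rule mpv.span_base)
    qed
    have "h * p \<in> mpv.span (B D)" if h: "h = f \<or> h = g" for h
      using p
    proof (induction rule: mpv.span_induct_alt)
      case (step c x y)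
      have "h * (mconst c * x + y) = mconst c * (h * x) + h * y" by (simp add: algebra_simps)
      then show ?case using step gen[OF h] by (simp add: mpv.span_add mpv.span_scale)
    qed (simp add: mpv.span_zero)
    then show "f * p \<in> mpv.span (B D)" "g * p \<in> mpv.span (B D)" by blast+
  qed
  \<comment> \<open>Induction on the degree. A monomial outside \<open>G\<close> is divisible by
    some \<open>t\<^sub>i\<^sup>M\<close>, so it is a combination of f and g; in its component of
    degree d the cofactors have smaller degree.\<close>
  have span: "p \<in> mpv.span (B d)" if "homogeneous d p" "p \<in> pvars {..<N}" for d p
    using that
  proof (induction d arbitrary: p rule: less_induct)
    case (less d)
    have mono: "Poly_Mapping.single \<alpha> 1 \<in> mpv.span (B d)"
      if \<alpha>: "mon_degree \<alpha> = d" "Poly_Mapping.keys \<alpha> \<subseteq> {..<N}" for \<alpha>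
    proof (cases "\<alpha> \<in> G")
      case True
      then have "Poly_Mapping.single \<alpha> 1 \<in> B d" unfolding B_def
        by (auto intro!: image_eqI[of _ _ "(0, 0, \<alpha>)"])
      then show ?thesis by (rule mpv.span_base)
    next
      case False
      then obtain i where i: "M \<le> Poly_Mapping.lookup \<alpha> i" using \<alpha>(2) by (auto simp: G_def not_less)
      show ?thesis
      proof (cases "i < N")
        case iN: True
        obtain u v where uv: "u \<in> pvars {..<N}" "v \<in> pvars {..<N}" "tvar i ^ M = u * f + v * g"
          using pow[OF iN] by blast
        define s where "s = Poly_Mapping.single (\<alpha> - Poly_Mapping.single i M) (1::'k)"
        have "Poly_Mapping.keys (\<alpha> - Poly_Mapping.single i M) \<subseteq> {..<N}"
        proof
          fix k assume "k \<in> Poly_Mapping.keys (\<alpha> - Poly_Mapping.single i M)"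
          then have "k \<in> Poly_Mapping.keys \<alpha>" by (auto simp: in_keys_iff lookup_minus)
          then show "k \<in> {..<N}" using \<alpha>(2) by blast
        qed
        then have sV: "s \<in> pvars {..<N}" unfolding s_def by (rule pvars_single)
        have "Poly_Mapping.single \<alpha> 1 = (u * s) * f + (v * s) * g"
          using tvar_power_mult_single[OF i, of "1::'k"] uv(3) by (simp add: s_def algebra_simps)
        moreover have "homogeneous d (Poly_Mapping.single \<alpha> (1::'k))" using \<alpha>(1) by (simp add: homogeneous_def)
        ultimately have "Poly_Mapping.single \<alpha> 1 = hcomp d ((u * s) * f) + hcomp d ((v * s) * g)"
          using hcomp_homogeneous[of d "Poly_Mapping.single \<alpha> (1::'k)" d] by (simp add: hcomp_add)
        moreover have "hcomp d ((u * s) * f) \<in> mpv.span (B d)"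
        proof (cases "a \<le> d")
          case True
          have "hcomp (d - a) (u * s) \<in> mpv.span (B (d - a))"
            using less.IH[of "d - a" "hcomp (d - a) (u * s)"] True f(2) uv sV by (simp add: pvars_hcomp pvars_mult)
          moreover have "hcomp d ((u * s) * f) = f * hcomp (d - a) (u * s)"
            using True by (simp only: hcomp_mult_homogeneous[OF f(1)] if_True mult.commute[of f])
          ultimately show ?thesis using fB[of _ "d - a" d] True f(2) by simp
        qed (simp add: hcomp_mult_homogeneous[OF f(1)] mpv.span_zero)
        moreover have "hcomp d ((v * s) * g) \<in> mpv.span (B d)"
        proof (cases "b \<le> d")
          case True
          have "hcomp (d - b) (v * s) \<in> mpv.span (B (d - b))"
            using less.IH[of "d - b" "hcomp (d - b) (v * s)"] True g(2) uv sV by (simp add: pvars_hcomp pvars_mult)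
          moreover have "hcomp d ((v * s) * g) = g * hcomp (d - b) (v * s)"
            using True by (simp only: hcomp_mult_homogeneous[OF g(1)] if_True mult.commute[of g])
          ultimately show ?thesis using gB[of _ "d - b" d] True g(2) by simp
        qed (simp add: hcomp_mult_homogeneous[OF g(1)] mpv.span_zero)
        ultimately show ?thesis by (simp add: mpv.span_add)
      next
        case False
        \<comment> \<open>An index outside the variables has exponent 0. This forces
          \<open>M = 0\<close>, so that 1 is a combination of f and g, which have no constant
          term.\<close>
        then have "Poly_Mapping.lookup \<alpha> i = 0" using \<alpha>(2) by (metis in_keys_iff lessThan_iff subsetD)
        then have "M = 0" using i by simp
        then obtain u v where uv: "u \<in> pvars {..<N}" "v \<in> pvars {..<N}" "1 = u * f + v * g"
          using pow[of 0] N by auto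
        have "hcomp 0 (u * f + v * g) = 0" using f g by (simp add: hcomp_add hcomp_mult_homogeneous)
        then have "hcomp 0 (1::'k mpoly) = 0" using uv(3) by simp
        then show ?thesis using hcomp_homogeneous[of 0 "1::'k mpoly" 0] homogeneous_mconst[of "1::'k"] by simp
      qed
    qed
    have "(\<Sum>m\<in>Poly_Mapping.keys p. mconst (Poly_Mapping.lookup p m) * Poly_Mapping.single m 1) \<in> mpv.span (B d)"
    proof (intro mpv.span_sum mpv.span_scale mono)
      fix m assume m: "m \<in> Poly_Mapping.keys p"
      show "mon_degree m = d" using less.prems(1) m by (simp add: homogeneous_def)
      show "Poly_Mapping.keys m \<subseteq> {..<N}" using less.prems(2) m by (simp add: pvars_def)
    qed
    then show ?case using mpoly_sum_single[of p] by (simp add: mconst_def mult_single)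
  qed
  \<comment> \<open>The \<open>(D + 1) ^ 3\<close> monomials in three variables with exponents at
    most D have degree at most \<open>3 * D\<close>, whereas \<open>B (3 * D)\<close> has at most
    \<open>(3 * D + 1) ^ 2 * M ^ N\<close> elements. Since
    \<open>(3 * D + 1) ^ 2 \<le> 9 * (D + 1) ^ 2\<close>, the factor 9 makes this less than
    \<open>(D + 1) ^ 3\<close>.\<close>
  define D where "D = 9 * M ^ N"
  define e where "e = (\<lambda>(x, y, z). Poly_Mapping.single 0 x + Poly_Mapping.single 1 y + Poly_Mapping.single (2::nat) (z::nat))"
  define X where "X = e ` ({..D} \<times> {..D} \<times> {..D})"
  have inj: "inj_on e ({..D} \<times> {..D} \<times> {..D})"
  proof (rule inj_onI)
    fix p q assume eq: "e p = e q"
    obtain x y z x' y' z' where pq: "p = (x, y, z)" "q = (x', y', z')" by (cases p, cases q)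
    have "Poly_Mapping.lookup (e p) i = Poly_Mapping.lookup (e q) i" for i using eq by simp
    from this[of 0] this[of 1] this[of 2] show "p = q"
      by (simp add: pq e_def lookup_add lookup_single)
  qed
  let ?s = "\<lambda>m. Poly_Mapping.single m (1::'k)"
  have "?s ` X \<subseteq> mpv.span (B (3 * D))"
  proof (clarify)
    fix m assume "m \<in> X"
    then obtain x y z where m: "m = e (x, y, z)" "x \<le> D" "y \<le> D" "z \<le> D" unfolding X_def by auto
    have "mon_degree m = x + y + z" by (simp add: m e_def mon_degree_add)
    then have "homogeneous (x + y + z) (?s m)" by (simp add: homogeneous_def)
    moreover have "?s m \<in> pvars {..<N}"
      using N by (auto simp: pvars_iff m(1) e_def lookup_add lookup_single when_def)
    ultimately have "?s m \<in> mpv.span (B (x + y + z))" by (rule span)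
    then show "?s m \<in> mpv.span (B (3 * D))"
      using mpv.span_mono[OF Bmono[of "x + y + z" "3 * D"]] m by auto
  qed
  then have "card (?s ` X) \<le> card (B (3 * D))"
    using mpv.independent_span_bound[OF finB independent_monomials] by blast
  moreover have "card (?s ` X) = card X" by (intro card_image inj_onI) (auto dest: arg_cong[of _ _ Poly_Mapping.keys])
  moreover have "card X = (D + 1) ^ 3"
    unfolding X_def card_image[OF inj] by (simp add: card_cartesian_product power3_eq_cube algebra_simps)
  ultimately have "(D + 1) ^ 3 \<le> (3 * D + 1) ^ 2 * M ^ N" using cardB[of "3 * D"] by linarith
  also have "\<dots> \<le> (3 * (D + 1)) ^ 2 * M ^ N" by (intro mult_right_mono power_mono) auto
  also have "\<dots> = (D + 1) ^ 2 * D" unfolding power_mult_distrib by (simp add: D_def)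
  also have "\<dots> < (D + 1) ^ 2 * (D + 1)" by simp
  also have "\<dots> = (D + 1) ^ 3" by (simp add: power2_eq_square power3_eq_cube)
  finally show False by simp
qed

text \<open>By the product rule every derivative of \<open>f * g\<close> lies in the ideal of f and
  g, and the factors of a form are forms, so \<open>two_forms_not_primary\<close> applies.\<close>

lemma irreducible_potential:
  fixes \<Omega> :: "'k::field mpoly"
  assumes N: "N \<ge> 3" and \<Omega>: "\<Omega> \<in> pvars {..<N}" "homogeneous d \<Omega>" "d > 0"
    and pow: "\<And>i. i < N \<Longrightarrow> \<exists>q. (\<forall>l<N. q l \<in> pvars {..<N}) \<and> tvar i ^ M = (\<Sum>l<N. q l * partial_deriv l \<Omega>)"
  shows "irreducible \<Omega>"
proof -
  have "\<Omega> \<noteq> 0"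
  proof
    assume "\<Omega> = 0"
    then have "tvar 0 ^ M = (0::'k mpoly)" using pow[of 0] N by auto
    then show False by simp
  qed
  moreover have "\<not> \<Omega> dvd 1" using \<Omega>(2,3) \<open>\<Omega> \<noteq> 0\<close> by (simp add: is_unit_mpoly_iff tdeg_homogeneous)
  moreover have "f dvd 1 \<or> g dvd 1" if fg: "\<Omega> = f * g" for f g
  proof (rule ccontr)
    assume neg: "\<not> (f dvd 1 \<or> g dvd 1)"
    have nz: "f \<noteq> 0" "g \<noteq> 0" using \<open>\<Omega> \<noteq> 0\<close> fg by auto
    have deg: "tdeg f > 0" "tdeg g > 0" using neg nz by (auto simp: is_unit_mpoly_iff)
    have hom: "homogeneous (tdeg f) f" "homogeneous (tdeg g) g"
      using homogeneous_factor[of d f g] homogeneous_factor[of d g f] \<Omega>(2) \<open>\<Omega> \<noteq> 0\<close> fg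
      by (simp_all add: mult.commute)
    have V: "f \<in> pvars {..<N}" "g \<in> pvars {..<N}"
      using pvars_factor[of f g] pvars_factor'[of f g] \<Omega>(1) \<open>\<Omega> \<noteq> 0\<close> fg by simp_all
    have "\<exists>u\<in>pvars {..<N}. \<exists>v\<in>pvars {..<N}. tvar i ^ M = u * f + v * g" if i: "i < N" for i
    proof -
      obtain q where q: "\<forall>l<N. q l \<in> pvars {..<N}" "tvar i ^ M = (\<Sum>l<N. q l * partial_deriv l \<Omega>)"
        using pow[OF i] by blast
      have "tvar i ^ M = (\<Sum>l<N. q l * partial_deriv l g) * f + (\<Sum>l<N. q l * partial_deriv l f) * g"
        unfolding q(2) fg partial_deriv_mult sum_distrib_right sum.distrib[symmetric]
        by (rule sum.cong) (simp_all add: algebra_simps)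
      moreover have "(\<Sum>l<N. q l * partial_deriv l h) \<in> pvars {..<N}" if "h \<in> pvars {..<N}" for h
        using q(1) that by (intro pvars_sum pvars_mult pvars_partial_deriv) auto
      ultimately show ?thesis using V by blast
    qed
    then show False
      using two_forms_not_primary[OF N hom(1) deg(1) hom(2) deg(2) V, of M] by blast
  qed
  ultimately show ?thesis by (simp add: irreducible_def)
qed

section \<open>Jacobian determinants\<close>

text \<open>The rows are values of a function, so that replacing a row is a function update, as
  multilinearity and derivations require.\<close>

definition detf :: "nat \<Rightarrow> (nat \<Rightarrow> nat \<Rightarrow> 'a::comm_ring_1) \<Rightarrow> 'a"
  where "detf N r = Determinant.det (mat N N (\<lambda>(i, j). r i j))"

definition cofr :: "nat \<Rightarrow> (nat \<Rightarrow> nat \<Rightarrow> 'a::comm_ring_1) \<Rightarrow> nat \<Rightarrow> nat \<Rightarrow> 'a"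
  where "cofr N r i j = cofactor (mat N N (\<lambda>(i, j). r i j)) i j"

lemma detf_leibniz:
  "detf N r = (\<Sum>p | p permutes {0..<N}. of_int (sign p) * (\<Prod>i=0..<N. r i (p i)))"
  unfolding detf_def
proof (subst det_def'[of _ N], simp, rule sum.cong, simp)
  fix p assume "p \<in> {p. p permutes {0..<N}}"
  then have "p i < N" if "i < N" for i using permutes_in_image[of p "{0..<N}" i] that by simp
  then show "of_int (sign p) * (\<Prod>i = 0..<N. mat N N (\<lambda>(i, j). r i j) $$ (i, p i)) =
    of_int (sign p) * (\<Prod>i=0..<N. r i (p i))" by simp
qed

lemma detf_row:
  assumes "s < N"
  shows "detf N (r(s := x)) = (\<Sum>j<N. x j * cofr N r s j)"
proof -
  let ?A = "mat N N (\<lambda>(i, j). (r(s := x)) i j)"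
  have "mat_delete ?A s j = mat_delete (mat N N (\<lambda>(i, j). r i j)) s j" if "j < N" for j
    unfolding mat_delete_def by (rule eq_matI) auto
  then have "cofactor ?A s j = cofr N r s j" if "j < N" for j
    using that by (simp add: cofactor_def cofr_def)
  moreover have "detf N (r(s := x)) = (\<Sum>j<N. ?A $$ (s, j) * cofactor ?A s j)"
    unfolding detf_def by (rule laplace_expansion_row) (use assms in auto)
  ultimately show ?thesis using assms by simp
qed

lemma detf_row_add:
  "s < N \<Longrightarrow> detf N (r(s := \<lambda>j. x j + y j)) = detf N (r(s := x)) + detf N (r(s := y))"
  by (simp add: detf_row algebra_simps sum.distrib)

lemma detf_row_diff:
  "s < N \<Longrightarrow> detf N (r(s := \<lambda>j. x j - y j)) = detf N (r(s := x)) - detf N (r(s := y))"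
  by (simp add: detf_row algebra_simps sum_subtractf)

lemma detf_row_mult:
  "s < N \<Longrightarrow> detf N (r(s := \<lambda>j. c * x j)) = c * detf N (r(s := x))"
  by (simp add: detf_row algebra_simps sum_distrib_left)

lemma detf_row_zero: "s < N \<Longrightarrow> detf N (r(s := \<lambda>j. 0)) = 0"
  by (simp add: detf_row)

lemma detf_identical_rows:
  assumes "i < N" "j < N" "i \<noteq> j" "r i = r j"
  shows "detf N r = 0"
  unfolding detf_def
  by (rule det_identical_rows[of _ N i j]) (use assms in \<open>auto intro!: eq_vecI\<close>)

text \<open>Polarization: expand the vanishing determinant with \<open>x + y\<close> in both
  rows.\<close>

lemma detf_swap:
  assumes "a < N" "b < N" "a \<noteq> b"
  shows "detf N (r(a := x, b := y)) = - detf N (r(a := y, b := x))"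
proof -
  let ?D = "\<lambda>u v. detf N (r(a := u, b := v))"
  have same: "?D u u = 0" for u by (rule detf_identical_rows[OF assms]) (use assms in auto)
  have addb: "?D u (\<lambda>j. v j + w j) = ?D u v + ?D u w" for u v w
    by (rule detf_row_add[OF assms(2)])
  have twist: "r(a := v, b := u) = r(b := u, a := v)" for u v
    by (rule fun_upd_twist[OF assms(3)])
  have adda: "?D (\<lambda>j. v j + w j) u = ?D v u + ?D w u" for u v w
    unfolding twist by (rule detf_row_add[OF assms(1)])
  have "0 = ?D (\<lambda>j. x j + y j) (\<lambda>j. x j + y j)" using same by simp
  also have "\<dots> = ?D x y + ?D y x" by (simp only: adda addb same) simp
  finally show ?thesis by (simp add: eq_neg_iff_add_eq_0)
qed

lemma detf_alien_cofactor:
  assumes "l < N" "j < N"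
  shows "(\<Sum>s<N. r s l * cofr N r s j) = (if l = j then detf N r else 0)"
proof -
  let ?A = "mat N N (\<lambda>(i, j). r i j)"
  have A: "?A \<in> carrier_mat N N" by simp
  have "(adj_mat ?A * ?A) $$ (j, l) = (\<Sum>s<N. r s l * cofr N r s j)"
    using assms by (simp add: adj_mat_def scalar_prod_def cofr_def mult.commute lessThan_atLeast0)
  moreover have "(adj_mat ?A * ?A) $$ (j, l) = (if l = j then detf N r else 0)"
    using adj_mat(3)[OF A] assms by (simp add: detf_def)
  ultimately show ?thesis by simp
qed

text \<open>Both sides are the derivative at t = 0 of \<open>det (r (1 + t M))\<close>, computed by
  rows on the left and from the product on the right. \<open>M\<close> will hold the derivatives of
  the coefficients of a vector field, so that its trace is the divergence.\<close>

lemma detf_trace: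
  "(\<Sum>s<N. detf N (r(s := \<lambda>j. \<Sum>l<N. r s l * M l j))) = (\<Sum>l<N. M l l) * detf N r"
proof -
  have "(\<Sum>s<N. detf N (r(s := \<lambda>j. \<Sum>l<N. r s l * M l j))) =
      (\<Sum>s<N. \<Sum>j<N. \<Sum>l<N. M l j * (r s l * cofr N r s j))"
    by (simp add: detf_row sum_distrib_right sum_distrib_left ac_simps)
  also have "\<dots> = (\<Sum>j<N. \<Sum>s<N. \<Sum>l<N. M l j * (r s l * cofr N r s j))"
    by (rule sum.swap)
  also have "\<dots> = (\<Sum>j<N. \<Sum>l<N. \<Sum>s<N. M l j * (r s l * cofr N r s j))"
    by (rule sum.cong[OF refl]) (rule sum.swap)
  also have "\<dots> = (\<Sum>j<N. \<Sum>l<N. M l j * (if l = j then detf N r else 0))"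
    by (simp add: detf_alien_cofactor flip: sum_distrib_left)
  also have "\<dots> = (\<Sum>j<N. M j j * detf N r)"
    by (simp add: if_distrib cong: if_cong)
  finally show ?thesis by (simp add: sum_distrib_right)
qed

section \<open>Derivations applied to determinants\<close>

locale derivation =
  fixes D :: "'a::comm_ring_1 \<Rightarrow> 'a"
  assumes D_add: "D (a + b) = D a + D b" and D_mult: "D (a * b) = a * D b + D a * b"
begin

lemma D_zero [simp]: "D 0 = 0"
  using D_add[of 0 0] by simp

lemma D_one [simp]: "D 1 = 0"
  using D_mult[of 1 1] by simp

lemma D_uminus: "D (- a) = - D a"
  using D_add[of a "-a"] by (simp add: eq_neg_iff_add_eq_0 add.commute)

lemma D_sum: "D (sum f S) = (\<Sum>i\<in>S. D (f i))"
  by (induction S rule: infinite_finite_induct) (auto simp: D_add)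

lemma D_sign: "D (of_int (sign p) * a) = of_int (sign p) * D a"
  by (cases "evenperm p") (simp_all add: sign_def D_uminus)

lemma D_prod: "finite S \<Longrightarrow> D (prod f S) = (\<Sum>s\<in>S. D (f s) * prod f (S - {s}))"
proof (induction S rule: finite_induct)
  case (insert x S)
  have "D (prod f (insert x S)) = f x * D (prod f S) + D (f x) * prod f S"
    using insert.hyps by (simp add: D_mult)
  also have "f x * D (prod f S) = (\<Sum>s\<in>S. D (f s) * prod f (insert x S - {s}))"
    unfolding insert.IH sum_distrib_left
  proof (rule sum.cong)
    fix s assume s: "s \<in> S"
    then have "insert x S - {s} = insert x (S - {s})" using insert.hyps by auto
    then show "f x * (D (f s) * prod f (S - {s})) = D (f s) * prod f (insert x S - {s})"
      using insert.hyps by (simp add: ac_simps)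
  qed simp
  also have "D (f x) * prod f S = D (f x) * prod f (insert x S - {x})"
    using insert.hyps by simp
  finally show ?case using insert.hyps by (simp add: add.commute)
qed simp

lemma D_detf: "D (detf N r) = (\<Sum>s<N. detf N (r(s := \<lambda>j. D (r s j))))"
proof -
  have upd: "(\<Prod>i=0..<N. (r(s := \<lambda>j. D (r s j))) i (p i)) = D (r s (p s)) * (\<Prod>i\<in>{0..<N} - {s}. r i (p i))"
    if "s < N" for s p
  proof -
    have "(\<Prod>i=0..<N. (r(s := \<lambda>j. D (r s j))) i (p i)) =
      (r(s := \<lambda>j. D (r s j))) s (p s) * (\<Prod>i\<in>{0..<N} - {s}. (r(s := \<lambda>j. D (r s j))) i (p i))"
      by (rule prod.remove) (use that in auto)
    also have "(\<Prod>i\<in>{0..<N} - {s}. (r(s := \<lambda>j. D (r s j))) i (p i)) = (\<Prod>i\<in>{0..<N} - {s}. r i (p i))"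
      by (rule prod.cong) auto
    finally show ?thesis by simp
  qed
  have "D (detf N r) = (\<Sum>p | p permutes {0..<N}. \<Sum>s<N. of_int (sign p) * (D (r s (p s)) * (\<Prod>i\<in>{0..<N} - {s}. r i (p i))))"
    by (simp add: detf_leibniz D_sum D_sign D_prod sum_distrib_left lessThan_atLeast0)
  also have "\<dots> = (\<Sum>s<N. \<Sum>p | p permutes {0..<N}. of_int (sign p) * (D (r s (p s)) * (\<Prod>i\<in>{0..<N} - {s}. r i (p i))))"
    by (rule sum.swap)
  also have "\<dots> = (\<Sum>s<N. detf N (r(s := \<lambda>j. D (r s j))))"
    by (intro sum.cong refl) (simp add: detf_leibniz upd del: fun_upd_apply)
  finally show ?thesis .
qed

end

lemma derivation_partial_deriv: "derivation (partial_deriv i :: 'k::comm_ring_1 mpoly \<Rightarrow> _)"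
  by unfold_locales (simp_all add: partial_deriv_add partial_deriv_mult)

section \<open>The Jacobian bracket and its fundamental identity\<close>

definition jrow :: "'k::comm_ring_1 mpoly list \<Rightarrow> nat \<Rightarrow> nat \<Rightarrow> 'k mpoly"
  where "jrow fs i j = partial_deriv j (fs ! i)"

lemma jacobian_detf: "jacobian_det fs = detf (length fs) (jrow fs)"
  by (simp add: jacobian_det_def detf_def jrow_def[abs_def])

lemma jrow_update: "s < length fs \<Longrightarrow> jrow (fs[s := a]) = (jrow fs)(s := \<lambda>j. partial_deriv j a)"
  by (auto simp: jrow_def fun_eq_iff nth_list_update)

lemma jacobian_update_append:
  assumes "s < length us"
  shows "jacobian_det (us[s := a] @ [\<Omega>]) = detf (Suc (length us)) ((jrow (us @ [\<Omega>]))(s := \<lambda>j. partial_deriv j a))"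
  using assms jrow_update[of s "us @ [\<Omega>]" a] by (simp add: jacobian_detf list_update_append)

lemma jacobian_add:
  assumes "s < length us"
  shows "jacobian_det (us[s := a + b] @ [\<Omega>]) = jacobian_det (us[s := a] @ [\<Omega>]) + jacobian_det (us[s := b] @ [\<Omega>])"
  using assms by (simp add: jacobian_update_append partial_deriv_add detf_row_add)

lemma jacobian_diff:
  assumes "s < length us"
  shows "jacobian_det (us[s := a - b] @ [\<Omega>]) = jacobian_det (us[s := a] @ [\<Omega>]) - jacobian_det (us[s := b] @ [\<Omega>])"
  using assms by (simp add: jacobian_update_append partial_deriv_diff detf_row_diff)

lemma jacobian_mconst:
  assumes "s < length us"
  shows "jacobian_det (us[s := mconst c * a] @ [\<Omega>]) = mconst c * jacobian_det (us[s := a] @ [\<Omega>])"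
  using assms by (simp add: jacobian_update_append partial_deriv_smult detf_row_mult)

lemma jacobian_leibniz:
  assumes "s < length us"
  shows "jacobian_det (us[s := a * b] @ [\<Omega>]) = a * jacobian_det (us[s := b] @ [\<Omega>]) + jacobian_det (us[s := a] @ [\<Omega>]) * b"
proof -
  have "(\<lambda>j. partial_deriv j (a * b)) = (\<lambda>j. a * partial_deriv j b + b * partial_deriv j a)"
    by (simp add: partial_deriv_mult mult.commute)
  then show ?thesis
    using assms by (simp add: jacobian_update_append detf_row_add detf_row_mult mult.commute)
qed

lemma jacobian_alternating:
  assumes "i < length fs" "j < length fs" "i \<noteq> j" "fs ! i = fs ! j"
  shows "jacobian_det fs = 0"
  unfolding jacobian_detf by (rule detf_identical_rows[OF assms(1-3)]) (simp add: jrow_def[abs_def] assms(4))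

lemma jacobian_potential_zero:
  assumes "s < length us"
  shows "jacobian_det (us[s := \<Omega>] @ [\<Omega>]) = 0"
  by (rule jacobian_alternating[of s _ "length us"]) (use assms in \<open>auto simp: nth_append\<close>)

context
  fixes vs :: "'k::field_char_0 mpoly list" and \<Omega> :: "'k mpoly" and N :: nat
  assumes N: "N = Suc (Suc (length vs))"
begin

text \<open>The coefficients of the Hamiltonian vector field \<open>{-, vs}\<close>. The 0 is a
  placeholder: cofactors along a row do not depend on that row.\<close>

definition hcoef :: "nat \<Rightarrow> 'k mpoly"
  where "hcoef j = cofr N (jrow (0 # vs @ [\<Omega>])) 0 j"

definition hder :: "'k mpoly \<Rightarrow> 'k mpoly"
  where "hder g = jacobian_det (g # vs @ [\<Omega>])"

lemma hder_eq: "hder g = (\<Sum>j<N. partial_deriv j g * hcoef j)"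
  unfolding hder_def hcoef_def
  using jrow_update[of 0 "0 # vs @ [\<Omega>]" g] detf_row[of 0 N "jrow (0 # vs @ [\<Omega>])" "\<lambda>j. partial_deriv j g"]
  by (simp add: jacobian_detf N)

lemma derivation_hder: "derivation hder"
  by unfold_locales (simp_all add: hder_eq partial_deriv_add partial_deriv_mult sum.distrib
      sum_distrib_left sum_distrib_right algebra_simps)

lemma hder_potential: "hder \<Omega> = 0"
  unfolding hder_def by (rule jacobian_alternating[of 0 _ "Suc (length vs)"]) (auto simp: nth_append)

text \<open>The Hamiltonian vector field of \<open>vs\<close> is free of divergence: second derivatives are symmetric
  while determinants are alternating.\<close>

lemma divergence_hcoef: "(\<Sum>l<N. partial_deriv l (hcoef l)) = 0"
proof -
  define r where "r = jrow (0 # vs @ [\<Omega>])"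
  define e where "e = (\<lambda>l k :: nat. if k = l then 1 else 0 :: 'k mpoly)"
  have e_sum: "(\<Sum>j<N. e l j * x j) = x l" if "l < N" for l x
    using that by (simp add: e_def if_distrib[of "\<lambda>z. z * _"] cong: if_cong)
  \<comment> \<open>A cofactor is the determinant with a unit row inserted; in this form it can be
    differentiated row by row.\<close>
  have hc: "hcoef l = detf N (r(0 := e l))" if "l < N" for l
    using e_sum[OF that, of "cofr N r 0"] detf_row[of 0 N r "e l"] by (simp only: hcoef_def r_def) (simp add: N)
  have term_s: "(\<Sum>l<N. detf N ((r(0 := e l))(s := \<lambda>k. partial_deriv l ((r(0 := e l)) s k)))) = 0" if s: "s < N" for s
  proof (cases "s = 0")
    case True
    have "(\<lambda>k. partial_deriv l (e l k)) = (\<lambda>k. 0)" for l by (auto simp: e_def)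
    then show ?thesis using True N by (simp add: detf_row_zero)
  next
    case False
    define H where "H = (\<lambda>l m. partial_deriv l (r s m))"
    have H: "H l m = H m l" for l m unfolding H_def r_def jrow_def by (rule partial_deriv_commute)
    define E where "E = (\<lambda>l m. detf N (r(0 := e l, s := e m)))"
    have E: "E l m = - E m l" for l m unfolding E_def by (rule detf_swap) (use s False N in auto)
    have "detf N ((r(0 := e l))(s := \<lambda>k. partial_deriv l ((r(0 := e l)) s k))) = (\<Sum>m<N. H l m * E l m)"
      if "l < N" for l
    proof -
      have "E l m = cofr N (r(0 := e l)) s m" if "m < N" for m
        unfolding E_def using detf_row[OF s, of "r(0 := e l)" "e m"] e_sum[OF that] by simp
      then show ?thesis using detf_row[OF s, of "r(0 := e l)" "H l"] False by (simp add: H_def)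
    qed
    then have eq: "(\<Sum>l<N. detf N ((r(0 := e l))(s := \<lambda>k. partial_deriv l ((r(0 := e l)) s k)))) =
      (\<Sum>l<N. \<Sum>m<N. H l m * E l m)" by simp
    have "(\<Sum>l<N. \<Sum>m<N. H l m * E l m) = (\<Sum>l<N. \<Sum>m<N. - (H m l * E m l))"
      by (intro sum.cong refl) (metis E H mult_minus_right)
    also have "\<dots> = - (\<Sum>l<N. \<Sum>m<N. H m l * E m l)" by (simp add: sum_negf)
    also have "(\<Sum>l<N. \<Sum>m<N. H m l * E m l) = (\<Sum>l<N. \<Sum>m<N. H l m * E l m)" by (rule sum.swap)
    \<comment> \<open>The sum equals its own negative; characteristic 0 allows division by
      2.\<close>
    finally have "2 * (\<Sum>l<N. \<Sum>m<N. H l m * E l m) = 0" by (simp add: eq_neg_iff_add_eq_0)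
    then show ?thesis unfolding eq by simp
  qed
  have "(\<Sum>l<N. partial_deriv l (hcoef l)) =
      (\<Sum>l<N. \<Sum>s<N. detf N ((r(0 := e l))(s := \<lambda>k. partial_deriv l ((r(0 := e l)) s k))))"
    by (intro sum.cong refl) (simp add: hc derivation.D_detf[OF derivation_partial_deriv])
  also have "\<dots> = (\<Sum>s<N. \<Sum>l<N. detf N ((r(0 := e l))(s := \<lambda>k. partial_deriv l ((r(0 := e l)) s k))))"
    by (rule sum.swap)
  also have "\<dots> = 0" using term_s by simp
  finally show ?thesis .
qed

text \<open>The derivation \<open>hder\<close> acts on the determinant \<open>{us}\<close> row by
  row. Moving it past \<open>\<partial>\<^sub>j\<close> costs the terms with \<open>M\<close>; by
  \<open>detf_trace\<close> these add up to the divergence times the determinant, hence to 0. The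
  last row contributes nothing because \<open>hder \<Omega> = 0\<close>.\<close>

lemma jacobian_fundamental_identity:
  assumes us: "length us = Suc (length vs)"
  shows "jacobian_det (jacobian_det (us @ [\<Omega>]) # vs @ [\<Omega>]) =
    (\<Sum>s<length us. jacobian_det (us[s := jacobian_det (us ! s # vs @ [\<Omega>])] @ [\<Omega>]))"
proof -
  define R where "R = jrow (us @ [\<Omega>])"
  define M where "M = (\<lambda>l j. partial_deriv j (hcoef l))"
  have com: "hder (partial_deriv j g) = partial_deriv j (hder g) - (\<Sum>l<N. partial_deriv l g * M l j)" for j g
  proof -
    have "partial_deriv j (hder g) = (\<Sum>l<N. partial_deriv l g * M l j + partial_deriv j (partial_deriv l g) * hcoef l)"
      by (simp add: hder_eq partial_deriv_sum partial_deriv_mult M_def)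
    moreover have "hder (partial_deriv j g) = (\<Sum>l<N. partial_deriv j (partial_deriv l g) * hcoef l)"
      unfolding hder_eq by (simp add: partial_deriv_commute[of _ j])
    ultimately show ?thesis by (simp add: sum.distrib)
  qed
  have row: "detf N (R(s := \<lambda>j. hder (R s j))) = detf N (R(s := \<lambda>j. partial_deriv j (hder ((us @ [\<Omega>]) ! s))))
      - detf N (R(s := \<lambda>j. \<Sum>l<N. R s l * M l j))" if "s < N" for s
  proof -
    have "(\<lambda>j. hder (R s j)) = (\<lambda>j. partial_deriv j (hder ((us @ [\<Omega>]) ! s)) - (\<Sum>l<N. R s l * M l j))"
      by (simp add: R_def jrow_def com)
    then show ?thesis using that by (simp add: detf_row_diff)
  qed
  have "jacobian_det (jacobian_det (us @ [\<Omega>]) # vs @ [\<Omega>]) = hder (detf N R)"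
    by (simp add: hder_def R_def jacobian_detf us N)
  also have "\<dots> = (\<Sum>s<N. detf N (R(s := \<lambda>j. hder (R s j))))"
    by (rule derivation.D_detf[OF derivation_hder])
  also have "\<dots> = (\<Sum>s<N. detf N (R(s := \<lambda>j. partial_deriv j (hder ((us @ [\<Omega>]) ! s)))))
      - (\<Sum>l<N. M l l) * detf N R"
    using row by (simp add: sum_subtractf flip: detf_trace)
  also have "(\<Sum>l<N. M l l) = 0" unfolding M_def by (rule divergence_hcoef)
  also have "(\<Sum>s<N. detf N (R(s := \<lambda>j. partial_deriv j (hder ((us @ [\<Omega>]) ! s))))) =
      (\<Sum>s<length us. detf N (R(s := \<lambda>j. partial_deriv j (hder (us ! s)))))"
    using detf_row_zero[of "Suc (length vs)" N R] by (simp add: N us hder_potential nth_append)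
  also have "\<dots> = (\<Sum>s<length us. jacobian_det (us[s := hder (us ! s)] @ [\<Omega>]))"
    by (intro sum.cong refl) (simp add: jacobian_update_append R_def N us)
  finally show ?thesis by (simp add: hder_def)
qed

end

text \<open>Each term of the Leibniz expansion takes exactly one factor from every row.\<close>

lemma detf_mem:
  fixes X :: "int \<Rightarrow> 'a::comm_ring_1 set"
  assumes zero: "\<And>d. 0 \<in> X d" and add: "\<And>d p q. p \<in> X d \<Longrightarrow> q \<in> X d \<Longrightarrow> p + q \<in> X d"
    and uminus: "\<And>d p. p \<in> X d \<Longrightarrow> - p \<in> X d" and one: "1 \<in> X 0"
    and mult: "\<And>d e p q. p \<in> X d \<Longrightarrow> q \<in> X e \<Longrightarrow> p * q \<in> X (d + e)"
    and r: "\<And>i j. i < N \<Longrightarrow> r i j \<in> X (e i)"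
  shows "detf N r \<in> X (\<Sum>i<N. e i)"
proof -
  have prod: "(\<Prod>i\<in>S. r i (p i)) \<in> X (\<Sum>i\<in>S. e i)" if "finite S" "S \<subseteq> {..<N}" for S p
    using that by (induction S rule: finite_induct) (auto intro!: one mult r)
  have sgn: "of_int (sign p) * x \<in> X d" if "x \<in> X d" for p :: "nat \<Rightarrow> nat" and x d
    using that uminus by (cases "evenperm p") (simp_all add: sign_def)
  have sum: "sum f S \<in> X d" if "\<And>x. x \<in> S \<Longrightarrow> f x \<in> X d" for f and S :: "(nat \<Rightarrow> nat) set" and d
    using that by (induction S rule: infinite_finite_induct) (auto intro!: zero add)
  show ?thesis unfolding detf_leibniz
    by (intro sum sgn) (use prod[of "{0..<N}"] in \<open>auto simp: lessThan_atLeast0\<close>)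
qed

text \<open>Stated for a general family \<open>X\<close> since it serves three times: for the
  constant family \<open>pvars V\<close>, for degree bounds and for homogeneity. Each row costs one
  degree by differentiation.\<close>

lemma jacobian_mem:
  fixes X :: "int \<Rightarrow> 'k::comm_ring_1 mpoly set"
  assumes zero: "\<And>d. 0 \<in> X d" and add: "\<And>d p q. p \<in> X d \<Longrightarrow> q \<in> X d \<Longrightarrow> p + q \<in> X d"
    and uminus: "\<And>d p. p \<in> X d \<Longrightarrow> - p \<in> X d" and one: "1 \<in> X 0"
    and mult: "\<And>d e p q. p \<in> X d \<Longrightarrow> q \<in> X e \<Longrightarrow> p * q \<in> X (d + e)"
    and deriv: "\<And>d i p. p \<in> X d \<Longrightarrow> partial_deriv i p \<in> X (d - 1)"
    and fs: "list_all2 (\<lambda>f d. f \<in> X d) fs ds" and \<Omega>: "\<Omega> \<in> X d"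
  shows "jacobian_det (fs @ [\<Omega>]) \<in> X (sum_list ds + d - int (length fs) - 1)"
proof -
  have len: "length ds = length fs" using fs by (simp add: list_all2_lengthD)
  have "jrow (fs @ [\<Omega>]) i j \<in> X ((ds @ [d]) ! i - 1)" if "i < Suc (length fs)" for i j
    unfolding jrow_def using that fs \<Omega> len
    by (intro deriv) (auto simp: nth_append list_all2_conv_all_nth less_Suc_eq)
  then have "detf (Suc (length fs)) (jrow (fs @ [\<Omega>])) \<in> X (\<Sum>i<Suc (length fs). (ds @ [d]) ! i - 1)"
    by (intro detf_mem zero add uminus one mult)
  moreover have "(\<Sum>i<Suc (length fs). (ds @ [d]) ! i - 1) = sum_list ds + d - int (length fs) - 1"
    using len by (simp add: sum_subtractf nth_append sum_list_sum_nth lessThan_atLeast0)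
  moreover have "length (fs @ [\<Omega>]) = Suc (length fs)" by simp
  ultimately show ?thesis by (simp only: jacobian_detf)
qed

lemma jacobian_pvars:
  assumes "set fs \<subseteq> pvars V" "\<Omega> \<in> pvars V"
  shows "jacobian_det (fs @ [\<Omega>]) \<in> pvars V"
  by (rule jacobian_mem[where X="\<lambda>_. pvars V" and ds="map (\<lambda>_. 0) fs" and d=0])
    (use assms in \<open>auto intro: pvars_add pvars_uminus pvars_mult pvars_partial_deriv simp: list_all2_conv_all_nth\<close>)

text \<open>In the matrix of \<open>{t\<^sub>\<tau>\<^sub>0, \<dots>, g, \<dots>}\<close> the permutation \<open>\<tau>\<close> is the only one
  without a vanishing entry, as \<open>g\<close> occupies one slot and is free of \<open>t\<^sub>j\<close> to first order.\<close>

lemma jacobian_coordinates: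
  fixes g \<Omega> :: "'k::comm_ring_1 mpoly"
  assumes j: "j \<le> n" and a: "a < n" and g: "partial_deriv j g = 0"
  defines "\<tau> \<equiv> transpose j n"
  shows "jacobian_det ((map (\<lambda>r. tvar (\<tau> r)) [0..<n])[a := g] @ [\<Omega>]) =
    of_int (sign \<tau>) * (partial_deriv (\<tau> a) g * partial_deriv j \<Omega>)"
proof -
  define fs where "fs = (map (\<lambda>r. tvar (\<tau> r)) [0..<n])[a := g] @ [\<Omega>]"
  have len: "length fs = Suc n" by (simp add: fs_def)
  \<comment> \<open>The transposition puts the variables other than \<open>t\<^sub>j\<close> into
    the slots below n and assigns column j to the last row, that of \<Omega>.\<close>
  have \<tau>: "\<tau> permutes {0..<Suc n}" unfolding \<tau>_def using j by (intro permutes_swap_id) auto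
  have row_t: "jrow fs i k = (if k = \<tau> i then 1 else 0)" if "i < n" "i \<noteq> a" for i k
    using that by (simp add: jrow_def fs_def nth_append partial_deriv_tvar)
  have row_a: "jrow fs a k = partial_deriv k g" for k using a by (simp add: jrow_def fs_def nth_append)
  have row_n: "jrow fs n k = partial_deriv k \<Omega>" for k by (simp add: jrow_def fs_def nth_append)
  have \<tau>n: "\<tau> n = j" by (simp add: \<tau>_def)
  have zero: "(\<Prod>i=0..<Suc n. jrow fs i (p i)) = 0" if p: "p permutes {0..<Suc n}" "p \<noteq> \<tau>" for p
  proof (rule ccontr)
    assume nz: "(\<Prod>i=0..<Suc n. jrow fs i (p i)) \<noteq> 0"
    have nz': "jrow fs i (p i) \<noteq> 0" if "i < Suc n" for i
    proof
      assume "jrow fs i (p i) = 0"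
      then have "(\<Prod>i=0..<Suc n. jrow fs i (p i)) = 0" by (intro prod_zero) (use that in auto)
      then show False using nz by simp
    qed
    \<comment> \<open>The coordinate rows force p to agree with \<tau> except in the rows a and n.
      The columns left are \<open>\<tau> a\<close> and j, and row a has a zero in column j.\<close>
    have pt: "p i = \<tau> i" if "i < n" "i \<noteq> a" for i using nz'[of i] that row_t[OF that] by (auto split: if_splits)
    have pinj: "p x = p y \<longleftrightarrow> x = y" for x y using permutes_inj[OF p(1)] by (auto dest: injD)
    have tinj: "\<tau> x = \<tau> y \<longleftrightarrow> x = y" for x y using permutes_inj[OF \<tau>] by (auto dest: injD)
    have surj: "\<exists>y<Suc n. x = \<tau> y" if "x < Suc n" for x
      using permutes_image[OF \<tau>] that by (metis (mono_tags, lifting) atLeastLessThan_iff imageE le0)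
    have pj: "p a \<noteq> j" using nz'[of a] a g row_a by auto
    obtain y where y: "y < Suc n" "p a = \<tau> y" using surj[of "p a"] permutes_in_image[OF p(1), of a] a by auto
    have "y = a"
    proof (rule ccontr)
      assume "y \<noteq> a"
      moreover have "y \<noteq> n" using pj y(2) \<tau>n by auto
      ultimately have "p y = \<tau> y" using pt y(1) by simp
      then show False using y(2) pinj \<open>y \<noteq> a\<close> by metis
    qed
    then have pa: "p a = \<tau> a" using y by simp
    obtain z where z: "z < Suc n" "p n = \<tau> z" using surj[of "p n"] permutes_in_image[OF p(1), of n] by auto
    have "z = n"
    proof (rule ccontr)
      assume "z \<noteq> n"
      then have "p z = \<tau> z" using pt pa z(1) by (cases "z = a") auto
      then show False using z(2) pinj \<open>z \<noteq> n\<close> by metis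
    qed
    then have pn: "p n = \<tau> n" using z by simp
    have "p i = \<tau> i" for i
    proof (cases "i < Suc n")
      case True
      then show ?thesis using pt pa pn by (cases "i = a"; cases "i = n") auto
    next
      case False
      then show ?thesis using permutes_not_in[OF p(1), of i] permutes_not_in[OF \<tau>, of i] by simp
    qed
    then show False using p(2) by auto
  qed
  have "jacobian_det fs = (\<Sum>p | p permutes {0..<Suc n}. of_int (sign p) * (\<Prod>i=0..<Suc n. jrow fs i (p i)))"
    by (simp only: jacobian_detf len detf_leibniz)
  also have "\<dots> = (\<Sum>p\<in>{\<tau>}. of_int (sign p) * (\<Prod>i=0..<Suc n. jrow fs i (p i)))"
    by (rule sum.mono_neutral_right) (use \<tau> zero in \<open>auto simp: finite_permutations\<close>)
  also have "\<dots> = of_int (sign \<tau>) * ((\<Prod>i=0..<n. jrow fs i (\<tau> i)) * partial_deriv j \<Omega>)"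
    by (simp add: row_n \<tau>n)
  also have "(\<Prod>i=0..<n. jrow fs i (\<tau> i)) = jrow fs a (\<tau> a) * (\<Prod>i\<in>{0..<n} - {a}. jrow fs i (\<tau> i))"
    by (rule prod.remove) (use a in auto)
  also have "(\<Prod>i\<in>{0..<n} - {a}. jrow fs i (\<tau> i)) = 1"
    by (rule prod.neutral) (simp add: row_t)
  finally have "jacobian_det fs = of_int (sign \<tau>) * (partial_deriv (\<tau> a) g * partial_deriv j \<Omega>)"
    by (simp only: row_a mult_1_right)
  then show ?thesis by (simp only: fs_def)
qed

section \<open>Uniqueness of the filtration of polynomials\<close>

text \<open>Bounds are integers because filtrations are indexed by integers; a negative bound leaves
  only 0, without a convention for the degree of 0.\<close>

definition degle :: "int \<Rightarrow> 'k::comm_ring_1 mpoly \<Rightarrow> bool"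
  where "degle D p \<longleftrightarrow> (\<forall>m. hcomp m p \<noteq> 0 \<longrightarrow> int m \<le> D)"

lemma degle_zero [simp]: "degle D 0"
  by (simp add: degle_def)

lemma degle_add: "degle D p \<Longrightarrow> degle D q \<Longrightarrow> degle D (p + q)"
  unfolding degle_def hcomp_add by (metis add.right_neutral)

lemma degle_uminus: "degle D p \<Longrightarrow> degle D (- p)"
  by (simp add: degle_def hcomp_uminus)

lemma degle_mult: "degle D p \<Longrightarrow> degle E q \<Longrightarrow> degle (D + E) (p * q)"
  unfolding degle_def
proof (intro allI impI)
  fix m assume p: "\<forall>m. hcomp m p \<noteq> 0 \<longrightarrow> int m \<le> D" and q: "\<forall>m. hcomp m q \<noteq> 0 \<longrightarrow> int m \<le> E"
    and "hcomp m (p * q) \<noteq> 0"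
  then obtain i where i: "i \<le> m" "hcomp i p * hcomp (m - i) q \<noteq> 0"
    unfolding hcomp_mult by (metis (no_types, lifting) atMost_iff sum.not_neutral_contains_not_neutral)
  then have "hcomp i p \<noteq> 0" "hcomp (m - i) q \<noteq> 0" by auto
  then have "int i \<le> D" "int (m - i) \<le> E" using p q by blast+
  then show "int m \<le> D + E" using i(1) by linarith
qed

lemma degle_partial_deriv: "degle D p \<Longrightarrow> degle (D - 1) (partial_deriv i p)"
  unfolding degle_def hcomp_partial_deriv
proof (intro allI impI)
  fix m assume "\<forall>m. hcomp m p \<noteq> 0 \<longrightarrow> int m \<le> D" "partial_deriv i (hcomp (Suc m) p) \<noteq> 0"
  moreover from this(2) have "hcomp (Suc m) p \<noteq> 0" by auto
  ultimately have "int (Suc m) \<le> D" by blast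
  then show "int m \<le> D - 1" by simp
qed

lemma degle_mono: "degle D p \<Longrightarrow> D \<le> E \<Longrightarrow> degle E p"
  unfolding degle_def by fastforce

lemma degle_homogeneous: "homogeneous d p \<Longrightarrow> degle (int d) p"
  by (auto simp: degle_def hcomp_homogeneous)

lemma degle_mconst [simp]: "degle 0 (mconst c)"
  using degle_homogeneous[OF homogeneous_mconst] by simp

lemma degle_one [simp]: "degle 0 1"
  using degle_mconst[of 1] by simp

lemma degle_tdeg: "degle (int (tdeg p)) p"
  unfolding degle_def using hcomp_above_tdeg[of p] by (metis not_le of_nat_le_iff)

lemma degle_negative: "degle D p \<Longrightarrow> D < 0 \<Longrightarrow> p = 0"
proof (rule ccontr)
  assume D: "degle D p" "D < 0" "p \<noteq> 0"
  then have "int (tdeg p) \<le> D" using hcomp_tdeg_nonzero unfolding degle_def by blast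
  then show False using D(2) by linarith
qed

lemma tdeg_le_degle: "degle (int d) p \<Longrightarrow> tdeg p \<le> d"
  unfolding tdeg_le_iff degle_def by (metis not_le of_nat_le_iff)

lemma jacobian_degle:
  assumes "list_all2 (\<lambda>f d. degle d f) fs ds" "degle d \<Omega>"
  shows "degle (sum_list ds + d - int (length fs) - 1) (jacobian_det (fs @ [\<Omega>]))"
proof -
  have "jacobian_det (fs @ [\<Omega>]) \<in> {p. degle (sum_list ds + d - int (length fs) - 1) p}"
    by (rule jacobian_mem[where X="\<lambda>d. {p. degle d p}"])
      (use assms in \<open>auto intro: degle_add degle_uminus degle_mult degle_partial_deriv\<close>)
  then show ?thesis by simp
qed

text \<open>Forms are built from 1 by sums, scalars and multiplication by variables. It extends
  bounds known for the variables to all forms.\<close>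

lemma homogeneous_generated:
  fixes X :: "nat \<Rightarrow> 'k::comm_ring_1 mpoly set"
  assumes zero: "\<And>d. 0 \<in> X d" and add: "\<And>d p q. p \<in> X d \<Longrightarrow> q \<in> X d \<Longrightarrow> p + q \<in> X d"
    and smult: "\<And>d c p. p \<in> X d \<Longrightarrow> mconst c * p \<in> X d" and one: "1 \<in> X 0"
    and var: "\<And>d i p. i \<in> V \<Longrightarrow> p \<in> X d \<Longrightarrow> tvar i * p \<in> X (Suc d)"
    and p: "homogeneous d p" "p \<in> pvars V"
  shows "p \<in> X d"
proof -
  have mono: "Poly_Mapping.single m 1 \<in> X d" if "mon_degree m = d" "Poly_Mapping.keys m \<subseteq> V" for m d
    using that
  proof (induction d arbitrary: m)
    case 0
    then show ?case using one by simp
  next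
    case (Suc d)
    then have "m \<noteq> 0" by auto
    then obtain i where i: "Poly_Mapping.lookup m i \<noteq> 0" using poly_mapping_eqI[of m 0] by auto
    let ?m = "m - Poly_Mapping.single i 1"
    have eq: "m = Poly_Mapping.single i 1 + ?m"
      using i by (intro poly_mapping_eqI) (auto simp: lookup_add lookup_minus lookup_single when_def)
    then have "mon_degree m = 1 + mon_degree ?m" by (metis mon_degree_add mon_degree_single)
    then have "mon_degree ?m = d" using Suc.prems(1) by simp
    moreover have "Poly_Mapping.keys ?m \<subseteq> V"
    proof
      fix k assume "k \<in> Poly_Mapping.keys ?m"
      then have "k \<in> Poly_Mapping.keys m" by (auto simp: in_keys_iff lookup_minus)
      then show "k \<in> V" using Suc.prems(2) by blast
    qed
    ultimately have "tvar i * Poly_Mapping.single ?m 1 \<in> X (Suc d)"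
      using Suc.IH Suc.prems(2) i by (intro var) (auto simp: in_keys_iff)
    moreover have "tvar i * Poly_Mapping.single ?m 1 = (Poly_Mapping.single m 1 :: 'k mpoly)"
      using tvar_power_mult_single[of 1 m i "1::'k"] i by simp
    ultimately show ?case by simp
  qed
  have "(\<Sum>m\<in>S. mconst (Poly_Mapping.lookup p m) * Poly_Mapping.single m 1) \<in> X d"
    if "finite S" "S \<subseteq> Poly_Mapping.keys p" for S
    using that
  proof (induction S rule: finite_induct)
    case (insert m S)
    then have "m \<in> Poly_Mapping.keys p" by simp
    then have "mon_degree m = d" "Poly_Mapping.keys m \<subseteq> V" using p by (auto simp: homogeneous_def pvars_def)
    then show ?case using insert by (auto intro!: add smult mono)
  qed (simp add: zero)
  from this[of "Poly_Mapping.keys p"] show ?thesis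
    using mpoly_sum_single[of p] by (simp add: mconst_def mult_single)
qed

text \<open>\<open>Om_pow\<close> stands for the finite dimension of the Jacobian ring, with one
  exponent \<open>M\<close> for all variables; \<open>fin_dim_imp_powers\<close> provides
  it.\<close>

locale potential =
  fixes n d0 :: nat and \<Omega> :: "'k::field_char_0 mpoly" and \<xi> :: 'k and M :: nat
  assumes n: "n \<ge> 3" and d0: "d0 \<ge> 2" and xi: "\<xi> \<noteq> 0"
    and Om_vars: "\<Omega> \<in> pvars {..<n + 1}" and Om_hom: "homogeneous (n + 1 + d0) \<Omega>"
    and Om_pow: "i < n + 1 \<Longrightarrow> \<exists>q. (\<forall>l<n + 1. q l \<in> pvars {..<n + 1}) \<and>
      tvar i ^ M = (\<Sum>l<n + 1. q l * partial_deriv l \<Omega>)"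
begin

abbreviation V :: "nat set" where "V \<equiv> {..<n + 1}"

abbreviation dOm :: nat where "dOm \<equiv> n + 1 + d0"

lemma Om_irreducible: "irreducible \<Omega>"
  by (rule irreducible_potential[OF _ Om_vars Om_hom _ Om_pow]) (use n in auto)

lemma Om_nonzero: "\<Omega> \<noteq> 0"
  using Om_irreducible by (simp add: irreducible_def)

lemma Om_prime: "a \<in> pvars V \<Longrightarrow> b \<in> pvars V \<Longrightarrow> \<Omega> dvd a * b \<Longrightarrow> \<Omega> dvd a \<or> \<Omega> dvd b"
  using irreducible_imp_prime_in[OF _ Om_vars Om_irreducible] unfolding prime_in_def by blast

definition I :: "'k mpoly set" where "I = {(\<Omega> - mconst \<xi>) * h | h. h \<in> pvars V}"

lemma I_mem: "h \<in> pvars V \<Longrightarrow> (\<Omega> - mconst \<xi>) * h \<in> I"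
  unfolding I_def by blast

lemma zero_I [simp]: "0 \<in> I"
  using I_mem[of 0] by simp

lemma tdeg_Om_xi: "tdeg (\<Omega> - mconst \<xi>) = dOm" and hcomp_Om_xi: "hcomp dOm (\<Omega> - mconst \<xi>) = \<Omega>"
proof -
  show h: "hcomp dOm (\<Omega> - mconst \<xi>) = \<Omega>"
    by (simp add: hcomp_diff hcomp_homogeneous[OF Om_hom] hcomp_homogeneous[OF homogeneous_mconst])
  have "tdeg (\<Omega> - mconst \<xi>) \<le> dOm"
    unfolding tdeg_le_iff
    by (auto simp: hcomp_diff hcomp_homogeneous[OF Om_hom] hcomp_homogeneous[OF homogeneous_mconst])
  moreover have "\<not> tdeg (\<Omega> - mconst \<xi>) < dOm" using hcomp_above_tdeg h Om_nonzero by metis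
  ultimately show "tdeg (\<Omega> - mconst \<xi>) = dOm" by simp
qed

text \<open>The leading form of \<open>\<Omega> - \<xi>\<close> is \<Omega>, and leading forms
  multiply.\<close>

lemma I_top:
  assumes "f \<in> I" "f \<noteq> 0"
  shows "tdeg f \<ge> dOm" "\<Omega> dvd hcomp (tdeg f) f"
proof -
  obtain h where h: "f = (\<Omega> - mconst \<xi>) * h" using assms(1) unfolding I_def by blast
  then have t: "tdeg f = dOm + tdeg h" using assms(2) tdeg_Om_xi by (simp add: tdeg_mult)
  then show "tdeg f \<ge> dOm" by simp
  have "hcomp (tdeg f) f = \<Omega> * hcomp (tdeg h) h"
    unfolding t using hcomp_tdeg_mult[of "\<Omega> - mconst \<xi>" h] tdeg_Om_xi hcomp_Om_xi h by simp
  then show "\<Omega> dvd hcomp (tdeg f) f" by simp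
qed

text \<open>As \<Omega> is homogeneous, the cofactor may be replaced by its component of degree
  \<open>m - dOm\<close>. The bound is an integer so as to include \<open>m < dOm\<close>, where f
  is 0.\<close>

lemma Om_dvd_homogeneous:
  assumes f: "homogeneous m f" "f \<in> pvars V" "\<Omega> dvd f"
  obtains u where "f = \<Omega> * u" "u \<in> pvars V" "degle (int m - int dOm) u"
proof (cases "f = 0")
  case True
  then show thesis using that[of 0] by simp
next
  case False
  obtain u where u: "f = u * \<Omega>" using f(3) by (metis dvd_def mult.commute)
  have "f = hcomp m (u * \<Omega>)" using hcomp_homogeneous[OF f(1), of m] u by simp
  also have "\<dots> = (if dOm \<le> m then hcomp (m - dOm) u * \<Omega> else 0)"
    by (rule hcomp_mult_homogeneous[OF Om_hom])
  finally have m: "dOm \<le> m" "f = \<Omega> * hcomp (m - dOm) u"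
    using False by (auto simp: mult.commute split: if_splits)
  moreover have "u \<in> pvars V" using pvars_factor[of u \<Omega> V] f(2) u False by simp
  moreover have "degle (int m - int dOm) (hcomp (m - dOm) u)"
    using degle_homogeneous[of "m - dOm" "hcomp (m - dOm) u"] m(1) by (simp add: of_nat_diff)
  ultimately show thesis using that pvars_hcomp by blast
qed

text \<open>Modulo \<open>I\<close> a factor \<Omega> may be traded for the constant \<xi>, which
  lowers the degree by \<open>dOm\<close>. Conversely, if the degree of a nonzero f drops modulo h
  in \<open>I\<close>, then f is the leading form of h.\<close>

lemma symbol_zero_iff:
  assumes f: "homogeneous m f" "f \<in> pvars V"
  shows "(\<exists>h\<in>I. degle (int m - 1) (f - h)) \<longleftrightarrow> \<Omega> dvd f"
proof
  assume "\<Omega> dvd f"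
  then obtain u where u: "f = \<Omega> * u" "u \<in> pvars V" "degle (int m - int dOm) u"
    using Om_dvd_homogeneous f by blast
  have "f - (\<Omega> - mconst \<xi>) * u = mconst \<xi> * u" by (simp add: u(1) algebra_simps)
  moreover have "degle (0 + (int m - int dOm)) (mconst \<xi> * u)" by (intro degle_mult u(3) degle_mconst)
  then have "degle (int m - 1) (mconst \<xi> * u)" by (rule degle_mono) simp
  ultimately show "\<exists>h\<in>I. degle (int m - 1) (f - h)" using I_mem[OF u(2)] by metis
next
  assume "\<exists>h\<in>I. degle (int m - 1) (f - h)"
  then obtain h where h: "h \<in> I" "degle (int m - 1) (f - h)" by blast
  show "\<Omega> dvd f"
  proof (cases "f = 0")
    case False
    have d: "hcomp e (f - h) = 0" if "e \<ge> m" for e using h(2) that unfolding degle_def by fastforce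
    have top: "hcomp m h = f" using d[of m] by (simp add: hcomp_diff hcomp_homogeneous[OF f(1)])
    have "hcomp e h = 0" if "e > m" for e using d[of e] that by (simp add: hcomp_diff hcomp_homogeneous[OF f(1)])
    then have "tdeg h \<le> m" by (simp add: tdeg_le_iff)
    moreover have "\<not> tdeg h < m" using top hcomp_above_tdeg False by metis
    ultimately have "tdeg h = m" by simp
    moreover have "h \<noteq> 0" using top False by auto
    ultimately show ?thesis using I_top(2)[OF h(1)] top by simp
  qed simp
qed

text \<open>The preimage among polynomials of the degree filtration of \<open>P\<close>. The sign
  turns growing degrees into decreasing indices.\<close>

definition std :: "int \<Rightarrow> 'k mpoly set"
  where "std i = {f \<in> pvars V. \<exists>h\<in>I. degle (- i) (f - h)}"

lemma I_vars: "h \<in> I \<Longrightarrow> h \<in> pvars V"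
  unfolding I_def using Om_vars by (auto intro!: pvars_mult pvars_diff)

text \<open>Take a representative of least degree modulo \<open>I\<close>. If its leading form were
  \<open>\<Omega> * u\<close>, subtracting \<open>(\<Omega> - \<xi>) * u\<close> would lower the
  degree further.\<close>

lemma reduced_representative:
  assumes f: "f \<in> pvars V" "f \<notin> I"
  obtains h where "h \<in> I" "f - h \<noteq> 0" "\<not> \<Omega> dvd hcomp (tdeg (f - h)) (f - h)"
proof -
  obtain h where h: "h \<in> I" and min: "\<And>h'. h' \<in> I \<Longrightarrow> tdeg (f - h) \<le> tdeg (f - h')"
    using ex_has_least_nat[of "\<lambda>h. h \<in> I" 0 "\<lambda>h. tdeg (f - h)"] by auto
  define f' where "f' = f - h"
  define m where "m = tdeg f'"
  have nz: "f' \<noteq> 0" using f(2) h f'_def by auto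
  have "\<not> \<Omega> dvd hcomp m f'"
  proof
    assume "\<Omega> dvd hcomp m f'"
    moreover have "hcomp m f' \<in> pvars V" using pvars_hcomp pvars_diff f(1) I_vars[OF h] f'_def by metis
    ultimately obtain u where u: "hcomp m f' = \<Omega> * u" "u \<in> pvars V" "degle (int m - int dOm) u"
      using Om_dvd_homogeneous[of m "hcomp m f'"] by auto
    have "hcomp m f' \<noteq> 0" using hcomp_tdeg_nonzero nz m_def by metis
    then have "u \<noteq> 0" using u(1) by auto
    \<comment> \<open>In particular m is positive, so that \<open>m - 1\<close> below is not
      truncated.\<close>
    then have "dOm \<le> m" using degle_negative[OF u(3)] by linarith
    have mu: "degle (0 + (int m - int dOm)) (mconst \<xi> * u)" by (intro degle_mult u(3) degle_mconst)
    have hI: "h + (\<Omega> - mconst \<xi>) * u \<in> I"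
    proof -
      obtain h' where h': "h = (\<Omega> - mconst \<xi>) * h'" "h' \<in> pvars V" using h unfolding I_def by blast
      have "h + (\<Omega> - mconst \<xi>) * u = (\<Omega> - mconst \<xi>) * (h' + u)" by (simp only: h'(1) distrib_left)
      then show ?thesis using I_mem[OF pvars_add[OF h'(2) u(2)]] by simp
    qed
    have eq: "f - (h + (\<Omega> - mconst \<xi>) * u) = f' - hcomp m f' + mconst \<xi> * u"
      by (simp add: f'_def u(1)[unfolded f'_def] algebra_simps)
    have "degle (int (m - 1)) (f' - hcomp m f')"
      unfolding degle_def
    proof (intro allI impI)
      fix e assume e: "hcomp e (f' - hcomp m f') \<noteq> 0"
      then have "e \<noteq> m" by (auto simp: hcomp_diff hcomp_homogeneous[OF homogeneous_hcomp])
      moreover from this e have "hcomp e f' \<noteq> 0" by (simp add: hcomp_diff hcomp_homogeneous[OF homogeneous_hcomp])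
      then have "e \<le> m" using hcomp_above_tdeg[of f' e] m_def by linarith
      ultimately show "int e \<le> int (m - 1)" by simp
    qed
    moreover have "degle (int (m - 1)) (mconst \<xi> * u)" using mu by (rule degle_mono) simp
    ultimately have "tdeg (f - (h + (\<Omega> - mconst \<xi>) * u)) \<le> m - 1"
      unfolding eq by (intro tdeg_le_degle degle_add)
    then show False using min[OF hI] \<open>dOm \<le> m\<close> by (simp add: m_def f'_def)
  qed
  then show thesis using that h nz unfolding f'_def m_def by blast
qed

end

text \<open>The hypotheses are those of the theorem for the preimages of a filtration of
  \<open>P\<close>: \<open>dom\<close> is the integrality of gr, \<open>F0\<close> its
  connectedness, \<open>bra\<close> the bound on brackets.\<close>

lemma (in potential) std_unique:
  fixes F :: "int \<Rightarrow> 'k mpoly set"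
  assumes sub: "\<And>i. F i \<subseteq> pvars V"
    and add: "\<And>i f g. f \<in> F i \<Longrightarrow> g \<in> F i \<Longrightarrow> f + g \<in> F i"
    and smult: "\<And>i c f. f \<in> F i \<Longrightarrow> mconst c * f \<in> F i"
    and IF: "\<And>i. I \<subseteq> F i"
    and dec: "\<And>i. F (i + 1) \<subseteq> F i"
    and mult: "\<And>i j f g. f \<in> F i \<Longrightarrow> g \<in> F j \<Longrightarrow> f * g \<in> F (i + j)"
    and exh: "\<And>f. f \<in> pvars V \<Longrightarrow> f \<notin> I \<Longrightarrow> \<exists>i. f \<in> F i \<and> f \<notin> F (i + 1)"
    and dom: "\<And>i j f g. f \<in> F i \<Longrightarrow> f \<notin> F (i + 1) \<Longrightarrow> g \<in> F j \<Longrightarrow> g \<notin> F (j + 1) \<Longrightarrow> f * g \<notin> F (i + j + 1)"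
    and one: "1 \<in> F 0" "1 \<notin> F 1"
    and F0: "\<And>f. f \<in> F 0 \<Longrightarrow> \<exists>c. \<exists>h\<in>I. f = mconst c + h"
    and bra: "\<And>fs is. length fs = n \<Longrightarrow> list_all2 (\<lambda>f i. f \<in> F i) fs is \<Longrightarrow>
      jacobian_det (fs @ [\<Omega>]) \<in> F (sum_list is - int d0)"
  shows "F i = std i"
proof -
  have zero: "0 \<in> F i" for i using IF[of i] zero_I by blast
  have uminus: "- f \<in> F i" if "f \<in> F i" for f i using smult[OF that, of "-1"] by (simp add: mconst_minus)
  have diff: "f - g \<in> F i" if "f \<in> F i" "g \<in> F i" for f g i using add[OF that(1) uminus[OF that(2)]] by simp
  have anti: "F j \<subseteq> F i" if "i \<le> j" for i j
    using that
  proof (induction j rule: int_ge_induct)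
    case (step j)
    then show ?case using dec[of j] by auto
  qed simp
  have sumF: "sum f S \<in> F i" if "\<And>x. x \<in> S \<Longrightarrow> f x \<in> F i" for f and S :: "nat set" and i
    using that by (induction S rule: infinite_finite_induct) (auto intro: zero add)
  have tF0: "tvar i \<notin> F 0" if "i < n + 1" for i
  proof
    assume "tvar i \<in> F 0"
    then obtain c h where ch: "h \<in> I" "tvar i = mconst c + h" using F0 by blast
    then have h: "h = tvar i - mconst c" by simp
    have h1: "hcomp 1 h = tvar i" unfolding h
      by (simp add: hcomp_diff hcomp_homogeneous[OF homogeneous_tvar] hcomp_homogeneous[OF homogeneous_mconst])
    then have "h \<noteq> 0" by auto
    have "tdeg h \<le> 1" unfolding tdeg_le_iff h
      by (simp add: hcomp_diff hcomp_homogeneous[OF homogeneous_tvar] hcomp_homogeneous[OF homogeneous_mconst])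
    then show False using I_top(1)[OF ch(1) \<open>h \<noteq> 0\<close>] n by simp
  qed
  have "\<exists>a. tvar i \<in> F (- a) \<and> tvar i \<notin> F (1 - a) \<and> a \<ge> 1" if iN: "i < n + 1" for i
  proof -
    have "tvar i \<notin> I" using tF0[OF iN] IF by blast
    then obtain k where k: "tvar i \<in> F k" "tvar i \<notin> F (k + 1)" using exh[of "tvar i"] pvars_tvar[of i V] iN by (metis lessThan_iff)
    have "\<not> k \<ge> 0" using tF0[OF iN] anti[of 0 k] k(1) by blast
    then show ?thesis using k by (intro exI[of _ "- k"]) (simp add: add.commute)
  qed
  \<comment> \<open>\<open>a i\<close> is the degree of \<open>t\<^sub>i\<close> for F, the negative
    of its index; it is positive because \<open>F 0\<close> contains no variable.\<close>
  then obtain a where a: "\<And>i. i < n + 1 \<Longrightarrow> tvar i \<in> F (- a i) \<and> tvar i \<notin> F (1 - a i) \<and> a i \<ge> (1::int)"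
    by metis
  define A where "A = Max (a ` V)"
  have aA: "a i \<le> A" if "i < n + 1" for i unfolding A_def using that by (intro Max_ge) auto
  have "A \<in> a ` V" unfolding A_def by (intro Max_in) auto
  then obtain i0 where i0: "i0 < n + 1" "a i0 = A" by auto
  have A1: "A \<ge> 1" using a[OF i0(1)] i0(2) by simp
  have tA: "tvar i \<in> F (- A)" if "i < n + 1" for i using a[OF that] aA[OF that] anti[of "- A" "- a i"] by auto
  have homA: "f \<in> F (- (A * int m))" if "homogeneous m f" "f \<in> pvars V" for f m
  proof (rule homogeneous_generated[where X="\<lambda>m. F (- (A * int m))", OF _ _ _ _ _ that])
    fix d i p assume i: "i \<in> V" and p: "p \<in> F (- (A * int d))"
    have "tvar i \<in> F (- A)" using tA i by auto
    from mult[OF this p] have "tvar i * p \<in> F (- A + - (A * int d))" .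
    then show "tvar i * p \<in> F (- (A * int (Suc d)))" by (simp add: algebra_simps)
  qed (use zero add smult one in auto)
  have hom_deriv: "homogeneous (n + d0) (partial_deriv l \<Omega>)" for l
    using homogeneous_partial_deriv[OF Om_hom] by simp
  \<comment> \<open>If all derivatives of \<Omega> fell short of the degree
    \<open>A * (n + d0)\<close>, the expression of \<open>tvar i0 ^ M\<close> through them would
    have degree less than \<open>A * M\<close>. By \<open>dom\<close> the powers of
    \<open>tvar i0\<close> have the exact degrees \<open>A * m\<close>.\<close>
  have "\<exists>j<n + 1. partial_deriv j \<Omega> \<notin> F (1 - A * int (n + d0))"
  proof (rule ccontr)
    assume neg: "\<not> (\<exists>j<n + 1. partial_deriv j \<Omega> \<notin> F (1 - A * int (n + d0)))"
    have allF: "partial_deriv l \<Omega> \<in> F (1 - A * int (n + d0))" if "l < n + 1" for l using neg that by blast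
    obtain q where q: "\<And>l. l < n + 1 \<Longrightarrow> q l \<in> pvars V" "tvar i0 ^ M = (\<Sum>l<n + 1. q l * partial_deriv l \<Omega>)"
      using Om_pow[OF i0(1)] by blast
    have "homogeneous M (tvar i0 ^ M :: 'k mpoly)" using homogeneous_power[OF homogeneous_tvar, of M i0] by simp
    then have "tvar i0 ^ M = hcomp M (tvar i0 ^ M :: 'k mpoly)" by (simp add: hcomp_homogeneous)
    also have "\<dots> = (\<Sum>l<n + 1. hcomp M (q l * partial_deriv l \<Omega>))" unfolding q(2) hcomp_sum ..
    also have "\<dots> \<in> F (1 - A * int M)"
    proof (rule sumF)
      fix l assume l: "l \<in> {..<n + 1}"
      show "hcomp M (q l * partial_deriv l \<Omega>) \<in> F (1 - A * int M)"
      proof (cases "n + d0 \<le> M")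
        case True
        have "hcomp (M - (n + d0)) (q l) * partial_deriv l \<Omega> \<in> F (- (A * int (M - (n + d0))) + (1 - A * int (n + d0)))"
          using l q(1) by (intro mult homA allF homogeneous_hcomp pvars_hcomp) auto
        moreover have "- (A * int (M - (n + d0))) + (1 - A * int (n + d0)) = 1 - A * int M"
          using True by (simp add: of_nat_diff algebra_simps)
        ultimately show ?thesis using True by (simp only: hcomp_mult_homogeneous[OF hom_deriv] if_True)
      qed (simp add: hcomp_mult_homogeneous[OF hom_deriv] zero)
    qed
    finally have "tvar i0 ^ M \<in> F (1 - A * int M)" .
    moreover have "tvar i0 ^ m \<in> F (- (A * int m)) \<and> tvar i0 ^ m \<notin> F (1 - A * int m)" for m
    proof (induction m)
      case (Suc m)
      have "tvar i0 * tvar i0 ^ m \<in> F (- A + - (A * int m))"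
        using mult a[OF i0(1)] i0(2) Suc.IH by blast
      moreover have "tvar i0 * tvar i0 ^ m \<notin> F (- A + - (A * int m) + 1)"
        using a[OF i0(1)] i0(2) Suc.IH by (intro dom) (auto simp: algebra_simps)
      ultimately show ?case by (simp add: algebra_simps)
    qed (use one in simp)
    ultimately show False by blast
  qed
  then obtain j where j: "j < n + 1" "partial_deriv j \<Omega> \<notin> F (1 - A * int (n + d0))" by blast
  define \<tau> where "\<tau> = transpose j n"
  define ts where "ts = map (\<lambda>r. tvar (\<tau> r) :: 'k mpoly) [0..<n]"
  have \<tau>_lt: "\<tau> r < n + 1" if "r < n" for r
    using that j(1) by (auto simp: \<tau>_def transpose_def)
  have sgn: "f \<in> F i" if "of_int (sign \<tau>) * f \<in> F i" for f i
    using that uminus[OF that] by (cases "evenperm \<tau>") (simp_all add: sign_def)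
  have A_eq: "A = 1"
  proof (rule ccontr)
    assume "A \<noteq> 1"
    then have A2: "A \<ge> 2" using A1 by simp
    have "list_all2 (\<lambda>f i. f \<in> F i) ts (map (\<lambda>r. - a (\<tau> r)) [0..<n])"
      using a \<tau>_lt by (auto simp: ts_def list_all2_conv_all_nth)
    then have J: "jacobian_det (ts @ [\<Omega>]) \<in> F (sum_list (map (\<lambda>r. - a (\<tau> r)) [0..<n]) - int d0)"
      by (intro bra) (simp add: ts_def)
    have "0 < n" using n by simp
    then have t0: "\<tau> 0 \<noteq> j" by (auto simp: \<tau>_def transpose_def)
    \<comment> \<open>Slot 0 is overwritten by its own entry to fit
      \<open>jacobian_coordinates\<close>, with g a coordinate.\<close>
    have "ts[0 := tvar (\<tau> 0)] = ts" using \<open>0 < n\<close> by (intro nth_equalityI) (auto simp: ts_def nth_list_update)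
    then have "jacobian_det (ts @ [\<Omega>]) = of_int (sign \<tau>) * (partial_deriv (\<tau> 0) (tvar (\<tau> 0)) * partial_deriv j \<Omega>)"
      using jacobian_coordinates[of j n 0 "tvar (\<tau> 0)" \<Omega>] j(1) \<open>0 < n\<close> t0
      by (simp add: ts_def \<tau>_def partial_deriv_tvar)
    then have "partial_deriv j \<Omega> \<in> F (sum_list (map (\<lambda>r. - a (\<tau> r)) [0..<n]) - int d0)"
      using J sgn by (simp add: partial_deriv_tvar)
    \<comment> \<open>In terms of degrees:
      \<open>\<Sum>a + d0 \<le> A * n + d0 \<le> A * (n + d0) - 1\<close>, the last because
      \<open>A \<ge> 2\<close>.\<close>
    moreover have "1 - A * int (n + d0) \<le> sum_list (map (\<lambda>r. - a (\<tau> r)) [0..<n]) - int d0"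
    proof -
      have "sum_list (map (\<lambda>r. - a (\<tau> r)) [0..<n]) = - (\<Sum>r<n. a (\<tau> r))"
        by (simp add: interv_sum_list_conv_sum_set_nat sum_negf lessThan_atLeast0)
      moreover have "(\<Sum>r<n. a (\<tau> r)) \<le> (\<Sum>r<n. A)" using aA \<tau>_lt by (intro sum_mono) auto
      moreover have "(\<Sum>r<n. A) = A * int n" by simp
      moreover have "A * int d0 \<ge> 2 * int d0" using A2 by (intro mult_right_mono) auto
      moreover have "A * int (n + d0) = A * int n + A * int d0" by (simp add: distrib_left)
      ultimately show ?thesis using d0 by linarith
    qed
    ultimately show False using anti j(2) by blast
  qed
  have tF: "tvar i \<in> F (- 1)" if "i < n + 1" for i using tA[OF that] A_eq by simp
  have jF: "partial_deriv j \<Omega> \<notin> F (- int (n + d0) + 1)" using j(2) A_eq by (simp add: algebra_simps)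
  have hom: "f \<in> F (- int m)" if "homogeneous m f" "f \<in> pvars V" for f m using homA[OF that] A_eq by simp
  \<comment> \<open>The bracket of g with coordinates is \<open>\<plusminus> (\<partial>g /
    \<partial>t\<^sub>i) \<Omega>\<^sub>j\<close>, one degree below the expected
    \<open>(m - 1) + (n + d0)\<close>. As \<open>\<Omega>\<^sub>j\<close> has its full degree,
    \<open>dom\<close> passes the drop on to the derivative, a nonzero form of degree
    \<open>m - 1\<close> again free of \<open>t\<^sub>j\<close>. The descent ends with 1 in
    \<open>F 1\<close>.\<close>
  have no_form: False if "homogeneous m g" "g \<noteq> 0" "g \<in> pvars (V - {j})" "g \<in> F (1 - int m)" for g m
    using that
  proof (induction m arbitrary: g rule: less_induct)
    case (less m)
    have gj: "g \<in> pvars (- {j})" using less.prems(3) by (rule pvars_mono[rotated]) auto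
    show False
    proof (cases "m = 0")
      case True
      then obtain c where c: "g = mconst c" using homogeneous_0_mconst less.prems(1) by blast
      then have "c \<noteq> 0" using less.prems(2) by auto
      then have "mconst (inverse c) * g = 1" by (simp add: c flip: mconst_mult)
      then show False using smult[OF less.prems(4), of "inverse c"] True one(2) by simp
    next
      case False
      then obtain i where i: "i \<in> V - {j}" "partial_deriv i g \<noteq> 0"
        using partial_deriv_nonzero[OF less.prems(3,1) _ less.prems(2)] by blast
      define r where "r = \<tau> i"
      have r: "r < n" "\<tau> r = i" using i(1) j(1) unfolding r_def \<tau>_def by (auto simp: transpose_def)
      have eq: "jacobian_det (ts[r := g] @ [\<Omega>]) = of_int (sign \<tau>) * (partial_deriv i g * partial_deriv j \<Omega>)"
        using jacobian_coordinates[of j n r g \<Omega>] j(1) r partial_deriv_pvars_0[OF gj] by (simp add: ts_def \<tau>_def)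
      have "list_all2 (\<lambda>f i. f \<in> F i) (ts[r := g]) ((map (\<lambda>_. - 1) [0..<n])[r := 1 - int m])"
        using tF \<tau>_lt r(1) less.prems(4) by (auto simp: ts_def list_all2_conv_all_nth nth_list_update)
      then have "jacobian_det (ts[r := g] @ [\<Omega>]) \<in> F (sum_list ((map (\<lambda>_. - 1) [0..<n])[r := 1 - int m]) - int d0)"
        by (intro bra) (simp add: ts_def)
      moreover have "sum_list ((map (\<lambda>_. - 1 :: int) [0..<n])[r := 1 - int m]) = - int n + 2 - int m"
        using r(1) by (simp add: upd_conv_take_nth_drop map_replicate_const sum_list_replicate of_nat_diff)
      ultimately have inF: "partial_deriv i g * partial_deriv j \<Omega> \<in> F (- int n + 2 - int m - int d0)"
        using sgn eq by simp
      have dh: "homogeneous (m - 1) (partial_deriv i g)" using homogeneous_partial_deriv less.prems(1) by blast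
      have dv: "partial_deriv i g \<in> pvars (V - {j})" using pvars_partial_deriv less.prems(3) by blast
      have "partial_deriv i g \<in> F (- int (m - 1))" by (rule hom[OF dh]) (use dv pvars_mono in blast)
      moreover have "partial_deriv j \<Omega> \<in> F (- int (n + d0))"
        by (rule hom[OF hom_deriv]) (use pvars_partial_deriv Om_vars in blast)
      ultimately have "partial_deriv i g \<in> F (- int (m - 1) + 1)"
        using dom[OF _ _ _ jF, of "partial_deriv i g" "- int (m - 1)"] inF False
        by (fastforce simp: of_nat_diff algebra_simps)
      then have "partial_deriv i g \<in> F (1 - int (m - 1))" by (simp add: add.commute)
      then show False using less.IH[of "m - 1", OF _ dh i(2) dv] False by simp
    qed
  qed
  have no_symbol: "\<Omega> dvd f" if f: "homogeneous m f" "f \<in> pvars V" "f \<in> F (1 - int m)" for f m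
  proof (rule ccontr)
    assume nd: "\<not> \<Omega> dvd f"
    \<comment> \<open>The polynomials all of whose components have dropped degree.
      \<open>Qmult\<close> makes this an ideal, so whatever is eliminated from \<Omega> and f stays
      inside.\<close>
    define Q where "Q = {f \<in> pvars V. \<forall>m. hcomp m f \<in> F (1 - int m)}"
    have Qmult: "g * f \<in> Q" if "f \<in> Q" "g \<in> pvars V" for f g
    proof -
      have "hcomp m (g * f) \<in> F (1 - int m)" for m unfolding hcomp_mult
      proof (rule sumF)
        fix i assume i: "i \<in> {..m}"
        have "hcomp i g * hcomp (m - i) f \<in> F (- int i + (1 - int (m - i)))"
          using that by (intro mult hom) (auto simp: Q_def pvars_hcomp)
        then show "hcomp i g * hcomp (m - i) f \<in> F (1 - int m)" using i by (simp add: of_nat_diff)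
      qed
      then show ?thesis using that unfolding Q_def by (auto intro: pvars_mult)
    qed
    have fQ: "f \<in> Q" using f by (auto simp: Q_def hcomp_homogeneous[OF f(1)] zero)
    \<comment> \<open>The degree of \<Omega> itself drops, since \<Omega> is congruent to a constant
      modulo \<open>I\<close>.\<close>
    have "(\<Omega> - mconst \<xi>) * 1 + mconst \<xi> * 1 \<in> F 0"
      using IF I_mem[of 1] by (intro add smult one) auto
    then have "\<Omega> \<in> F (1 - int dOm)" using anti[of "1 - int dOm" 0] by auto
    then have OQ: "\<Omega> \<in> Q" using Om_vars by (auto simp: Q_def hcomp_homogeneous[OF Om_hom] zero)
    have "partial_deriv j \<Omega> \<noteq> 0" using jF zero by metis
    then obtain c \<alpha> \<beta> where c: "c = \<alpha> * \<Omega> + \<beta> * f" "c \<noteq> 0" "c \<in> pvars (V - {j})" "\<alpha> \<in> pvars V" "\<beta> \<in> pvars V"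
      using elimination[OF _ _ Om_vars Om_irreducible degree_xpoly_pos f(2) nd, of j] j(1) by auto
    have "hcomp (tdeg c) c \<in> F (1 - int (tdeg c))"
      unfolding c(1) hcomp_add using Qmult[OF OQ c(4)] Qmult[OF fQ c(5)] by (auto simp: Q_def intro: add)
    then show False
      using no_form[of "tdeg c" "hcomp (tdeg c) c"] hcomp_tdeg_nonzero[OF c(2)] pvars_hcomp[OF c(3)] by simp
  qed
  have degF: "f \<in> F k" if "degle (- k) f" "f \<in> pvars V" for f k
  proof -
    have "hcomp d f \<in> F k" for d
    proof (cases "hcomp d f = 0")
      case False
      then have "k \<le> - int d" using that(1) unfolding degle_def by fastforce
      then show ?thesis using hom[of d "hcomp d f"] anti pvars_hcomp[OF that(2)] by auto
    qed (simp add: zero)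
    then have "(\<Sum>d\<le>tdeg f. hcomp d f) \<in> F k" by (intro sumF)
    then show ?thesis by (simp add: sum_hcomp)
  qed
  show "F i = std i"
  proof
    show "std i \<subseteq> F i"
    proof
      fix f assume "f \<in> std i"
      then obtain h where h: "f \<in> pvars V" "h \<in> I" "degle (- i) (f - h)" unfolding std_def by blast
      have "f - h \<in> F i" by (rule degF[OF h(3)]) (use h I_vars pvars_diff in blast)
      then show "f \<in> F i" using add[of "f - h" i h] h(2) IF by auto
    qed
    show "F i \<subseteq> std i"
    proof
      fix f assume f: "f \<in> F i"
      then have fV: "f \<in> pvars V" using sub by blast
      show "f \<in> std i"
      proof (cases "f \<in> I")
        case True
        then show ?thesis using fV unfolding std_def by (auto intro!: bexI[of _ f])
      next
        case False
        then obtain h where h: "h \<in> I" "f - h \<noteq> 0" "\<not> \<Omega> dvd hcomp (tdeg (f - h)) (f - h)"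
          using reduced_representative fV by blast
        define g where "g = f - h"
        define m where "m = tdeg g"
        have gV: "g \<in> pvars V" using fV I_vars[OF h(1)] pvars_diff g_def by metis
        \<comment> \<open>After reduction modulo \<open>I\<close> the leading form is no multiple of
          \<Omega> and keeps its degree, so g has index exactly \<open>- m\<close> for F. Membership
          in \<open>F i\<close> then bounds m.\<close>
        have top: "hcomp m g \<notin> F (1 - int m)"
          using no_symbol[of m "hcomp m g"] h(3) pvars_hcomp[OF gV] unfolding m_def g_def by auto
        have "degle (- (1 - int m)) (g - hcomp m g)"
          unfolding degle_def
        proof (intro allI impI)
          fix e assume e: "hcomp e (g - hcomp m g) \<noteq> 0"
          then have "e \<noteq> m" by (auto simp: hcomp_diff hcomp_homogeneous[OF homogeneous_hcomp])
          moreover from this e have "hcomp e g \<noteq> 0" by (simp add: hcomp_diff hcomp_homogeneous[OF homogeneous_hcomp])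
          then have "e \<le> m" using hcomp_above_tdeg[of g e] m_def by linarith
          ultimately show "int e \<le> - (1 - int m)" by simp
        qed
        then have "g - hcomp m g \<in> F (1 - int m)" using gV pvars_diff pvars_hcomp by (intro degF) blast+
        then have "g \<notin> F (1 - int m)" using diff[of g _ "g - hcomp m g"] top by fastforce
        moreover have "g \<in> F i" unfolding g_def using diff f h(1) IF by blast
        ultimately have "i \<le> - int m" using anti[of "1 - int m" i] by force
        then have "degle (- i) g" using degle_mono[OF degle_tdeg[of g], of "- i"] m_def by simp
        then show ?thesis using fV h(1) unfolding std_def g_def by blast
      qed
    qed
  qed
qed

section \<open>Homomorphic images\<close>

context ring
begin

lemma a_rcoset_eq_iff:
  assumes "additive_subgroup T R" "x \<in> carrier R" "y \<in> carrier R"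
  shows "T +> x = T +> y \<longleftrightarrow> x \<ominus> y \<in> T"
proof -
  interpret T: abelian_subgroup T R using assms(1) by (intro abelian_subgroupI3 is_abelian_group)
  have "T +> x = T +> y \<longleftrightarrow> x \<in> T +> y"
    using T.a_repr_independence'[OF _ assms(3)] T.a_rcos_self[OF assms(2)] by auto
  also have "\<dots> \<longleftrightarrow> x \<ominus> y \<in> T" by (rule T.a_rcos_module_minus[OF ring_axioms assms(3,2)])
  finally show ?thesis .
qed

lemma a_rcoset_mem:
  assumes "additive_subgroup T R" "x \<in> carrier R" "y \<in> T +> x"
  shows "y \<in> carrier R" "y \<ominus> x \<in> T"
proof -
  interpret T: abelian_subgroup T R using assms(1) by (intro abelian_subgroupI3 is_abelian_group)
  show "y \<in> carrier R" using T.a_elemrcos_carrier[OF assms(2,3)] .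
  then show "y \<ominus> x \<in> T" using T.a_rcos_module_minus[OF ring_axioms assms(2)] assms(3) by blast
qed

lemma a_rcoset_self:
  assumes "additive_subgroup T R" "x \<in> carrier R"
  shows "x \<in> T +> x"
proof -
  interpret T: abelian_subgroup T R using assms(1) by (intro abelian_subgroupI3 is_abelian_group)
  show ?thesis by (rule T.a_rcos_self[OF assms(2)])
qed

lemma a_rcoset_eq_self_iff:
  assumes "additive_subgroup T R" "x \<in> carrier R"
  shows "T +> x = T \<longleftrightarrow> x \<in> T"
proof -
  have T: "T +> \<zero> = T" using a_coset_add_zero additive_subgroup.a_subset[OF assms(1)] by blast
  show ?thesis using a_rcoset_eq_iff[OF assms(1,2), of \<zero>] assms(2) unfolding T by (simp add: a_minus_def)
qed

text \<open>Induced operations are unions over representatives; they collapse to one coset as soon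
  as all results agree modulo T.\<close>

lemma rcoset_union_const:
  assumes T: "additive_subgroup T R" and x: "x \<in> carrier R" and "S \<noteq> {}"
    and S: "\<And>s. s \<in> S \<Longrightarrow> f s \<in> carrier R \<and> f s \<ominus> x \<in> T"
  shows "(\<Union>s\<in>S. T +> f s) = T +> x"
proof -
  have "T +> f s = T +> x" if "s \<in> S" for s using a_rcoset_eq_iff[OF T _ x] S[OF that] by blast
  then show ?thesis using \<open>S \<noteq> {}\<close> by auto
qed

lemma a_rcoset_add:
  assumes "additive_subgroup T R" "x \<in> carrier R" "y \<in> carrier R"
  shows "(T +> x) <+> (T +> y) = T +> (x \<oplus> y)"
  using abelian_subgroup.a_rcos_sum[OF abelian_subgroupI3[OF assms(1) is_abelian_group] assms(2,3)] .

text \<open>T is merely a subgroup, so \<open>R Quot T\<close> need not be a ring; its addition is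
  that of the factor group \<open>R A_Mod T\<close>.\<close>

lemma finsum_FactRing:
  assumes T: "additive_subgroup T R" and S: "finite S" "f \<in> S \<rightarrow> carrier R"
    and "\<And>i. i \<in> S \<Longrightarrow> g i = T +> f i"
  shows "finsum (R Quot T) g S = T +> finsum R f S"
proof -
  interpret T: abelian_subgroup T R using T by (intro abelian_subgroupI3 is_abelian_group)
  have "add_monoid (R Quot T) = R A_Mod T"
    by (simp add: FactRing_def A_FactGroup_def FactGroup_def A_RCOSETS_def set_add_def)
  then interpret Q: abelian_monoid "R Quot T"
    using T.a_factorgroup_is_comm_group by (intro abelian_monoid.intro) (simp add: comm_group_def)
  have c: "T +> x \<in> carrier (R Quot T)" if "x \<in> carrier R" for x
    using that T.a_subset by (auto simp: FactRing_def intro: a_rcosetsI)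
  show ?thesis using S assms(4)
  proof (induction S rule: finite_induct)
    case empty
    show ?case unfolding Q.finsum_empty finsum_empty using T.a_subset by (simp add: FactRing_def)
  next
    case (insert i S)
    then have "finsum (R Quot T) g (insert i S) = (T +> f i) <+> (T +> finsum R f S)"
      using c by (subst Q.finsum_insert) (auto simp: FactRing_def Pi_iff)
    also have "\<dots> = T +> (f i \<oplus> finsum R f S)" using insert.prems by (intro a_rcoset_add T) auto
    finally show ?case using insert by (subst finsum_insert) auto
  qed
qed

end

text \<open>Every law in B is an equation between images and is pulled back to A by choosing
  preimages. Nothing is presupposed of B, so the same argument covers quotients and gr.\<close>

lemma algebra_hom_image:
  fixes K :: "'k ring" and A :: "('k, 'a, 'm) module_scheme" and B :: "('k, 'b, 'l) module_scheme"
  assumes A: "Module.algebra K A"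
    and surj: "\<phi> ` carrier A = carrier B"
    and add: "\<And>a b. a \<in> carrier A \<Longrightarrow> b \<in> carrier A \<Longrightarrow> \<phi> (a \<oplus>\<^bsub>A\<^esub> b) = \<phi> a \<oplus>\<^bsub>B\<^esub> \<phi> b"
    and mult: "\<And>a b. a \<in> carrier A \<Longrightarrow> b \<in> carrier A \<Longrightarrow> \<phi> (a \<otimes>\<^bsub>A\<^esub> b) = \<phi> a \<otimes>\<^bsub>B\<^esub> \<phi> b"
    and one: "\<phi> \<one>\<^bsub>A\<^esub> = \<one>\<^bsub>B\<^esub>" and zero: "\<phi> \<zero>\<^bsub>A\<^esub> = \<zero>\<^bsub>B\<^esub>"
    and smult: "\<And>c a. c \<in> carrier K \<Longrightarrow> a \<in> carrier A \<Longrightarrow> \<phi> (c \<odot>\<^bsub>A\<^esub> a) = c \<odot>\<^bsub>B\<^esub> \<phi> a"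
  shows "Module.algebra K B"
proof -
  interpret Module.algebra K A by (rule A)
  have \<phi>B: "\<phi> a \<in> carrier B" if "a \<in> carrier A" for a using that surj by blast
  define \<sigma> where "\<sigma> = inv_into (carrier A) \<phi>"
  have \<sigma>: "\<sigma> x \<in> carrier A" "\<phi> (\<sigma> x) = x" if "x \<in> carrier B" for x
    using that surj by (auto simp: \<sigma>_def inv_into_into f_inv_into_f)
  have lift: "\<exists>a\<in>carrier A. x = \<phi> a" if "x \<in> carrier B" for x using \<sigma>[OF that] by metis
  have ag: "abelian_group B"
  proof (rule abelian_groupI)
    fix x y z assume "x \<in> carrier B" "y \<in> carrier B" "z \<in> carrier B"
    then obtain a b c where "a \<in> carrier A" "b \<in> carrier A" "c \<in> carrier A" "x = \<phi> a" "y = \<phi> b" "z = \<phi> c"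
      using lift by metis
    then show "x \<oplus>\<^bsub>B\<^esub> y \<oplus>\<^bsub>B\<^esub> z = x \<oplus>\<^bsub>B\<^esub> (y \<oplus>\<^bsub>B\<^esub> z)" by (simp add: a_assoc flip: add)
  next
    fix x y assume "x \<in> carrier B" "y \<in> carrier B"
    then obtain a b where "a \<in> carrier A" "b \<in> carrier A" "x = \<phi> a" "y = \<phi> b" using lift by metis
    then show "x \<oplus>\<^bsub>B\<^esub> y = y \<oplus>\<^bsub>B\<^esub> x" "x \<oplus>\<^bsub>B\<^esub> y \<in> carrier B"
      using \<phi>B by (simp_all add: a_comm flip: add)
  next
    fix x assume "x \<in> carrier B"
    then obtain a where a: "a \<in> carrier A" "x = \<phi> a" using lift by metis
    show "\<zero>\<^bsub>B\<^esub> \<oplus>\<^bsub>B\<^esub> x = x" using a by (simp flip: add zero)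
    show "\<exists>y\<in>carrier B. y \<oplus>\<^bsub>B\<^esub> x = \<zero>\<^bsub>B\<^esub>"
      using a \<phi>B by (intro bexI[of _ "\<phi> (\<ominus>\<^bsub>A\<^esub> a)"]) (simp_all add: l_neg zero flip: add)
  qed (use \<phi>B[of "\<zero>\<^bsub>A\<^esub>"] zero in simp)
  have cm: "comm_monoid B"
  proof (rule comm_monoidI)
    fix x y z assume "x \<in> carrier B" "y \<in> carrier B" "z \<in> carrier B"
    then obtain a b c where "a \<in> carrier A" "b \<in> carrier A" "c \<in> carrier A" "x = \<phi> a" "y = \<phi> b" "z = \<phi> c"
      using lift by metis
    then show "x \<otimes>\<^bsub>B\<^esub> y \<otimes>\<^bsub>B\<^esub> z = x \<otimes>\<^bsub>B\<^esub> (y \<otimes>\<^bsub>B\<^esub> z)" by (simp add: m_assoc flip: mult)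
  next
    fix x y assume "x \<in> carrier B" "y \<in> carrier B"
    then obtain a b where "a \<in> carrier A" "b \<in> carrier A" "x = \<phi> a" "y = \<phi> b" using lift by metis
    then show "x \<otimes>\<^bsub>B\<^esub> y = y \<otimes>\<^bsub>B\<^esub> x" "x \<otimes>\<^bsub>B\<^esub> y \<in> carrier B"
      using \<phi>B by (simp_all add: m_comm flip: mult)
  next
    fix x assume "x \<in> carrier B"
    then obtain a where a: "a \<in> carrier A" "x = \<phi> a" using lift by metis
    show "\<one>\<^bsub>B\<^esub> \<otimes>\<^bsub>B\<^esub> x = x" using a by (simp flip: mult one)
  qed (use \<phi>B[of "\<one>\<^bsub>A\<^esub>"] one in simp)
  have cr: "cring B"
  proof (rule cringI[OF ag cm])
    fix x y z assume "x \<in> carrier B" "y \<in> carrier B" "z \<in> carrier B"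
    then obtain a b c where "a \<in> carrier A" "b \<in> carrier A" "c \<in> carrier A" "x = \<phi> a" "y = \<phi> b" "z = \<phi> c"
      using lift by metis
    then show "(x \<oplus>\<^bsub>B\<^esub> y) \<otimes>\<^bsub>B\<^esub> z = x \<otimes>\<^bsub>B\<^esub> z \<oplus>\<^bsub>B\<^esub> y \<otimes>\<^bsub>B\<^esub> z"
      by (simp add: l_distr flip: mult add)
  qed
  show "Module.algebra K B"
  proof (rule algebraI[OF R.is_cring cr])
    fix c c' x y assume c: "c \<in> carrier K" "c' \<in> carrier K" and x: "x \<in> carrier B" and y: "y \<in> carrier B"
    obtain a where a: "a \<in> carrier A" "x = \<phi> a" using lift[OF x] by blast
    obtain b where b: "b \<in> carrier A" "y = \<phi> b" using lift[OF y] by blast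
    show "c \<odot>\<^bsub>B\<^esub> x \<in> carrier B" using a c \<phi>B by (simp flip: smult)
    show "(c \<oplus>\<^bsub>K\<^esub> c') \<odot>\<^bsub>B\<^esub> x = c \<odot>\<^bsub>B\<^esub> x \<oplus>\<^bsub>B\<^esub> c' \<odot>\<^bsub>B\<^esub> x"
      using a c by (simp add: smult_l_distr flip: smult add)
    show "c \<odot>\<^bsub>B\<^esub> (x \<oplus>\<^bsub>B\<^esub> y) = c \<odot>\<^bsub>B\<^esub> x \<oplus>\<^bsub>B\<^esub> c \<odot>\<^bsub>B\<^esub> y"
      using a b c by (simp add: smult_r_distr flip: smult add)
    show "(c \<otimes>\<^bsub>K\<^esub> c') \<odot>\<^bsub>B\<^esub> x = c \<odot>\<^bsub>B\<^esub> (c' \<odot>\<^bsub>B\<^esub> x)" using a c by (simp add: smult_assoc1 flip: smult)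
    show "(c \<odot>\<^bsub>B\<^esub> x) \<otimes>\<^bsub>B\<^esub> y = c \<odot>\<^bsub>B\<^esub> (x \<otimes>\<^bsub>B\<^esub> y)" using a b c by (simp add: smult_assoc2 flip: smult mult)
  next
    fix x assume "x \<in> carrier B"
    then obtain a where a: "a \<in> carrier A" "x = \<phi> a" using lift by metis
    then show "\<one>\<^bsub>K\<^esub> \<odot>\<^bsub>B\<^esub> x = x" by (simp flip: smult)
  qed
qed

lemma hom_finsum:
  assumes A: "abelian_monoid A" and B: "abelian_monoid B"
    and surj: "\<phi> ` carrier A \<subseteq> carrier B"
    and add: "\<And>a b. a \<in> carrier A \<Longrightarrow> b \<in> carrier A \<Longrightarrow> \<phi> (a \<oplus>\<^bsub>A\<^esub> b) = \<phi> a \<oplus>\<^bsub>B\<^esub> \<phi> b"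
    and zero: "\<phi> \<zero>\<^bsub>A\<^esub> = \<zero>\<^bsub>B\<^esub>"
    and S: "finite S" "f \<in> S \<rightarrow> carrier A"
  shows "\<phi> (finsum A f S) = finsum B (\<lambda>i. \<phi> (f i)) S"
proof -
  interpret A: abelian_monoid A by (rule A)
  interpret B: abelian_monoid B by (rule B)
  have \<phi>B: "\<phi> a \<in> carrier B" if "a \<in> carrier A" for a using that surj by blast
  show ?thesis using S
  proof (induction S rule: finite_induct)
    case (insert i S)
    have f: "f i \<in> carrier A" "f \<in> S \<rightarrow> carrier A" using insert.prems by auto
    have "\<phi> (finsum A f (insert i S)) = \<phi> (f i \<oplus>\<^bsub>A\<^esub> finsum A f S)"
      using A.finsum_insert[OF insert.hyps f(2,1)] by (rule arg_cong)
    also have "\<dots> = \<phi> (f i) \<oplus>\<^bsub>B\<^esub> finsum B (\<lambda>i. \<phi> (f i)) S"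
      using add[OF f(1) A.finsum_closed[OF f(2)]] insert.IH[OF f(2)] by simp
    also have "\<dots> = finsum B (\<lambda>i. \<phi> (f i)) (insert i S)"
      by (rule B.finsum_insert[symmetric, OF insert.hyps]) (use f \<phi>B in blast)+
    finally show ?case .
  qed (simp add: zero)
qed

section \<open>Brackets of cosets and images of Nambu-Poisson algebras\<close>

context nambu_poisson_algebra
begin

sublocale algebra K A by (rule algebra)

lemma bracket_diff:
  assumes "length us = n" "set us \<subseteq> carrier A" "i < n" "a \<in> carrier A" "b \<in> carrier A"
  shows "nbracket A (us[i := a]) \<ominus> nbracket A (us[i := b]) = nbracket A (us[i := a \<ominus> b])"
proof -
  have cl: "nbracket A (us[i := x]) \<in> carrier A" if "x \<in> carrier A" for x
    using assms(1,2) that set_update_subsetI[of us "carrier A" x i] by (intro bracket_closed) auto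
  have "nbracket A (us[i := (a \<ominus> b) \<oplus> b]) = nbracket A (us[i := a \<ominus> b]) \<oplus> nbracket A (us[i := b])"
    using assms by (intro bracket_add) auto
  moreover have "(a \<ominus> b) \<oplus> b = a" using assms(4,5) by (simp add: a_minus_def a_assoc l_neg)
  ultimately show ?thesis using cl assms(4,5) by (simp add: a_minus_def a_assoc r_neg)
qed

text \<open>The arguments are exchanged one slot at a time through the hybrids \<open>H k\<close>.
  Slot s ranges over \<open>U s\<close> and is perturbed by \<open>D s\<close>, and a bracket with
  one argument in \<open>D s\<close> falls into T.\<close>

lemma bracket_cong_mod:
  assumes T: "additive_subgroup T A"
    and fs: "length fs = n" "\<And>s. s < n \<Longrightarrow> fs ! s \<in> U s" and gs: "length gs = n" "\<And>s. s < n \<Longrightarrow> gs ! s \<in> U s"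
    and D: "\<And>s. s < n \<Longrightarrow> fs ! s \<ominus> gs ! s \<in> D s" and DU: "\<And>s. D s \<subseteq> U s" and U: "\<And>s. U s \<subseteq> carrier A"
    and br: "\<And>hs s. length hs = n \<Longrightarrow> (\<And>r. r < n \<Longrightarrow> hs ! r \<in> U r) \<Longrightarrow> s < n \<Longrightarrow> hs ! s \<in> D s \<Longrightarrow>
      nbracket A hs \<in> T"
  shows "nbracket A fs \<ominus> nbracket A gs \<in> T"
proof -
  interpret T: additive_subgroup T A by (rule T)
  define H where "H k = take k gs @ drop k fs" for k
  have lenH: "length (H k) = n" if "k \<le> n" for k using that fs(1) gs(1) by (simp add: H_def)
  have HU: "H k ! s \<in> U s" if "k \<le> n" "s < n" for k s
    using that fs gs by (auto simp: H_def nth_append)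
  have carr: "set hs \<subseteq> carrier A" if "length hs = n" "\<And>s. s < n \<Longrightarrow> hs ! s \<in> U s" for hs
    using that U by (fastforce simp: in_set_conv_nth)
  have bH: "nbracket A (H k) \<in> carrier A" if "k \<le> n" for k
    using lenH[OF that] HU[OF that] by (intro bracket_closed carr)
  have "nbracket A fs \<ominus> nbracket A (H k) \<in> T" if "k \<le> n" for k
    using that
  proof (induction k)
    case 0
    then show ?case using bH[of 0] by (simp add: H_def r_neg a_minus_def)
  next
    case (Suc k)
    then have k: "k < n" by simp
    have H1: "H k = (H k)[k := fs ! k]" using k fs(1) gs(1)
      by (intro nth_equalityI) (auto simp: H_def nth_append nth_list_update)
    have H2: "H (Suc k) = (H k)[k := gs ! k]" using k fs(1) gs(1)
      by (intro nth_equalityI) (auto simp: H_def nth_append nth_list_update min_def)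
    have "nbracket A (H k) \<ominus> nbracket A (H (Suc k)) = nbracket A ((H k)[k := fs ! k \<ominus> gs ! k])"
      unfolding H2 using bracket_diff[of "H k" k "fs ! k" "gs ! k"] H1 lenH[of k] HU[of k] carr[of "H k"] k
        fs(2)[OF k] gs(2)[OF k] U by auto
    also have "\<dots> \<in> T"
      using k lenH[of k] HU[of k] D[OF k] DU by (intro br[of _ k]) (auto simp: nth_list_update)
    finally have "(nbracket A fs \<ominus> nbracket A (H k)) \<oplus> (nbracket A (H k) \<ominus> nbracket A (H (Suc k))) \<in> T"
      using Suc by (intro T.a_closed) auto
    moreover have "(nbracket A fs \<ominus> nbracket A (H k)) \<oplus> (nbracket A (H k) \<ominus> nbracket A (H (Suc k))) =
        nbracket A fs \<ominus> nbracket A (H (Suc k))"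
      using bH[of k] bH[of "Suc k"] bH[of 0] k by (simp add: H_def a_minus_def a_assoc l_neg r_neg1)
    ultimately show ?case by simp
  qed
  from this[of n] show ?thesis using fs(1) gs(1) by (simp add: H_def)
qed

text \<open>For a quotient, U is the whole algebra and D and T are the ideal; for gr,
  \<open>U s\<close> and \<open>D s\<close> are consecutive members of the filtration.\<close>

lemma rcoset_bracket_eq:
  assumes T: "additive_subgroup T A"
    and fs: "length fs = n" "\<And>s. s < n \<Longrightarrow> fs ! s \<in> U s"
    and Xs: "length Xs = n" "\<And>s. s < n \<Longrightarrow> Xs ! s = D s +> fs ! s"
    and D: "\<And>s. additive_subgroup (D s) A" and DU: "\<And>s. D s \<subseteq> U s" and U: "\<And>s. additive_subgroup (U s) A"
    and br: "\<And>hs s. length hs = n \<Longrightarrow> (\<And>r. r < n \<Longrightarrow> hs ! r \<in> U r) \<Longrightarrow> s < n \<Longrightarrow> hs ! s \<in> D s \<Longrightarrow>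
      nbracket A hs \<in> T"
  shows "rcoset_bracket A T Xs = T +> nbracket A fs"
  unfolding rcoset_bracket_def
proof (rule rcoset_union_const[OF T])
  have Uc: "U s \<subseteq> carrier A" for s using additive_subgroup.a_subset[OF U] .
  have carr: "set hs \<subseteq> carrier A" if "length hs = n" "\<And>s. s < n \<Longrightarrow> hs ! s \<in> U s" for hs
    using that Uc by (fastforce simp: in_set_conv_nth)
  show "nbracket A fs \<in> carrier A" by (intro bracket_closed carr fs)
  have fsc: "fs ! s \<in> carrier A" if "s < n" for s using fs(2)[OF that] Uc by blast
  have "list_all2 (\<in>) fs Xs" using fs(1) Xs a_rcoset_self[OF D fsc] by (simp add: list_all2_conv_all_nth)
  then show "{fs. list_all2 (\<in>) fs Xs} \<noteq> {}" by blast
  fix gs assume "gs \<in> {fs. list_all2 (\<in>) fs Xs}"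
  then have len: "length gs = n" and mem: "\<And>s. s < n \<Longrightarrow> gs ! s \<in> D s +> fs ! s"
    using Xs by (auto simp: list_all2_conv_all_nth)
  have gD: "gs ! s \<ominus> fs ! s \<in> D s" and gc: "gs ! s \<in> carrier A" if "s < n" for s
    using a_rcoset_mem[OF D fsc[OF that] mem[OF that]] by blast+
  have gU: "gs ! s \<in> U s" if "s < n" for s
  proof -
    have "(gs ! s \<ominus> fs ! s) \<oplus> fs ! s \<in> U s"
      using gD[OF that] DU by (intro additive_subgroup.a_closed[OF U] fs(2)[OF that]) blast
    moreover have "(gs ! s \<ominus> fs ! s) \<oplus> fs ! s = gs ! s"
      using gc[OF that] fsc[OF that] by (simp add: a_minus_def a_assoc l_neg)
    ultimately show ?thesis by simp
  qed
  show "nbracket A gs \<in> carrier A \<and> nbracket A gs \<ominus> nbracket A fs \<in> T"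
    by (intro conjI bracket_closed[OF len carr[OF len gU]]
      bracket_cong_mod[OF T len gU fs gD DU Uc br])
qed

text \<open>As for algebras, the axioms are lifted along a section \<sigma> of
  \<open>\<phi>\<close>; \<open>0 < n\<close> makes \<open>a # vs\<close> a list of n arguments in
  the fundamental identity.\<close>

lemma hom_image:
  fixes B :: "('k, 'b) np_algebra"
  assumes "0 < n" and surj: "\<phi> ` carrier A = carrier B"
    and add: "\<And>a b. a \<in> carrier A \<Longrightarrow> b \<in> carrier A \<Longrightarrow> \<phi> (a \<oplus>\<^bsub>A\<^esub> b) = \<phi> a \<oplus>\<^bsub>B\<^esub> \<phi> b"
    and mult: "\<And>a b. a \<in> carrier A \<Longrightarrow> b \<in> carrier A \<Longrightarrow> \<phi> (a \<otimes>\<^bsub>A\<^esub> b) = \<phi> a \<otimes>\<^bsub>B\<^esub> \<phi> b"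
    and one: "\<phi> \<one>\<^bsub>A\<^esub> = \<one>\<^bsub>B\<^esub>" and zero: "\<phi> \<zero>\<^bsub>A\<^esub> = \<zero>\<^bsub>B\<^esub>"
    and smult: "\<And>c a. c \<in> carrier K \<Longrightarrow> a \<in> carrier A \<Longrightarrow> \<phi> (c \<odot>\<^bsub>A\<^esub> a) = c \<odot>\<^bsub>B\<^esub> \<phi> a"
    and bracket: "\<And>us. length us = n \<Longrightarrow> set us \<subseteq> carrier A \<Longrightarrow> \<phi> (nbracket A us) = nbracket B (map \<phi> us)"
  shows "nambu_poisson_algebra K n B"
proof -
  have \<phi>B: "\<phi> a \<in> carrier B" if "a \<in> carrier A" for a using that surj by blast
  define \<sigma> where "\<sigma> = inv_into (carrier A) \<phi>"
  have \<sigma>: "\<sigma> x \<in> carrier A" "\<phi> (\<sigma> x) = x" if "x \<in> carrier B" for x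
    using that surj by (auto simp: \<sigma>_def inv_into_into f_inv_into_f)
  have lift: "\<exists>a\<in>carrier A. x = \<phi> a" if "x \<in> carrier B" for x using \<sigma>[OF that] by metis
  have lists: "set (map \<sigma> xs) \<subseteq> carrier A" "map \<phi> (map \<sigma> xs) = xs" if "set xs \<subseteq> carrier B" for xs
    using that \<sigma> by (auto simp: map_idI subset_iff)
  have alg: "Module.algebra K B"
    using algebra_hom_image[OF algebra surj add mult one zero smult] .
  interpret B: Module.algebra K B by (rule alg)
  note fs = hom_finsum[OF abelian_monoid_axioms B.M.abelian_monoid_axioms equalityD1[OF surj] add zero]
  have upd: "set (us[i := a]) \<subseteq> X" if "set us \<subseteq> X" "a \<in> X" for us i a and X :: "'c set"
    by (rule set_update_subsetI[OF that])
  show ?thesis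
  proof (rule nambu_poisson_algebra.intro)
    show "field K" by (rule base_field)
    show "Module.algebra K B" by (rule alg)
    fix us assume us: "length us = n" "set us \<subseteq> carrier B"
    define us' where "us' = map \<sigma> us"
    have us': "length us' = n" "set us' \<subseteq> carrier A" "us = map \<phi> us'"
      using us lists[OF us(2)] by (simp_all add: us'_def)
    show "nbracket B us \<in> carrier B"
      using \<phi>B[OF bracket_closed[OF us'(1,2)]] bracket[OF us'(1,2)] us'(3) by simp
    have br: "nbracket B (us[i := \<phi> a]) = \<phi> (nbracket A (us'[i := a]))" if "a \<in> carrier A" for i a
      using bracket[of "us'[i := a]"] us' upd[OF us'(2) that] by (simp add: map_update)
    have brc: "nbracket A (us'[i := a]) \<in> carrier A" if "a \<in> carrier A" for i a
      using us' upd[OF us'(2) that] by (intro bracket_closed) auto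
    show "nbracket B us = \<zero>\<^bsub>B\<^esub>" if "i < j" "j < n" "us ! i = us ! j" for i j
    proof -
      have "us' ! i = us' ! j" using that us(1) by (simp add: us'_def)
      then show ?thesis using bracket_alternating[OF us'(1,2) that(1,2)] bracket[OF us'(1,2)] us'(3) zero by simp
    qed
    show "nbracket B (nbracket B us # vs) = (\<Oplus>\<^bsub>B\<^esub>s\<in>{..<n}. nbracket B (us[s := nbracket B (us ! s # vs)]))"
      if vs: "length vs = n - 1" "set vs \<subseteq> carrier B" for vs
    proof -
      define vs' where "vs' = map \<sigma> vs"
      have vs': "length vs' = n - 1" "set vs' \<subseteq> carrier A" "vs = map \<phi> vs'"
        using vs lists[OF vs(2)] by (simp_all add: vs'_def)
      have cons: "nbracket B (\<phi> a # vs) = \<phi> (nbracket A (a # vs'))"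
        and consc: "nbracket A (a # vs') \<in> carrier A" if "a \<in> carrier A" for a
        using bracket[of "a # vs'"] bracket_closed[of "a # vs'"] vs' that \<open>0 < n\<close> by simp_all
      have nth: "us' ! s \<in> carrier A" "us ! s = \<phi> (us' ! s)" if "s < n" for s
        using us' that by (auto simp: subset_iff)
      have "nbracket B (nbracket B us # vs) = \<phi> (nbracket A (nbracket A us' # vs'))"
        using bracket[OF us'(1,2)] us'(3) cons[OF bracket_closed[OF us'(1,2)]] by simp
      also have "\<dots> = \<phi> (\<Oplus>\<^bsub>A\<^esub>s\<in>{..<n}. nbracket A (us'[s := nbracket A (us' ! s # vs')]))"
        using fundamental_identity[OF us'(1,2) vs'(1,2)] by simp
      also have "\<dots> = (\<Oplus>\<^bsub>B\<^esub>s\<in>{..<n}. \<phi> (nbracket A (us'[s := nbracket A (us' ! s # vs')])))"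
        using brc consc nth by (intro fs) auto
      also have "\<dots> = (\<Oplus>\<^bsub>B\<^esub>s\<in>{..<n}. nbracket B (us[s := nbracket B (us ! s # vs)]))"
        using br cons consc nth \<phi>B brc by (intro B.finsum_cong') auto
      finally show ?thesis .
    qed
    fix i assume i: "i < n"
    show "nbracket B (us[i := c \<odot>\<^bsub>B\<^esub> x]) = c \<odot>\<^bsub>B\<^esub> nbracket B (us[i := x])"
      if c: "c \<in> carrier K" and x: "x \<in> carrier B" for c x
    proof -
      obtain a where a: "a \<in> carrier A" "x = \<phi> a" using lift[OF x] by blast
      have "nbracket B (us[i := \<phi> (c \<odot>\<^bsub>A\<^esub> a)]) = \<phi> (c \<odot>\<^bsub>A\<^esub> nbracket A (us'[i := a]))"
        using bracket_smult[OF us'(1,2) i c a(1)] br a c by simp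
      then show ?thesis using a c by (simp add: smult br brc)
    qed
    fix x y assume x: "x \<in> carrier B" and y: "y \<in> carrier B"
    obtain a where a: "a \<in> carrier A" "x = \<phi> a" using lift[OF x] by blast
    obtain b where b: "b \<in> carrier A" "y = \<phi> b" using lift[OF y] by blast
    have "nbracket B (us[i := \<phi> (a \<oplus>\<^bsub>A\<^esub> b)]) = \<phi> (nbracket A (us'[i := a]) \<oplus>\<^bsub>A\<^esub> nbracket A (us'[i := b]))"
      using bracket_add[OF us'(1,2) i a(1) b(1)] br a b by simp
    then show "nbracket B (us[i := x \<oplus>\<^bsub>B\<^esub> y]) = nbracket B (us[i := x]) \<oplus>\<^bsub>B\<^esub> nbracket B (us[i := y])"
      using a b by (simp add: add br brc)
    have "nbracket B (us[i := \<phi> (a \<otimes>\<^bsub>A\<^esub> b)]) =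
        \<phi> (a \<otimes>\<^bsub>A\<^esub> nbracket A (us'[i := b]) \<oplus>\<^bsub>A\<^esub> nbracket A (us'[i := a]) \<otimes>\<^bsub>A\<^esub> b)"
      using leibniz[OF us'(1,2) i a(1) b(1)] br a b by simp
    then show "nbracket B (us[i := x \<otimes>\<^bsub>B\<^esub> y]) =
        x \<otimes>\<^bsub>B\<^esub> nbracket B (us[i := y]) \<oplus>\<^bsub>B\<^esub> nbracket B (us[i := x]) \<otimes>\<^bsub>B\<^esub> y"
      using a b by (simp add: add mult br brc)
  qed
qed

end

section \<open>Associated graded algebras and quotients\<close>

lemma sum_list_update_group: "k < length xs \<Longrightarrow> sum_list (xs[k := x]) = sum_list xs + x - xs ! k"
  for xs :: "'a::ab_group_add list"
proof (induction xs arbitrary: k)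
  case (Cons a xs)
  then show ?case by (cases k) (simp_all add: algebra_simps)
qed simp

section \<open>Homogeneous classes of a filtration\<close>

context w_filtration
begin

lemma F_additive_subgroup: "additive_subgroup (F i) A"
proof -
  interpret S: submodule K "F i" A using subspaces[of i] unfolding subspace_def by blast
  have "\<ominus> x \<in> F i" if x: "x \<in> F i" for x
  proof -
    have xc: "x \<in> carrier A" using S.subset x by blast
    have "(\<ominus>\<^bsub>K\<^esub> \<one>\<^bsub>K\<^esub>) \<odot> x = \<ominus> (\<one>\<^bsub>K\<^esub> \<odot> x)" using xc by (intro smult_l_minus) auto
    then show ?thesis using S.smult_closed[of "\<ominus>\<^bsub>K\<^esub> \<one>\<^bsub>K\<^esub>" x] x xc by simp
  qed
  then have "subgroup (F i) (add_monoid A)"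
    using S.subset by unfold_locales (auto simp: a_inv_def[symmetric])
  then show ?thesis by (rule additive_subgroupI)
qed

lemma F_carrier: "F i \<subseteq> carrier A"
  using additive_subgroup.a_subset[OF F_additive_subgroup] .

lemma F_smult: "c \<in> carrier K \<Longrightarrow> x \<in> F i \<Longrightarrow> c \<odot> x \<in> F i"
  using subspaces[of i] unfolding subspace_def submodule_def by blast

lemma F_antimono: "i \<le> j \<Longrightarrow> F j \<subseteq> F i"
proof (induction j rule: int_ge_induct)
  case (step j)
  then show ?case using decreasing[of j] by blast
qed simp

abbreviation cls :: "int \<Rightarrow> 'a \<Rightarrow> 'a set"
  where "cls i a \<equiv> F (i + 1) +> a"

lemma cls_eq_iff: "a \<in> carrier A \<Longrightarrow> b \<in> carrier A \<Longrightarrow> cls i a = cls i b \<longleftrightarrow> a \<ominus> b \<in> F (i + 1)"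
  by (rule a_rcoset_eq_iff[OF F_additive_subgroup])

lemma cls_eq_self_iff: "a \<in> carrier A \<Longrightarrow> cls i a = F (i + 1) \<longleftrightarrow> a \<in> F (i + 1)"
  by (rule a_rcoset_eq_self_iff[OF F_additive_subgroup])

lemma rcoset_mult_cls:
  assumes a: "a \<in> F i" and b: "b \<in> F j"
  shows "rcoset_mult A (F (i + j + 1)) (cls i a) (cls j b) = cls (i + j) (a \<otimes> b)"
proof -
  have ac: "a \<in> carrier A" "b \<in> carrier A" using a b F_carrier by blast+
  have "rcoset_mult A (F (i + j + 1)) (cls i a) (cls j b) =
      (\<Union>s\<in>cls i a \<times> cls j b. F (i + j + 1) +> (fst s \<otimes> snd s))"
    unfolding rcoset_mult_def by (auto, blast)
  also have "\<dots> = F (i + j + 1) +> (a \<otimes> b)"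
  proof (rule rcoset_union_const[OF F_additive_subgroup])
    show "a \<otimes> b \<in> carrier A" using ac by simp
    show "cls i a \<times> cls j b \<noteq> {}" using a_rcoset_self[OF F_additive_subgroup] ac by blast
    fix s assume "s \<in> cls i a \<times> cls j b"
    then obtain x y where s: "s = (x, y)" "x \<in> cls i a" "y \<in> cls j b" by blast
    have x: "x \<in> carrier A" "x \<ominus> a \<in> F (i + 1)" using a_rcoset_mem[OF F_additive_subgroup ac(1) s(2)] by blast+
    have y: "y \<in> carrier A" "y \<ominus> b \<in> F (j + 1)" using a_rcoset_mem[OF F_additive_subgroup ac(2) s(3)] by blast+
    have "(y \<ominus> b) \<oplus> b \<in> F j"
      using y(2) b decreasing[of j] by (intro additive_subgroup.a_closed[OF F_additive_subgroup]) auto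
    moreover have "(y \<ominus> b) \<oplus> b = y" using y(1) ac by (simp add: a_minus_def a_assoc l_neg)
    ultimately have yF: "y \<in> F j" by simp
    \<comment> \<open>The difference of the products splits as
      \<open>x y - a b = (x - a) y + a (y - b)\<close>, each term one step deeper.\<close>
    have "(x \<ominus> a) \<otimes> y \<in> F (i + 1 + j)" "a \<otimes> (y \<ominus> b) \<in> F (i + (j + 1))"
      using mult_mem x(2) yF a y(2) by blast+
    then have "(x \<ominus> a) \<otimes> y \<oplus> a \<otimes> (y \<ominus> b) \<in> F (i + j + 1)"
      by (intro additive_subgroup.a_closed[OF F_additive_subgroup]) (simp_all add: ac_simps)
    moreover have "(x \<ominus> a) \<otimes> y \<oplus> a \<otimes> (y \<ominus> b) = x \<otimes> y \<ominus> a \<otimes> b"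
      using x(1) y(1) ac by algebra
    ultimately show "fst s \<otimes> snd s \<in> carrier A \<and> fst s \<otimes> snd s \<ominus> a \<otimes> b \<in> F (i + j + 1)"
      using x(1) y(1) s(1) by simp
  qed
  finally show ?thesis .
qed

lemma rcoset_smult_cls:
  assumes a: "a \<in> carrier A" and c: "c \<in> carrier K"
  shows "rcoset_smult A (F (i + 1)) c (cls i a) = cls i (c \<odot> a)"
  unfolding rcoset_smult_def
proof (rule rcoset_union_const[OF F_additive_subgroup])
  show "cls i a \<noteq> {}" using a_rcoset_self[OF F_additive_subgroup a] by blast
  fix x assume "x \<in> cls i a"
  then have x: "x \<in> carrier A" "x \<ominus> a \<in> F (i + 1)" using a_rcoset_mem[OF F_additive_subgroup a] by blast+
  have "c \<odot> (x \<ominus> a) = c \<odot> x \<ominus> c \<odot> a"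
    using x(1) a c by (simp add: a_minus_def smult_r_distr smult_r_minus)
  then show "c \<odot> x \<in> carrier A \<and> c \<odot> x \<ominus> c \<odot> a \<in> F (i + 1)" using F_smult[OF c x(2)] x(1) c by simp
qed (use a c in simp)

lemma rcoset_bracket_cls:
  assumes fs: "length is = n" "list_all2 (\<lambda>f i. f \<in> F i) fs is"
  shows "rcoset_bracket A (F (sum_list is - w + 1)) (map2 (\<lambda>f i. cls i f) fs is) = cls (sum_list is - w) (nbracket A fs)"
proof (rule rcoset_bracket_eq[OF F_additive_subgroup, where U="\<lambda>s. F (is ! s)" and D="\<lambda>s. F (is ! s + 1)"])
  show "length fs = n" using fs by (simp add: list_all2_lengthD)
  then show "fs ! s \<in> F (is ! s)" if "s < n" for s using fs that by (simp add: list_all2_conv_all_nth)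
  show "length (map2 (\<lambda>f i. cls i f) fs is) = n" using fs \<open>length fs = n\<close> by simp
  show "map2 (\<lambda>f i. cls i f) fs is ! s = cls (is ! s) (fs ! s)" if "s < n" for s
    using fs \<open>length fs = n\<close> that by simp
  show "F (is ! s + 1) \<subseteq> F (is ! s)" for s by (rule decreasing)
  fix hs s assume hs: "length hs = n" "\<And>r. r < n \<Longrightarrow> hs ! r \<in> F (is ! r)" "s < n" "hs ! s \<in> F (is ! s + 1)"
  \<comment> \<open>An argument in the next member of the filtration raises the total index by
    1.\<close>
  have "list_all2 (\<lambda>f i. f \<in> F i) hs (is[s := is ! s + 1])"
    using hs fs(1) by (auto simp: list_all2_conv_all_nth nth_list_update)
  then have "nbracket A hs \<in> F (sum_list (is[s := is ! s + 1]) - w)"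
    using fs(1) by (intro bracket_mem) simp
  moreover have "sum_list (is[s := is ! s + 1]) - w = sum_list is - w + 1"
    using hs(3) fs(1) by (simp add: sum_list_update_group)
  ultimately show "nbracket A hs \<in> F (sum_list is - w + 1)" by simp
qed (rule F_additive_subgroup)+

lemma finsum_cls:
  "finite S \<Longrightarrow> f \<in> S \<rightarrow> carrier A \<Longrightarrow> (\<And>s. s \<in> S \<Longrightarrow> g s = cls i (f s)) \<Longrightarrow>
    finsum (A Quot F (i + 1)) g S = cls i (finsum A f S)"
  by (rule finsum_FactRing[OF F_additive_subgroup])

definition gr_single :: "int \<Rightarrow> 'a \<Rightarrow> int \<Rightarrow> 'a set"
  where "gr_single i a = (\<lambda>k. if k = i then cls i a else F (k + 1))"

lemma gr_single_support: "gr_support F (gr_single i a) \<subseteq> {i}"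
  by (auto simp: gr_support_def gr_single_def)

lemma cls_zero: "cls i \<zero> = F (i + 1)"
  using F_carrier by simp

lemma gr_single_component:
  assumes "a \<in> F i"
  shows "gr_single i a \<in> gr_component n w A F i"
proof -
  have "F (k + 1) \<in> (\<lambda>f. cls k f) ` F k" for k
    using cls_zero additive_subgroup.zero_closed[OF F_additive_subgroup] by (metis image_eqI)
  then show ?thesis using assms finite_subset[OF gr_single_support] gr_single_support
    by (auto simp: gr_component_def gr_def gr_single_def)
qed

lemma gr_zero_sel: "\<zero>\<^bsub>gr n w A F\<^esub> = (\<lambda>i. F (i + 1))"
  by (simp add: gr_def)

lemma gr_single_eq_zero_iff:
  "a \<in> F i \<Longrightarrow> gr_single i a = \<zero>\<^bsub>gr n w A F\<^esub> \<longleftrightarrow> a \<in> F (i + 1)"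
  using cls_eq_self_iff[of a i] F_carrier unfolding gr_zero_sel gr_single_def fun_eq_iff
  by (metis subsetD)

text \<open>Turns integrality of gr into additivity of degrees: the product of two homogeneous
  elements has the class of \<open>a \<otimes> b\<close> as its only possible component, and this
  class must not be zero.\<close>

lemma gr_domain_mult:
  assumes dom: "domain (gr n w A F)"
    and a: "a \<in> F i" "a \<notin> F (i + 1)" and b: "b \<in> F j" "b \<notin> F (j + 1)"
  shows "a \<otimes> b \<notin> F (i + j + 1)"
proof
  assume ab: "a \<otimes> b \<in> F (i + j + 1)"
  interpret G: domain "gr n w A F" by (rule dom)
  have ac: "a \<in> carrier A" "b \<in> carrier A" using a b F_carrier by blast+
  have supp: "gr_support F (gr_single i a) = {i}"
    using cls_eq_self_iff[OF ac(1), of i] a(2) by (auto simp: gr_support_def gr_single_def)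
  have "(gr_single i a \<otimes>\<^bsub>gr n w A F\<^esub> gr_single j b) k = F (k + 1)" for k
  proof -
    \<comment> \<open>A representative of the component of \<open>gr_single j b\<close> in degree
      \<open>k - i\<close>, which is 0 except for \<open>k = i + j\<close>.\<close>
    define b' where "b' = (if k - i = j then b else \<zero>)"
    have b': "b' \<in> F (k - i)" "gr_single j b (k - i) = cls (k - i) b'"
      using b(1) additive_subgroup.zero_closed[OF F_additive_subgroup] cls_zero
      by (auto simp: b'_def gr_single_def)
    have "rcoset_mult A (F (k + 1)) (cls i a) (cls (k - i) b') = cls k (a \<otimes> b')"
      using rcoset_mult_cls[OF a(1) b'(1)] by simp
    moreover have "a \<otimes> b' \<in> F (k + 1)"
      using ab ac additive_subgroup.zero_closed[OF F_additive_subgroup] by (auto simp: b'_def)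
    moreover have "(gr_single i a \<otimes>\<^bsub>gr n w A F\<^esub> gr_single j b) k =
        finsum (A Quot F (k + 1)) (\<lambda>l. rcoset_mult A (F (k + 1)) (gr_single i a l) (gr_single j b (k - l))) {i}"
      by (simp add: gr_def supp)
    moreover have "\<dots> = cls k (finsum A (\<lambda>l. a \<otimes> b') {i})"
      using calculation(1) b'(2) ac b'(1) F_carrier[of "k - i"]
      by (intro finsum_cls) (auto simp: gr_single_def[of i])
    moreover have "finsum A (\<lambda>l. a \<otimes> b') {i} = a \<otimes> b'"
      using ac b'(1) F_carrier[of "k - i"] by (subst finsum_insert) auto
    moreover have "cls k (a \<otimes> b') = F (k + 1)"
      using calculation(2) F_carrier by (subst cls_eq_self_iff) auto
    ultimately show ?thesis by simp
  qed
  then have "gr_single i a \<otimes>\<^bsub>gr n w A F\<^esub> gr_single j b = \<zero>\<^bsub>gr n w A F\<^esub>"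
    by (auto simp: gr_zero_sel)
  then show False
    using G.integral gr_single_component[OF a(1)] gr_single_component[OF b(1)]
      gr_single_eq_zero_iff a b by (auto simp: gr_component_def)
qed

text \<open>The components of positive index vanish, so F is constant from index 1 on; a nonzero
  element there would have no exact index. With \<open>F 1\<close> zero, the component of degree 0
  is \<open>F 0\<close> itself.\<close>

lemma connected_filtration:
  assumes con: "connected_graded_algebra K (gr n w A F) (gr_component n w A F)"
  shows "F 1 = {\<zero>}" and "F 0 = {c \<odot> \<one> | c. c \<in> carrier K}"
proof -
  interpret G: connected_graded_algebra K "gr n w A F" "gr_component n w A F" by (rule con)
  have zF: "\<zero> \<in> F i" for i using additive_subgroup.zero_closed[OF F_additive_subgroup] .
  have step: "F i = F (i + 1)" if "i > 0" for i
  proof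
    show "F i \<subseteq> F (i + 1)"
    proof
      fix a assume a: "a \<in> F i"
      have "gr_single i a = \<zero>\<^bsub>gr n w A F\<^esub>" using gr_single_component[OF a] G.positive_trivial[OF that] by blast
      then show "a \<in> F (i + 1)" using gr_single_eq_zero_iff[OF a] by blast
    qed
  qed (rule decreasing)
  have F1: "F j = F 1" if "j \<ge> 1" for j
    using that
  proof (induction j rule: int_ge_induct)
    case (step j)
    then show ?case using \<open>\<And>i. i > 0 \<Longrightarrow> F i = F (i + 1)\<close>[of j] by simp
  qed simp
  show z: "F 1 = {\<zero>}"
  proof (rule ccontr)
    assume "F 1 \<noteq> {\<zero>}"
    then obtain a where a: "a \<in> F 1" "a \<noteq> \<zero>" using zF by blast
    then obtain i where i: "a \<in> F i" "a \<notin> F (i + 1)" using exhaustive_separated F_carrier by blast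
    show False
    proof (cases "i \<ge> 1")
      case True
      then show ?thesis using i F1[of i] F1[of "i + 1"] by simp
    next
      case False
      then show ?thesis using i(2) a(1) F_antimono[of "i + 1" 1] by auto
    qed
  qed
  have one: "\<one> \<in> F 0" using one_mem by blast
  show "F 0 = {c \<odot> \<one> | c. c \<in> carrier K}"
  proof
    show "{c \<odot> \<one> | c. c \<in> carrier K} \<subseteq> F 0" using F_smult one by blast
    show "F 0 \<subseteq> {c \<odot> \<one> | c. c \<in> carrier K}"
    proof
      fix a assume a: "a \<in> F 0"
      then obtain c where c: "c \<in> carrier K" "gr_single 0 a = c \<odot>\<^bsub>gr n w A F\<^esub> \<one>\<^bsub>gr n w A F\<^esub>"
        using gr_single_component[OF a] G.degree_zero(1) by blast
      have "cls 0 a = cls 0 (c \<odot> \<one>)"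
        using fun_cong[OF c(2), of 0] rcoset_smult_cls[OF _ c(1), of \<one> 0] by (simp add: gr_single_def gr_def)
      then have "a \<ominus> c \<odot> \<one> \<in> F 1" using cls_eq_iff[of a "c \<odot> \<one>" 0] a F_carrier c(1) by auto
      then have "a \<ominus> c \<odot> \<one> = \<zero>" using z by simp
      moreover have "(a \<ominus> c \<odot> \<one>) \<oplus> c \<odot> \<one> = a"
        using a F_carrier[of 0] c(1) by (auto simp: a_minus_def a_assoc l_neg)
      ultimately have "a = c \<odot> \<one>" using c(1) by simp
      then show "a \<in> {c \<odot> \<one> | c. c \<in> carrier K}" using c(1) by blast
    qed
  qed
qed

end

section \<open>Quotients by ideals\<close>

lemma algebra_quotient:
  fixes K :: "'k ring" and A :: "('k, 'a, 'm) module_scheme"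
  assumes A: "Module.algebra K A" and J: "ideal J A"
  defines "\<pi> \<equiv> a_r_coset A J"
  shows "\<pi> ` carrier A = carrier (quot_algebra A J)"
    and "\<And>a b. a \<in> carrier A \<Longrightarrow> b \<in> carrier A \<Longrightarrow> \<pi> (a \<oplus>\<^bsub>A\<^esub> b) = \<pi> a \<oplus>\<^bsub>quot_algebra A J\<^esub> \<pi> b"
    and "\<And>a b. a \<in> carrier A \<Longrightarrow> b \<in> carrier A \<Longrightarrow> \<pi> (a \<otimes>\<^bsub>A\<^esub> b) = \<pi> a \<otimes>\<^bsub>quot_algebra A J\<^esub> \<pi> b"
    and "\<pi> \<one>\<^bsub>A\<^esub> = \<one>\<^bsub>quot_algebra A J\<^esub>" and "\<pi> \<zero>\<^bsub>A\<^esub> = \<zero>\<^bsub>quot_algebra A J\<^esub>"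
    and "\<And>c a. c \<in> carrier K \<Longrightarrow> a \<in> carrier A \<Longrightarrow> \<pi> (c \<odot>\<^bsub>A\<^esub> a) = c \<odot>\<^bsub>quot_algebra A J\<^esub> \<pi> a"
    and "Module.algebra K (quot_algebra A J)"
proof -
  interpret A: Module.algebra K A by (rule A)
  interpret J: ideal J A by (rule J)
  have add: "additive_subgroup J A" by (rule J.is_additive_subgroup)
  note q = quot_algebra_def ring.extend_def module.fields_def FactRing_def
  show 1: "\<pi> ` carrier A = carrier (quot_algebra A J)"
    by (auto simp: q \<pi>_def A_RCOSETS_def')
  show 2: "\<pi> (a \<oplus>\<^bsub>A\<^esub> b) = \<pi> a \<oplus>\<^bsub>quot_algebra A J\<^esub> \<pi> b" if "a \<in> carrier A" "b \<in> carrier A" for a b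
    using A.a_rcoset_add[OF add that] by (simp add: q \<pi>_def)
  show 3: "\<pi> (a \<otimes>\<^bsub>A\<^esub> b) = \<pi> a \<otimes>\<^bsub>quot_algebra A J\<^esub> \<pi> b" if "a \<in> carrier A" "b \<in> carrier A" for a b
    using J.rcoset_mult_add[OF that] by (simp add: q \<pi>_def)
  show 4: "\<pi> \<one>\<^bsub>A\<^esub> = \<one>\<^bsub>quot_algebra A J\<^esub>" by (simp add: q \<pi>_def)
  show 5: "\<pi> \<zero>\<^bsub>A\<^esub> = \<zero>\<^bsub>quot_algebra A J\<^esub>" using J.a_subset by (simp add: q \<pi>_def)
  show 6: "\<pi> (c \<odot>\<^bsub>A\<^esub> a) = c \<odot>\<^bsub>quot_algebra A J\<^esub> \<pi> a" if c: "c \<in> carrier K" and a: "a \<in> carrier A" for c a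
  proof -
    have "rcoset_smult A J c (J +>\<^bsub>A\<^esub> a) = J +>\<^bsub>A\<^esub> (c \<odot>\<^bsub>A\<^esub> a)"
      unfolding rcoset_smult_def
    proof (rule A.rcoset_union_const[OF add])
      show "J +>\<^bsub>A\<^esub> a \<noteq> {}" using A.a_rcoset_self[OF add a] by blast
      fix x assume "x \<in> J +>\<^bsub>A\<^esub> a"
      then have x: "x \<in> carrier A" "x \<ominus>\<^bsub>A\<^esub> a \<in> J" using A.a_rcoset_mem[OF add a] by blast+
      \<comment> \<open>Scalars act through multiples of the unit, which makes the ideal a
        subspace.\<close>
      have "(c \<odot>\<^bsub>A\<^esub> \<one>\<^bsub>A\<^esub>) \<otimes>\<^bsub>A\<^esub> (x \<ominus>\<^bsub>A\<^esub> a) = c \<odot>\<^bsub>A\<^esub> (x \<ominus>\<^bsub>A\<^esub> a)"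
        using x(1) a c by (simp add: A.smult_assoc2)
      also have "\<dots> = c \<odot>\<^bsub>A\<^esub> x \<ominus>\<^bsub>A\<^esub> c \<odot>\<^bsub>A\<^esub> a"
        using x(1) a c by (simp add: a_minus_def A.smult_r_distr A.smult_r_minus)
      finally show "c \<odot>\<^bsub>A\<^esub> x \<in> carrier A \<and> c \<odot>\<^bsub>A\<^esub> x \<ominus>\<^bsub>A\<^esub> c \<odot>\<^bsub>A\<^esub> a \<in> J"
        using J.I_l_closed[OF x(2), of "c \<odot>\<^bsub>A\<^esub> \<one>\<^bsub>A\<^esub>"] x(1) c by simp
    qed (use a c in simp)
    then show ?thesis by (simp add: q \<pi>_def)
  qed
  show "Module.algebra K (quot_algebra A J)" by (rule algebra_hom_image[OF A 1 2 3 4 5 6])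
qed

text \<open>\<open>stable\<close> says that J is a Poisson ideal, whence brackets of cosets do not
  depend on representatives.\<close>

lemma np_quotient:
  fixes K :: "'k ring" and A :: "('k, 'a) np_algebra"
  assumes A: "nambu_poisson_algebra K n A" and n: "0 < n" and J: "ideal J A"
    and stable: "\<And>us s. length us = n \<Longrightarrow> set us \<subseteq> carrier A \<Longrightarrow> s < n \<Longrightarrow> us ! s \<in> J \<Longrightarrow> nbracket A us \<in> J"
  defines "\<pi> \<equiv> a_r_coset A J"
  shows "\<And>us. length us = n \<Longrightarrow> set us \<subseteq> carrier A \<Longrightarrow> nbracket (quot_np_algebra A J) (map \<pi> us) = \<pi> (nbracket A us)"
    and "nambu_poisson_algebra K n (quot_np_algebra A J)"
proof -
  interpret A: nambu_poisson_algebra K n A by (rule A)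
  interpret J: ideal J A by (rule J)
  have add: "additive_subgroup J A" by (rule J.is_additive_subgroup)
  have carr: "additive_subgroup (carrier A) A"
    by (rule additive_subgroupI) (rule A.add.subgroup_self)
  show br: "nbracket (quot_np_algebra A J) (map \<pi> us) = \<pi> (nbracket A us)" if us: "length us = n" "set us \<subseteq> carrier A" for us
  proof -
    have "rcoset_bracket A J (map \<pi> us) = J +>\<^bsub>A\<^esub> nbracket A us"
    proof (rule A.rcoset_bracket_eq[OF add us(1), where U="\<lambda>_. carrier A" and D="\<lambda>_. J"])
      fix hs s assume "length hs = n" "\<And>r. r < n \<Longrightarrow> hs ! r \<in> carrier A" "s < n" "hs ! s \<in> J"
      then show "nbracket A hs \<in> J" by (intro stable) (auto simp: in_set_conv_nth)
    qed (use us J.a_subset add carr in \<open>auto simp: \<pi>_def subset_iff\<close>)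
    then show ?thesis
      by (simp add: quot_np_algebra_def module.extend_def np_algebra.fields_def \<pi>_def)
  qed
  note aq = algebra_quotient[OF A.algebra J, folded \<pi>_def]
  have sel: "carrier (quot_np_algebra A J) = carrier (quot_algebra A J)" "monoid.mult (quot_np_algebra A J) = monoid.mult (quot_algebra A J)"
    "one (quot_np_algebra A J) = one (quot_algebra A J)" "ring.add (quot_np_algebra A J) = ring.add (quot_algebra A J)"
    "ring.zero (quot_np_algebra A J) = ring.zero (quot_algebra A J)" "module.smult (quot_np_algebra A J) = module.smult (quot_algebra A J)"
    by (simp_all add: quot_np_algebra_def module.extend_def)
  show "nambu_poisson_algebra K n (quot_np_algebra A J)"
    by (rule A.hom_image[OF n, of \<pi>]) (use aq br in \<open>simp_all add: sel\<close>)
qed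

section \<open>Polynomial algebras\<close>

lemma carrier_poly_algebra: "carrier (poly_algebra N) = pvars {..<N}"
  by (simp add: poly_algebra_def pvars_def)

lemma poly_algebra_sel:
  "monoid.mult (poly_algebra N) = (*)" "one (poly_algebra N) = 1"
  "ring.zero (poly_algebra N) = 0" "ring.add (poly_algebra N) = (+)"
  "module.smult (poly_algebra N) = (\<lambda>c p. mconst c * p)"
  by (simp_all add: poly_algebra_def)

lemma A_pot_sel:
  "carrier (A_pot n \<Omega>) = pvars {..<n + 1}" "monoid.mult (A_pot n \<Omega>) = (*)" "one (A_pot n \<Omega>) = 1"
  "ring.zero (A_pot n \<Omega>) = 0" "ring.add (A_pot n \<Omega>) = (+)"
  "module.smult (A_pot n \<Omega>) = (\<lambda>c p. mconst c * p)"
  "nbracket (A_pot n \<Omega>) = (\<lambda>fs. jacobian_det (fs @ [\<Omega>]))"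
  by (simp_all add: A_pot_def module.extend_def np_algebra.fields_def poly_algebra_def pvars_def)

lemma class_cring: "cring (class_ring :: 'k::field ring)"
  using class_field by (rule fieldE)

lemma algebra_of_polynomials:
  fixes B :: "('k::field, 'k mpoly, 'm) module_scheme"
  assumes sel: "carrier B = pvars V" "monoid.mult B = (*)" "one B = 1" "ring.zero B = 0" "ring.add B = (+)"
    "module.smult B = (\<lambda>c p. mconst c * p)"
  shows "Module.algebra class_ring B"
proof (rule algebraI)
  show "cring (class_ring :: 'k ring)" by (rule class_cring)
  show "cring B"
  proof (rule cringI)
    show "abelian_group B"
    proof (rule abelian_groupI)
      fix x assume "x \<in> carrier B"
      then show "\<exists>y\<in>carrier B. y \<oplus>\<^bsub>B\<^esub> x = \<zero>\<^bsub>B\<^esub>"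
        by (intro bexI[of _ "- x"]) (simp_all add: sel pvars_uminus)
    qed (simp_all add: sel pvars_add ac_simps)
    show "comm_monoid B"
      by (rule comm_monoidI) (simp_all add: sel pvars_mult ac_simps)
  qed (simp add: sel distrib_right)
qed (simp_all add: sel pvars_mult mconst_add mconst_mult algebra_simps)

lemma algebra_poly_algebra: "Module.algebra class_ring (poly_algebra N)"
  by (rule algebra_of_polynomials) (simp_all add: poly_algebra_sel carrier_poly_algebra)

lemma finsum_polynomials:
  fixes B :: "('k::field, 'k mpoly, 'm) module_scheme"
  assumes B: "abelian_monoid B" and sel: "ring.zero B = 0" "ring.add B = (+)"
    and S: "finite S" "f \<in> S \<rightarrow> carrier B"
  shows "finsum B f S = sum f S"
proof -
  interpret abelian_monoid B by (rule B)
  show ?thesis using S by (induction S rule: finite_induct) (auto simp: sel)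
qed

theorem nambu_poisson_A_pot:
  fixes \<Omega> :: "'k::field_char_0 mpoly"
  assumes n: "n \<ge> 1" and \<Omega>: "\<Omega> \<in> pvars {..<n + 1}"
  shows "nambu_poisson_algebra class_ring n (A_pot n \<Omega>)"
proof -
  have alg: "Module.algebra class_ring (A_pot n \<Omega>)"
    by (rule algebra_of_polynomials) (simp_all add: A_pot_sel)
  interpret A: Module.algebra class_ring "A_pot n \<Omega>" by (rule alg)
  have closed: "jacobian_det (us @ [\<Omega>]) \<in> pvars {..<n + 1}" if "set us \<subseteq> pvars {..<n + 1}" for us
    using that \<Omega> by (rule jacobian_pvars)
  show ?thesis
  proof (rule nambu_poisson_algebra.intro[OF class_field alg], unfold A_pot_sel)
    fix us :: "'k mpoly list" and vs :: "'k mpoly list"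
    assume us: "length us = n" "set us \<subseteq> pvars {..<n + 1}" and vs: "length vs = n - 1" "set vs \<subseteq> pvars {..<n + 1}"
    have len: "length us = Suc (length vs)" using us(1) vs(1) n by simp
    have cl: "jacobian_det ((us ! s # vs) @ [\<Omega>]) \<in> pvars {..<n + 1}" if "s < n" for s
      using us vs that nth_mem[of s us] by (intro closed) auto
    have "jacobian_det (us[s := jacobian_det ((us ! s # vs) @ [\<Omega>])] @ [\<Omega>]) \<in> pvars {..<n + 1}" if "s < n" for s
      by (rule closed, rule set_update_subsetI) (use cl[OF that] us in simp_all)
    then have "(\<Oplus>\<^bsub>A_pot n \<Omega>\<^esub>s\<in>{..<n}. jacobian_det (us[s := jacobian_det ((us ! s # vs) @ [\<Omega>])] @ [\<Omega>])) =
        (\<Sum>s<n. jacobian_det (us[s := jacobian_det ((us ! s # vs) @ [\<Omega>])] @ [\<Omega>]))"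
      by (intro finsum_polynomials[OF A.M.abelian_monoid_axioms]) (auto simp: A_pot_sel)
    then show "jacobian_det ((jacobian_det (us @ [\<Omega>]) # vs) @ [\<Omega>]) =
        (\<Oplus>\<^bsub>A_pot n \<Omega>\<^esub>s\<in>{..<n}. jacobian_det (us[s := jacobian_det ((us ! s # vs) @ [\<Omega>])] @ [\<Omega>]))"
      using jacobian_fundamental_identity[OF refl len, of \<Omega>] us(1) by simp
  next
    fix us :: "'k mpoly list" and i j
    assume "length us = n" "i < j" "j < n" "us ! i = us ! j"
    then show "jacobian_det (us @ [\<Omega>]) = 0"
      by (intro jacobian_alternating[of i _ j]) (auto simp: nth_append)
  qed (use closed in blast, (rule jacobian_add jacobian_mconst jacobian_leibniz; simp)+)
qed

text \<open>The combinations form an ideal that contains the generators, and the generated ideal is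
  minimal.\<close>

lemma ideal_genset_subset:
  fixes \<Omega> :: "'k::field mpoly" and N :: nat
  defines "V \<equiv> {..<N}"
  assumes \<Omega>: "\<Omega> \<in> pvars V"
  shows "genideal (poly_algebra N) {partial_deriv i \<Omega> | i. i < N} \<subseteq>
    {\<Sum>l<N. q l * partial_deriv l \<Omega> | q. \<forall>l<N. q l \<in> pvars V}" (is "_ \<subseteq> ?J")
proof -
  interpret R: Module.algebra class_ring "poly_algebra N :: ('k, 'k mpoly) module" by (rule algebra_poly_algebra)
  have d: "partial_deriv l \<Omega> \<in> pvars V" for l using \<Omega> by (rule pvars_partial_deriv)
  have JV: "?J \<subseteq> pvars V" using d by (auto intro!: pvars_sum pvars_mult)
  have uminus: "\<ominus>\<^bsub>poly_algebra N\<^esub> x = - x" if "x \<in> pvars V" for x :: "'k mpoly"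
    using that by (intro R.minus_equality) (auto simp: poly_algebra_sel carrier_poly_algebra pvars_uminus V_def)
  have J: "ideal ?J (poly_algebra N :: ('k, 'k mpoly) module)"
  proof (rule idealI)
    show "ring (poly_algebra N :: ('k, 'k mpoly) module)" by (rule R.ring_axioms)
    show "subgroup ?J (add_monoid (poly_algebra N))"
    proof
      show "?J \<subseteq> carrier (add_monoid (poly_algebra N))" using JV by (simp add: carrier_poly_algebra V_def)
      show "\<one>\<^bsub>add_monoid (poly_algebra N)\<^esub> \<in> ?J"
        by (auto simp: poly_algebra_sel intro!: exI[of _ "\<lambda>_. 0"])
      fix x y assume x: "x \<in> ?J" and y: "y \<in> ?J"
      obtain q where q: "x = (\<Sum>l<N. q l * partial_deriv l \<Omega>)" "\<forall>l<N. q l \<in> pvars V" using x by blast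
      obtain r where r: "y = (\<Sum>l<N. r l * partial_deriv l \<Omega>)" "\<forall>l<N. r l \<in> pvars V" using y by blast
      have "x + y = (\<Sum>l<N. (q l + r l) * partial_deriv l \<Omega>)"
        by (simp add: q(1) r(1) distrib_right sum.distrib)
      then show "x \<otimes>\<^bsub>add_monoid (poly_algebra N)\<^esub> y \<in> ?J"
        using q(2) r(2) by (auto simp: poly_algebra_sel intro!: exI[of _ "\<lambda>l. q l + r l"] pvars_add)
      have "- x = (\<Sum>l<N. (- q l) * partial_deriv l \<Omega>)" by (simp add: q(1) sum_negf)
      then have "- x \<in> ?J" using q(2) by (auto intro!: exI[of _ "\<lambda>l. - q l"] pvars_uminus)
      moreover have "x \<in> pvars V" using x JV by blast
      ultimately show "inv\<^bsub>add_monoid (poly_algebra N)\<^esub> x \<in> ?J"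
        using uminus by (simp add: a_inv_def)
    qed
    fix a x assume a: "a \<in> ?J" and x: "x \<in> carrier (poly_algebra N :: ('k, 'k mpoly) module)"
    obtain q where q: "a = (\<Sum>l<N. q l * partial_deriv l \<Omega>)" "\<forall>l<N. q l \<in> pvars V" using a by blast
    have "x * a = (\<Sum>l<N. (x * q l) * partial_deriv l \<Omega>)" by (simp add: q(1) sum_distrib_left mult.assoc)
    then have "x * a \<in> ?J" using q(2) x
      by (auto simp: carrier_poly_algebra V_def intro!: exI[of _ "\<lambda>l. x * q l"] pvars_mult)
    then show "x \<otimes>\<^bsub>poly_algebra N\<^esub> a \<in> ?J" "a \<otimes>\<^bsub>poly_algebra N\<^esub> x \<in> ?J"
      by (simp_all add: poly_algebra_sel mult.commute)
  qed
  have "partial_deriv i \<Omega> \<in> ?J" if "i < N" for i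
  proof -
    have "partial_deriv i \<Omega> = (\<Sum>l<N. (if l = i then 1 else 0) * partial_deriv l \<Omega>)"
      using that by (simp add: if_distrib[of "\<lambda>z. z * _"] cong: if_cong)
    then show ?thesis by (auto intro!: exI[of _ "\<lambda>l. if l = i then 1 else 0"])
  qed
  then show ?thesis by (intro R.genideal_minimal J) auto
qed

text \<open>In a finite-dimensional quotient the powers of \<open>t\<^sub>i\<close> satisfy a
  relation, so some nonzero polynomial in \<open>t\<^sub>i\<close> lies in the ideal. The ideal is
  homogeneous, hence already a single power lies in it; the maximal exponent serves all
  variables.\<close>

lemma fin_dim_imp_powers:
  fixes \<Omega> :: "'k::field mpoly"
  assumes \<Omega>: "\<Omega> \<in> pvars {..<N}" "homogeneous d \<Omega>"
    and fd: "vectorspace.fin_dim class_ring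
      (quot_algebra (poly_algebra N) (genideal (poly_algebra N) {partial_deriv i \<Omega> | i. i < N}))"
  shows "\<exists>M. \<forall>i<N. \<exists>q. (\<forall>l<N. q l \<in> pvars {..<N}) \<and> tvar i ^ M = (\<Sum>l<N. q l * partial_deriv l \<Omega>)"
proof -
  let ?R = "poly_algebra N :: ('k, 'k mpoly) module"
  let ?V = "{..<N}"
  define J where "J = genideal ?R {partial_deriv i \<Omega> | i. i < N}"
  interpret R: Module.algebra class_ring ?R by (rule algebra_poly_algebra)
  have J: "ideal J ?R" unfolding J_def
    using pvars_partial_deriv[OF \<Omega>(1)] by (intro R.genideal_ideal) (auto simp: carrier_poly_algebra)
  then have Jadd: "additive_subgroup J ?R" by (simp add: ideal_def)
  define e where "e = a_r_coset ?R J"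
  note q = algebra_quotient[OF algebra_poly_algebra J, folded e_def]
  let ?Q = "quot_algebra ?R J"
  interpret Q: Module.algebra class_ring ?Q by (rule q(7))
  interpret Q: vectorspace class_ring ?Q
    by (intro vectorspace.intro Q.module_axioms class_field)
  have eJ: "e f = e g \<longleftrightarrow> f - g \<in> J" if "f \<in> pvars ?V" "g \<in> pvars ?V" for f g
  proof -
    have "\<ominus>\<^bsub>?R\<^esub> g = - g"
      using that by (intro R.minus_equality) (auto simp: poly_algebra_sel carrier_poly_algebra pvars_uminus)
    then show ?thesis
      using R.a_rcoset_eq_iff[OF Jadd, of f g] that
      by (simp add: e_def carrier_poly_algebra a_minus_def poly_algebra_sel)
  qed
  \<comment> \<open>Homogeneity of the ideal: the derivatives are forms of degree
    \<open>d - 1\<close>, so a component of a combination is obtained by taking components of the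
    coefficients.\<close>
  have hc: "\<exists>q. (\<forall>l<N. q l \<in> pvars ?V) \<and> hcomp D p = (\<Sum>l<N. q l * partial_deriv l \<Omega>)" if p: "p \<in> J" for p D
  proof -
    obtain q where q: "\<forall>l<N. q l \<in> pvars ?V" "p = (\<Sum>l<N. q l * partial_deriv l \<Omega>)"
      using ideal_genset_subset[OF \<Omega>(1)] p unfolding J_def by blast
    have "hcomp D p = (\<Sum>l<N. (if d - 1 \<le> D then hcomp (D - (d - 1)) (q l) else 0) * partial_deriv l \<Omega>)"
      unfolding q(2) hcomp_sum
      by (intro sum.cong refl) (simp add: hcomp_mult_homogeneous[OF homogeneous_partial_deriv[OF \<Omega>(2)]])
    then show ?thesis using q(1)
      by (intro exI[of _ "\<lambda>l. if d - 1 \<le> D then hcomp (D - (d - 1)) (q l) else 0"]) (auto intro: pvars_hcomp)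
  qed
  have "\<exists>M. \<exists>q. (\<forall>l<N. q l \<in> pvars ?V) \<and> tvar i ^ M = (\<Sum>l<N. q l * partial_deriv l \<Omega>)" if i: "i < N" for i
  proof -
    have tV: "(tvar i ^ l :: 'k mpoly) \<in> pvars ?V" for l using i by (intro pvars_power pvars_tvar) auto
    have th: "hcomp M (mconst c * tvar i ^ l) = (if M = l then mconst c * tvar i ^ l else 0)" for M l and c :: 'k
      using homogeneous_mult[OF homogeneous_mconst[of c] homogeneous_power[OF homogeneous_tvar[of i], of l]]
      by (simp add: hcomp_homogeneous)
    have th1: "hcomp M (tvar i ^ l) = (if M = l then tvar i ^ l else 0 :: 'k mpoly)" for M l
      using th[of M 1 l] by simp
    have mt: "mconst c * tvar i ^ l \<in> pvars ?V" for c :: 'k and l by (intro pvars_mult tV pvars_mconst)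
    have "\<exists>p M c. p \<in> J \<and> c \<noteq> 0 \<and> hcomp M p = mconst c * tvar i ^ M"
    proof (cases "inj (\<lambda>l. e (tvar i ^ l))")
      case False
      \<comment> \<open>Two coinciding powers give a relation directly; linear dependence is a
        notion for sets of vectors and does not see a repetition.\<close>
      then obtain l m where lm: "l \<noteq> m" "e (tvar i ^ l) = e (tvar i ^ m)" by (auto simp: inj_on_def)
      then have "tvar i ^ l - tvar i ^ m \<in> J" using eJ tV by blast
      moreover have "hcomp l (tvar i ^ l - tvar i ^ m) = mconst (1::'k) * tvar i ^ l"
        using lm(1) by (simp add: hcomp_diff th1)
      ultimately show ?thesis using one_neq_zero by blast
    next
      case True
      let ?E = "range (\<lambda>l. e (tvar i ^ l))"
      have "infinite ?E" using True by (simp add: finite_image_iff)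
      moreover have E: "?E \<subseteq> carrier ?Q" using q(1) tV by (auto simp: carrier_poly_algebra)
      ultimately have "Q.lin_dep ?E" using Q.fin_dim_li_fin[OF fd[folded J_def]] by blast
      then obtain S a v where S: "finite S" "S \<subseteq> ?E" "Q.lincomb a S = \<zero>\<^bsub>?Q\<^esub>" "v \<in> S" "a v \<noteq> (0::'k)"
        unfolding Q.lin_dep_def by auto
      define g where "g v = (SOME l. v = e (tvar i ^ l))" for v
      have g: "v = e (tvar i ^ g v)" if "v \<in> S" for v
        using someI_ex[of "\<lambda>l. v = e (tvar i ^ l)"] S(2) that unfolding g_def by blast
      define p where "p = (\<Sum>v\<in>S. mconst (a v) * tvar i ^ g v)"
      have pV: "p \<in> pvars ?V" unfolding p_def by (intro pvars_sum pvars_mult tV) simp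
      have term_eq: "a v \<odot>\<^bsub>?Q\<^esub> v = e (mconst (a v) * tvar i ^ g v)" if "v \<in> S" for v
        using q(6)[of "a v" "tvar i ^ g v"] tV by (simp add: carrier_poly_algebra poly_algebra_sel flip: g[OF that])
      have "e (finsum ?R (\<lambda>v. mconst (a v) * tvar i ^ g v) S) = finsum ?Q (\<lambda>v. e (mconst (a v) * tvar i ^ g v)) S"
        using S(1) tV by (intro hom_finsum R.M.abelian_monoid_axioms Q.M.abelian_monoid_axioms q(2,5))
          (use q(1) in \<open>auto simp: carrier_poly_algebra mt\<close>)
      also have "\<dots> = Q.lincomb a S" unfolding Q.lincomb_def
        using term_eq q(1) by (intro Q.M.finsum_cong') (auto simp: carrier_poly_algebra mt)
      also have "finsum ?R (\<lambda>v. mconst (a v) * tvar i ^ g v) S = p" unfolding p_def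
        using S(1) tV by (intro finsum_polynomials R.M.abelian_monoid_axioms)
          (auto simp: carrier_poly_algebra poly_algebra_sel mt)
      finally have "e p = e 0" using S(3) q(5) by (simp add: poly_algebra_sel)
      then have "p \<in> J" using eJ[OF pV] by simp
      \<comment> \<open>Different vectors in S have different exponents under \<open>g\<close>, so
        only v contributes in degree \<open>g v\<close>.\<close>
      moreover have "hcomp (g v) p = mconst (a v) * tvar i ^ g v"
      proof -
        have "hcomp (g v) p = (\<Sum>u\<in>S. if u = v then mconst (a v) * tvar i ^ g v else 0)"
          unfolding p_def hcomp_sum th using g S(4) by (intro sum.cong) metis+
        then show ?thesis using S(1,4) by simp
      qed
      ultimately show ?thesis using S(5) by blast
    qed
    then obtain p M c where p: "p \<in> J" "c \<noteq> 0" "hcomp M p = mconst c * tvar i ^ M" by blast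
    obtain q where q: "\<forall>l<N. q l \<in> pvars ?V" "hcomp M p = (\<Sum>l<N. q l * partial_deriv l \<Omega>)"
      using hc[OF p(1)] by blast
    have "tvar i ^ M = mconst (inverse c) * hcomp M p"
      using p(2,3) by (simp add: mult.assoc[symmetric] flip: mconst_mult)
    also have "\<dots> = (\<Sum>l<N. (mconst (inverse c) * q l) * partial_deriv l \<Omega>)"
      unfolding q(2) sum_distrib_left by (simp only: mult.assoc)
    finally show ?thesis using q(1)
      by (intro exI[of _ M] exI[of _ "\<lambda>l. mconst (inverse c) * q l"]) (simp add: pvars_mult)
  qed
  then obtain Mf where Mf: "\<And>i. i < N \<Longrightarrow> \<exists>q. (\<forall>l<N. q l \<in> pvars ?V) \<and> tvar i ^ Mf i = (\<Sum>l<N. q l * partial_deriv l \<Omega>)"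
    by metis
  define M where "M = Max (Mf ` ?V)"
  have "\<exists>q. (\<forall>l<N. q l \<in> pvars ?V) \<and> tvar i ^ M = (\<Sum>l<N. q l * partial_deriv l \<Omega>)" if i: "i < N" for i
  proof -
    obtain q where q: "\<forall>l<N. q l \<in> pvars ?V" "tvar i ^ Mf i = (\<Sum>l<N. q l * partial_deriv l \<Omega>)"
      using Mf[OF i] by blast
    have "Mf i \<le> M" unfolding M_def using i by (intro Max_ge) auto
    then have "tvar i ^ M = tvar i ^ (M - Mf i) * (tvar i ^ Mf i :: 'k mpoly)" by (simp flip: power_add)
    also have "\<dots> = (\<Sum>l<N. (tvar i ^ (M - Mf i) * q l) * partial_deriv l \<Omega>)"
      unfolding q(2) sum_distrib_left by (simp only: mult.assoc)
    finally show ?thesis using q(1) i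
      by (intro exI[of _ "\<lambda>l. tvar i ^ (M - Mf i) * q l"]) (auto intro!: pvars_mult pvars_power pvars_tvar)
  qed
  then show ?thesis by blast
qed

section \<open>The degree filtration\<close>

declare One_nat_def [simp del]

text \<open>Homogeneity for integer degrees, closed under the shifts caused by brackets and
  derivatives; in negative degrees only 0 remains.\<close>

definition homz :: "int \<Rightarrow> 'k::comm_ring_1 mpoly \<Rightarrow> bool"
  where "homz D p \<longleftrightarrow> (\<forall>m. hcomp m p \<noteq> 0 \<longrightarrow> int m = D)"

text \<open>Filtrations are decreasing, so the component of degree \<open>m\<close> has index \<open>- m\<close>.\<close>

definition cmp :: "int \<Rightarrow> 'k::comm_ring_1 mpoly \<Rightarrow> 'k mpoly"
  where "cmp i p = (if i \<le> 0 then hcomp (nat (- i)) p else 0)"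

lemma homz_zero [simp]: "homz D 0"
  by (simp add: homz_def)

lemma homz_add: "homz D p \<Longrightarrow> homz D q \<Longrightarrow> homz D (p + q)"
  unfolding homz_def hcomp_add by (metis add.right_neutral)

lemma homz_uminus: "homz D p \<Longrightarrow> homz D (- p)"
  by (simp add: homz_def hcomp_uminus)

lemma homz_homogeneous: "homogeneous d p \<Longrightarrow> homz (int d) p"
  by (auto simp: homz_def hcomp_homogeneous)

lemma homz_cmp: "homz (- i) (cmp i p)"
  using homz_homogeneous[of "nat (- i)" "hcomp (nat (- i)) p"] by (cases "i \<le> 0") (simp_all add: cmp_def)

lemma homz_degle: "homz D p \<Longrightarrow> degle D p"
  by (simp add: homz_def degle_def)

lemma cmp_homz:
  assumes "homz (- i) p"
  shows "cmp k p = (if k = i then p else 0)"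
proof (cases "p = 0")
  case False
  then have t: "int (tdeg p) = - i" using assms hcomp_tdeg_nonzero[of p] unfolding homz_def by blast
  have "hcomp e p = (if e = tdeg p then p else 0)" for e
  proof -
    have z: "hcomp d p = 0" if "d \<noteq> tdeg p" for d using assms t that unfolding homz_def by (metis of_nat_eq_iff)
    have "p = (\<Sum>d\<le>tdeg p. hcomp d p)" by (simp add: sum_hcomp)
    also have "\<dots> = (\<Sum>d\<le>tdeg p. if d = tdeg p then hcomp (tdeg p) p else 0)"
      using z by (intro sum.cong) auto
    finally have "p = hcomp (tdeg p) p" by simp
    then show ?thesis using z by simp
  qed
  then show ?thesis using t by (auto simp: cmp_def)
qed (simp add: cmp_def)

lemma homz_mult: "homz D p \<Longrightarrow> homz E q \<Longrightarrow> homz (D + E) (p * q)"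
  unfolding homz_def
proof (intro allI impI)
  fix m assume p: "\<forall>m. hcomp m p \<noteq> 0 \<longrightarrow> int m = D" and q: "\<forall>m. hcomp m q \<noteq> 0 \<longrightarrow> int m = E"
    and "hcomp m (p * q) \<noteq> 0"
  then obtain i where i: "i \<le> m" "hcomp i p * hcomp (m - i) q \<noteq> 0"
    unfolding hcomp_mult by (metis (no_types, lifting) atMost_iff sum.not_neutral_contains_not_neutral)
  then have "hcomp i p \<noteq> 0" "hcomp (m - i) q \<noteq> 0" by auto
  then have "int i = D" "int (m - i) = E" using p q by blast+
  then show "int m = D + E" using i(1) by linarith
qed

lemma homz_partial_deriv: "homz D p \<Longrightarrow> homz (D - 1) (partial_deriv i p)"
  unfolding homz_def hcomp_partial_deriv
proof (intro allI impI)
  fix m assume "\<forall>m. hcomp m p \<noteq> 0 \<longrightarrow> int m = D" "partial_deriv i (hcomp (Suc m) p) \<noteq> 0"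
  moreover from this(2) have "hcomp (Suc m) p \<noteq> 0" by auto
  ultimately have "int (Suc m) = D" by blast
  then show "int m = D - 1" by simp
qed

lemma jacobian_homz:
  assumes "list_all2 (\<lambda>f d. homz d f) fs ds" "homz d \<Omega>"
  shows "homz (sum_list ds + d - int (length fs) - 1) (jacobian_det (fs @ [\<Omega>]))"
proof -
  have "homz 0 (1 :: 'a mpoly)" using homz_homogeneous[OF homogeneous_mconst[of 1]] by simp
  then have "jacobian_det (fs @ [\<Omega>]) \<in> {p. homz (sum_list ds + d - int (length fs) - 1) p}"
    by (intro jacobian_mem[where X="\<lambda>d. {p. homz d p}"])
      (use assms in \<open>auto intro: homz_add homz_uminus homz_mult homz_partial_deriv\<close>)
  then show ?thesis by simp
qed

lemma cmp_add: "cmp i (p + q) = cmp i p + cmp i q"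
  by (simp add: cmp_def hcomp_add)

lemma cmp_zero [simp]: "cmp i 0 = 0"
  by (simp add: cmp_def)

lemma cmp_sum: "cmp i (sum f S) = (\<Sum>x\<in>S. cmp i (f x))"
  by (induction S rule: infinite_finite_induct) (simp_all add: cmp_add)

lemma cmp_mconst_mult: "cmp i (mconst c * p) = mconst c * cmp i p"
  using hcomp_mult_homogeneous[OF homogeneous_mconst[of c], of _ p] by (simp add: cmp_def mult.commute)

lemma pvars_cmp: "p \<in> pvars V \<Longrightarrow> cmp i p \<in> pvars V"
  by (simp add: cmp_def pvars_hcomp)

lemma cmp_outside: "i \<notin> {- int (tdeg p)..0} \<Longrightarrow> cmp i p = 0"
  using hcomp_above_tdeg[of p "nat (- i)"] by (auto simp: cmp_def)

lemma sum_cmp: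
  assumes "{- int (tdeg p)..0} \<subseteq> S" "finite S"
  shows "(\<Sum>i\<in>S. cmp i p) = p"
proof -
  have "(\<Sum>i\<in>S. cmp i p) = (\<Sum>i\<in>{- int (tdeg p)..0}. cmp i p)"
    by (rule sum.mono_neutral_right) (use assms in \<open>auto intro!: cmp_outside\<close>)
  also have "\<dots> = (\<Sum>d\<in>{..tdeg p}. hcomp d p)"
    by (rule sum.reindex_bij_witness[of _ "\<lambda>d. - int d" "\<lambda>i. nat (- i)"]) (auto simp: cmp_def)
  also have "\<dots> = p" by (simp add: sum_hcomp)
  finally show ?thesis .
qed

lemma cmp_mult:
  assumes S: "{- int (tdeg p)..0} \<subseteq> S" "finite S"
  shows "cmp k (p * q) = (\<Sum>i\<in>S. cmp i p * cmp (k - i) q)"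
proof -
  define T where "T = {- int (tdeg q)..0}"
  have q: "q = (\<Sum>j\<in>T. cmp j q)" by (rule sum_cmp[symmetric]) (simp_all add: T_def)
  have "p * q = (\<Sum>i\<in>S. \<Sum>j\<in>T. cmp i p * cmp j q)"
    using sum_cmp[OF S] q by (simp flip: sum_product)
  then have "cmp k (p * q) = (\<Sum>i\<in>S. \<Sum>j\<in>T. cmp k (cmp i p * cmp j q))" by (simp add: cmp_sum)
  also have "\<dots> = (\<Sum>i\<in>S. cmp i p * cmp (k - i) q)"
  proof (rule sum.cong[OF refl])
    fix i assume "i \<in> S"
    have "cmp k (cmp i p * cmp j q) = (if j = k - i then cmp i p * cmp (k - i) q else 0)" for j
    proof -
      have "homz (- (i + j)) (cmp i p * cmp j q)" using homz_mult[OF homz_cmp[of i p] homz_cmp[of j q]] by simp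
      from cmp_homz[OF this, of k] show ?thesis by auto
    qed
    then have "(\<Sum>j\<in>T. cmp k (cmp i p * cmp j q)) = (\<Sum>j\<in>T. if j = k - i then cmp i p * cmp (k - i) q else 0)" by simp
    also have "\<dots> = cmp i p * cmp (k - i) q"
      using cmp_outside[of "k - i" q] by (auto simp: T_def)
    finally show "(\<Sum>j\<in>T. cmp k (cmp i p * cmp j q)) = cmp i p * cmp (k - i) q" .
  qed
  finally show ?thesis .
qed

lemma jacobian_slot_sum:
  "jacobian_det (xs @ sum f S # ys @ [\<Omega>]) = (\<Sum>i\<in>S. jacobian_det (xs @ f i # ys @ [\<Omega>]))"
proof -
  have up: "jacobian_det (xs @ a # ys @ [\<Omega>]) = jacobian_det ((xs @ 0 # ys)[length xs := a] @ [\<Omega>])" for a by simp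
  have zero: "jacobian_det (xs @ 0 # ys @ [\<Omega>]) = 0"
    using jacobian_mconst[of "length xs" "xs @ 0 # ys" 0 0 \<Omega>] by simp
  have add: "jacobian_det (xs @ (a + b) # ys @ [\<Omega>]) = jacobian_det (xs @ a # ys @ [\<Omega>]) + jacobian_det (xs @ b # ys @ [\<Omega>])" for a b
    unfolding up by (rule jacobian_add) simp
  show ?thesis by (induction S rule: infinite_finite_induct) (simp_all add: zero add)
qed

text \<open>One index set S serves all arguments. The prefix \<open>xs\<close> carries the slots
  that are already expanded through the induction.\<close>

lemma jacobian_expand:
  assumes "finite S" "\<And>f. f \<in> set fs \<Longrightarrow> {- int (tdeg f)..0} \<subseteq> S"
  shows "jacobian_det (xs @ fs @ [\<Omega>]) =
    (\<Sum>is | set is \<subseteq> S \<and> length is = length fs. jacobian_det (xs @ map2 (\<lambda>f i. cmp i f) fs is @ [\<Omega>]))"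
  using assms(2)
proof (induction fs arbitrary: xs)
  case Nil
  have "{is. set is \<subseteq> S \<and> length is = 0} = {[]}" by auto
  then show ?case by simp
next
  case (Cons f fs)
  let ?L = "\<lambda>n. {is. set is \<subseteq> S \<and> length is = n}"
  have f: "(\<Sum>i\<in>S. cmp i f) = f" using Cons.prems by (intro sum_cmp assms(1)) auto
  have "jacobian_det (xs @ (f # fs) @ [\<Omega>]) = (\<Sum>i\<in>S. jacobian_det ((xs @ [cmp i f]) @ fs @ [\<Omega>]))"
    using jacobian_slot_sum[of xs "\<lambda>i. cmp i f" S fs \<Omega>] f by simp
  also have "\<dots> = (\<Sum>i\<in>S. \<Sum>is\<in>?L (length fs). jacobian_det ((xs @ [cmp i f]) @ map2 (\<lambda>f i. cmp i f) fs is @ [\<Omega>]))"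
    using Cons by (intro sum.cong refl Cons.IH) auto
  also have "\<dots> = (\<Sum>(i, is)\<in>S \<times> ?L (length fs). jacobian_det (xs @ map2 (\<lambda>f i. cmp i f) (f # fs) (i # is) @ [\<Omega>]))"
    by (simp add: sum.cartesian_product)
  also have "\<dots> = (\<Sum>is\<in>?L (length (f # fs)). jacobian_det (xs @ map2 (\<lambda>f i. cmp i f) (f # fs) is @ [\<Omega>]))"
    by (rule sum.reindex_bij_witness[of _ "\<lambda>is. (hd is, tl is)" "\<lambda>(i, is). i # is"])
      (auto simp: length_Suc_conv)
  finally show ?case .
qed

section \<open>The quotient \<open>P\<close> and its filtration by degree\<close>

context potential
begin

abbreviation Apot :: "('k, 'k mpoly) np_algebra" where "Apot \<equiv> A_pot n \<Omega>"

abbreviation P :: "('k, 'k mpoly set) np_algebra" where "P \<equiv> P_pot n \<Omega> \<xi>"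

lemma np_Apot: "nambu_poisson_algebra class_ring n Apot"
  using n Om_vars by (intro nambu_poisson_A_pot) auto

sublocale Ap: nambu_poisson_algebra "class_ring :: 'k ring" n Apot
  by (rule np_Apot)

lemma genideal_eq_I: "genideal Apot {\<Omega> - mconst \<xi>} = I"
proof -
  have "\<Omega> - mconst \<xi> \<in> carrier Apot" using Om_vars by (simp add: A_pot_sel pvars_diff)
  then have "genideal Apot {\<Omega> - mconst \<xi>} = cgenideal Apot (\<Omega> - mconst \<xi>)"
    by (simp add: Ap.cgenideal_eq_genideal)
  also have "\<dots> = I" by (auto simp: cgenideal_def I_def A_pot_sel mult.commute)
  finally show ?thesis .
qed

lemma I_ideal: "ideal I Apot"
proof -
  have "\<Omega> - mconst \<xi> \<in> carrier Apot" using Om_vars by (simp add: A_pot_sel pvars_diff)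
  then show ?thesis unfolding genideal_eq_I[symmetric] by (intro Ap.genideal_ideal) auto
qed

lemma I_add: "f \<in> I \<Longrightarrow> g \<in> I \<Longrightarrow> f + g \<in> I"
  using additive_subgroup.a_closed[of I Apot f g] I_ideal by (simp add: ideal_def A_pot_sel)

lemma I_mult: "f \<in> I \<Longrightarrow> h \<in> pvars V \<Longrightarrow> h * f \<in> I"
  using ideal.I_l_closed[OF I_ideal, of f h] by (simp add: A_pot_sel)

lemma Apot_minus: "g \<in> pvars V \<Longrightarrow> f \<ominus>\<^bsub>Apot\<^esub> g = f - g"
proof -
  assume g: "g \<in> pvars V"
  then have "\<ominus>\<^bsub>Apot\<^esub> g = - g"
    by (intro Ap.minus_equality) (simp_all add: A_pot_sel pvars_uminus)
  then show ?thesis by (simp add: a_minus_def A_pot_sel)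
qed

text \<open>The bracket is a derivation in each slot and vanishes on \<Omega>, which repeats the
  last row, and on constants. So the factor \<open>\<Omega> - \<xi>\<close> can be pulled out of
  slot s.\<close>

lemma I_stable:
  assumes us: "length us = n" "set us \<subseteq> carrier Apot" "s < n" "us ! s \<in> I"
  shows "nbracket Apot us \<in> I"
proof -
  obtain h where h: "us ! s = (\<Omega> - mconst \<xi>) * h" "h \<in> pvars V" using us(4) unfolding I_def by blast
  have cl: "jacobian_det (us[s := h] @ [\<Omega>]) \<in> pvars V"
    using us h(2) by (intro jacobian_pvars set_update_subsetI Om_vars) (simp_all add: A_pot_sel)
  \<comment> \<open>The Leibniz rule for \<open>1 * 1\<close> shows that the bracket vanishes on
    1.\<close>
  have c: "jacobian_det (us[s := mconst \<xi>] @ [\<Omega>]) = 0"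
    using jacobian_mconst[of s us \<xi> 1 \<Omega>] jacobian_leibniz[of s us 1 1 \<Omega>] us by simp
  have "jacobian_det (us[s := \<Omega> - mconst \<xi>] @ [\<Omega>]) = 0"
    using jacobian_diff[of s us \<Omega> "mconst \<xi>" \<Omega>] jacobian_potential_zero[of s us \<Omega>] c us by simp
  then have "jacobian_det (us[s := (\<Omega> - mconst \<xi>) * h] @ [\<Omega>]) = (\<Omega> - mconst \<xi>) * jacobian_det (us[s := h] @ [\<Omega>])"
    using jacobian_leibniz[of s us "\<Omega> - mconst \<xi>" h \<Omega>] us by simp
  moreover have "us[s := (\<Omega> - mconst \<xi>) * h] = us" using h(1) by (metis list_update_id)
  ultimately show ?thesis using I_mem[OF cl] by (simp add: A_pot_sel)
qed

lemma P_quot: "P = quot_np_algebra Apot I"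
  by (simp add: P_pot_def genideal_eq_I)

definition \<pi> :: "'k mpoly \<Rightarrow> 'k mpoly set"
  where "\<pi> = a_r_coset Apot I"

lemma P_sel: "carrier P = carrier (quot_algebra Apot I)" "monoid.mult P = monoid.mult (quot_algebra Apot I)"
    "one P = one (quot_algebra Apot I)" "ring.add P = ring.add (quot_algebra Apot I)"
    "ring.zero P = ring.zero (quot_algebra Apot I)" "module.smult P = module.smult (quot_algebra Apot I)"
  by (simp_all add: P_quot quot_np_algebra_def module.extend_def)

lemmas quot_facts = algebra_quotient[OF Ap.algebra I_ideal, folded \<pi>_def P_sel, unfolded A_pot_sel]

lemma P_carrier: "carrier P = \<pi> ` pvars V"
  using quot_facts(1) by simp

lemma P_one: "\<one>\<^bsub>P\<^esub> = \<pi> 1" and P_zero: "\<zero>\<^bsub>P\<^esub> = \<pi> 0"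
  using quot_facts(4,5) by simp_all

lemma P_add: "f \<in> pvars V \<Longrightarrow> g \<in> pvars V \<Longrightarrow> \<pi> f \<oplus>\<^bsub>P\<^esub> \<pi> g = \<pi> (f + g)"
  using quot_facts(2)[of f g] by simp

lemma P_mult: "f \<in> pvars V \<Longrightarrow> g \<in> pvars V \<Longrightarrow> \<pi> f \<otimes>\<^bsub>P\<^esub> \<pi> g = \<pi> (f * g)"
  using quot_facts(3)[of f g] by simp

lemma P_smult: "f \<in> pvars V \<Longrightarrow> c \<odot>\<^bsub>P\<^esub> \<pi> f = \<pi> (mconst c * f)"
  using quot_facts(6)[of c f] by simp

lemma P_bracket: "length fs = n \<Longrightarrow> set fs \<subseteq> pvars V \<Longrightarrow> nbracket P (map \<pi> fs) = \<pi> (jacobian_det (fs @ [\<Omega>]))"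
  using np_quotient(1)[OF np_Apot _ I_ideal I_stable, where us=fs] n
  by (simp add: P_quot \<pi>_def A_pot_sel)

lemma np_P: "nambu_poisson_algebra class_ring n P"
  using np_quotient(2)[OF np_Apot _ I_ideal I_stable] n by (simp add: P_quot)

sublocale P: nambu_poisson_algebra "class_ring :: 'k ring" n P
  by (rule np_P)

lemma pi_eq_iff: "f \<in> pvars V \<Longrightarrow> g \<in> pvars V \<Longrightarrow> \<pi> f = \<pi> g \<longleftrightarrow> f - g \<in> I"
  using Ap.a_rcoset_eq_iff[of I f g] I_ideal Apot_minus[of g f] by (simp add: \<pi>_def A_pot_sel ideal_def)

lemma P_minus: "f \<in> pvars V \<Longrightarrow> g \<in> pvars V \<Longrightarrow> \<pi> f \<ominus>\<^bsub>P\<^esub> \<pi> g = \<pi> (f - g)"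
proof -
  assume fg: "f \<in> pvars V" "g \<in> pvars V"
  have "\<ominus>\<^bsub>P\<^esub> \<pi> g = \<pi> (- g)"
    using fg pvars_uminus[OF fg(2)] P_carrier by (intro P.minus_equality) (simp_all add: P_add P_zero)
  then show ?thesis using P_add[OF fg(1) pvars_uminus[OF fg(2)]] by (simp add: a_minus_def)
qed

lemma std_vars: "f \<in> std i \<Longrightarrow> f \<in> pvars V"
  by (simp add: std_def)

lemma I_std: "I \<subseteq> std i"
  unfolding std_def using I_vars by (auto intro!: bexI)

lemma std_I: "0 < i \<Longrightarrow> std i = I"
proof
  assume i: "0 < i"
  show "std i \<subseteq> I"
  proof
    fix f assume "f \<in> std i"
    then obtain h where h: "h \<in> I" "degle (- i) (f - h)" unfolding std_def by blast
    then have "f - h = 0" using degle_negative[OF h(2)] i by auto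
    then show "f \<in> I" using h(1) by simp
  qed
qed (rule I_std)

lemma std_add: "f \<in> std i \<Longrightarrow> g \<in> std i \<Longrightarrow> f + g \<in> std i"
proof -
  assume "f \<in> std i" "g \<in> std i"
  then obtain h k where hk: "f \<in> pvars V" "g \<in> pvars V" "h \<in> I" "degle (- i) (f - h)" "k \<in> I" "degle (- i) (g - k)"
    unfolding std_def by blast
  have eq: "(f + g) - (h + k) = (f - h) + (g - k)" by simp
  have "degle (- i) ((f + g) - (h + k))" unfolding eq by (rule degle_add[OF hk(4,6)])
  then show ?thesis using hk I_add pvars_add unfolding std_def by blast
qed

lemma std_degle: "degle (- i) f \<Longrightarrow> f \<in> pvars V \<Longrightarrow> f \<in> std i"
  unfolding std_def by (auto intro!: bexI[of _ 0])

lemma std_mult: "f \<in> std i \<Longrightarrow> g \<in> std j \<Longrightarrow> f * g \<in> std (i + j)"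
proof -
  assume "f \<in> std i" "g \<in> std j"
  then obtain h k where hk: "f \<in> pvars V" "g \<in> pvars V" "h \<in> I" "degle (- i) (f - h)" "k \<in> I" "degle (- j) (g - k)"
    unfolding std_def by blast
  have eq: "f * g = (f - h) * (g - k) + (g * h + (f - h) * k)" by (simp add: algebra_simps)
  have "degle (- (i + j)) ((f - h) * (g - k))" using degle_mult[OF hk(4,6)] by simp
  then have "(f - h) * (g - k) \<in> std (i + j)"
    using hk I_vars by (intro std_degle pvars_mult pvars_diff) auto
  moreover have "g * h + (f - h) * k \<in> I" using hk I_vars by (intro I_add I_mult pvars_diff) auto
  ultimately show ?thesis unfolding eq by (rule std_add[OF _ subsetD[OF I_std]])
qed

lemma std_smult: "f \<in> std i \<Longrightarrow> mconst c * f \<in> std i"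
  using std_mult[of "mconst c" 0 f i] std_degle[of 0 "mconst c"] by simp

lemma std_uminus: "f \<in> std i \<Longrightarrow> - f \<in> std i"
  using std_smult[of f i "- 1"] by (simp add: mconst_minus)

lemma std_decreasing: "i \<le> j \<Longrightarrow> std j \<subseteq> std i"
  unfolding std_def using degle_mono[of "- j" _ "- i"] by auto

text \<open>The bracket descends to \<open>P\<close>, so every argument may be replaced by a
  congruent polynomial that satisfies the degree bound itself.\<close>

lemma std_bracket:
  assumes "length is = n" "list_all2 (\<lambda>f i. f \<in> std i) fs is"
  shows "jacobian_det (fs @ [\<Omega>]) \<in> std (sum_list is - int d0)"
proof -
  have len: "length fs = n" using assms by (simp add: list_all2_lengthD)
  have "\<forall>s<n. \<exists>g. g \<in> pvars V \<and> fs ! s - g \<in> I \<and> degle (- (is ! s)) g"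
  proof (intro allI impI)
    fix s assume "s < n"
    then have "fs ! s \<in> std (is ! s)" using assms len by (simp add: list_all2_conv_all_nth)
    then obtain h where h: "h \<in> I" "degle (- (is ! s)) (fs ! s - h)" "fs ! s \<in> pvars V" unfolding std_def by blast
    then show "\<exists>g. g \<in> pvars V \<and> fs ! s - g \<in> I \<and> degle (- (is ! s)) g"
      using I_vars by (intro exI[of _ "fs ! s - h"]) (simp add: pvars_diff)
  qed
  then obtain g where g: "\<And>s. s < n \<Longrightarrow> g s \<in> pvars V" "\<And>s. s < n \<Longrightarrow> fs ! s - g s \<in> I" "\<And>s. s < n \<Longrightarrow> degle (- (is ! s)) (g s)"
    by metis
  define gs where "gs = map g [0..<n]"
  have fsV: "set fs \<subseteq> pvars V"
    using assms len std_vars by (fastforce simp: list_all2_conv_all_nth in_set_conv_nth)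
  have gsV: "set gs \<subseteq> pvars V" using g(1) by (auto simp: gs_def)
  have "map \<pi> fs = map \<pi> gs"
  proof (rule nth_equalityI)
    fix s assume s: "s < length (map \<pi> fs)"
    then have "fs ! s \<in> pvars V" using fsV by (simp add: subset_iff)
    then show "map \<pi> fs ! s = map \<pi> gs ! s" using pi_eq_iff[of "fs ! s" "g s"] g s len by (simp add: gs_def)
  qed (simp add: gs_def len)
  then have "\<pi> (jacobian_det (fs @ [\<Omega>])) = \<pi> (jacobian_det (gs @ [\<Omega>]))"
    using P_bracket[OF len fsV] P_bracket[OF _ gsV] by (simp add: gs_def)
  then have d: "jacobian_det (fs @ [\<Omega>]) - jacobian_det (gs @ [\<Omega>]) \<in> I"
    using pi_eq_iff jacobian_pvars[OF fsV Om_vars] jacobian_pvars[OF gsV Om_vars] by blast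
  have "list_all2 (\<lambda>f d. degle d f) gs (map uminus is)"
    using g(3) assms(1) by (simp add: gs_def list_all2_conv_all_nth)
  then have "degle (sum_list (map uminus is) + int dOm - int (length gs) - 1) (jacobian_det (gs @ [\<Omega>]))"
    by (rule jacobian_degle) (rule degle_homogeneous[OF Om_hom])
  moreover have "sum_list (map uminus is) = - sum_list is" by (induction "is") simp_all
  \<comment> \<open>The bracket raises degrees by \<open>dOm - n - 1 = d0\<close>: the degree of
    \<Omega>, less one for each of the \<open>n + 1\<close> differentiated rows.\<close>
  then have "sum_list (map uminus is) + int dOm - int (length gs) - 1 = - (sum_list is - int d0)"
    by (simp add: gs_def)
  ultimately have "degle (- (sum_list is - int d0)) (jacobian_det (gs @ [\<Omega>]))" by (simp only:)
  then have "jacobian_det (gs @ [\<Omega>]) \<in> std (sum_list is - int d0)"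
    using jacobian_pvars[OF gsV Om_vars] by (intro std_degle)
  then have "jacobian_det (gs @ [\<Omega>]) + (jacobian_det (fs @ [\<Omega>]) - jacobian_det (gs @ [\<Omega>])) \<in> std (sum_list is - int d0)"
    using d I_std by (intro std_add) auto
  then show ?thesis by simp
qed

lemma std_symbol:
  assumes f: "homogeneous m f" "f \<in> pvars V"
  shows "f \<in> std (1 - int m) \<longleftrightarrow> \<Omega> dvd f"
  using symbol_zero_iff[OF f] f(2) by (simp add: std_def)

definition Ft :: "int \<Rightarrow> 'k mpoly set set"
  where "Ft i = \<pi> ` std i"

lemma Ft_iff: "f \<in> pvars V \<Longrightarrow> \<pi> f \<in> Ft i \<longleftrightarrow> f \<in> std i"
proof
  assume f: "f \<in> pvars V" "\<pi> f \<in> Ft i"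
  then obtain g where g: "g \<in> std i" "\<pi> f = \<pi> g" unfolding Ft_def by blast
  then have "f - g \<in> I" using pi_eq_iff f(1) std_vars by blast
  then have "g + (f - g) \<in> std i" using g(1) I_std by (intro std_add) auto
  then show "f \<in> std i" by simp
qed (simp add: Ft_def)

lemma w_filtration_Ft: "w_filtration class_ring n (int d0) P Ft"
proof (intro w_filtration.intro np_P filtration.intro w_filtration_axioms.intro)
  show "VectorSpace.subspace class_ring (Ft i) P" for i
  proof (intro subspace.intro submodule.intro)
    show "vectorspace class_ring P" by (intro vectorspace.intro P.module_axioms class_field)
    show "module class_ring P" by (rule P.module_axioms)
    show "Ft i \<subseteq> carrier P" unfolding Ft_def P_carrier using std_vars by auto
    show "\<zero>\<^bsub>P\<^esub> \<in> Ft i" unfolding Ft_def P_zero using std_degle by (intro imageI) auto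
    fix v w assume "v \<in> Ft i" "w \<in> Ft i"
    then show "v \<oplus>\<^bsub>P\<^esub> w \<in> Ft i" unfolding Ft_def using P_add std_vars std_add by force
  next
    fix c v assume "v \<in> Ft i"
    then show "c \<odot>\<^bsub>P\<^esub> v \<in> Ft i" unfolding Ft_def using P_smult std_vars std_smult by force
  qed
  show "Ft (i + 1) \<subseteq> Ft i" for i unfolding Ft_def by (intro image_mono std_decreasing) simp
  have "1 \<notin> std 1"
  proof
    assume "1 \<in> std 1"
    then have "1 \<in> I" by (simp add: std_I)
    then show False using I_top(1)[of 1] tdeg_mconst[of "1::'k"] by simp
  qed
  then show "\<one>\<^bsub>P\<^esub> \<in> Ft 0 - Ft 1" using std_degle[of 0 1] by (simp add: P_one Ft_iff)
  show "f \<otimes>\<^bsub>P\<^esub> g \<in> Ft (i + j)" if fg: "f \<in> Ft i" "g \<in> Ft j" for f g i j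
    using fg unfolding Ft_def using P_mult std_vars std_mult by force
  show "(\<Union>i. Ft i - Ft (i + 1)) = carrier P - {\<zero>\<^bsub>P\<^esub>}"
  proof (intro equalityI subsetI)
    fix x assume "x \<in> (\<Union>i. Ft i - Ft (i + 1))"
    then obtain i where x: "x \<in> Ft i" "x \<notin> Ft (i + 1)" by blast
    have "\<pi> 0 \<in> Ft (i + 1)" using Ft_iff[of 0] std_degle[of "i + 1" 0] by simp
    then show "x \<in> carrier P - {\<zero>\<^bsub>P\<^esub>}" using x std_vars unfolding P_carrier P_zero by (auto simp: Ft_def)
  next
    fix x assume "x \<in> carrier P - {\<zero>\<^bsub>P\<^esub>}"
    then obtain f where f: "x = \<pi> f" "f \<in> pvars V" "\<pi> f \<noteq> \<pi> 0" unfolding P_carrier P_zero by blast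
    then have "f \<notin> I" using pi_eq_iff[of f 0] by simp
    \<comment> \<open>A nonzero class has index exactly \<open>- m\<close>, where m is the degree of
      a reduced representative: its leading form, not divisible by \<Omega>, stays outside the next
      member.\<close>
    then obtain h where h: "h \<in> I" "f - h \<noteq> 0" "\<not> \<Omega> dvd hcomp (tdeg (f - h)) (f - h)"
      using reduced_representative f(2) by blast
    define g where "g = f - h"
    define m where "m = tdeg g"
    have gV: "g \<in> pvars V" using f(2) I_vars[OF h(1)] pvars_diff g_def by blast
    have "\<pi> f = \<pi> g" using pi_eq_iff[OF f(2) gV] h(1) by (simp add: g_def)
    moreover have "g \<in> std (- int m)" using degle_tdeg[of g] gV by (intro std_degle) (simp_all add: m_def)
    moreover have "g \<notin> std (1 - int m)"
    proof
      assume g: "g \<in> std (1 - int m)"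
      have "degle (- (1 - int m)) (hcomp m g - g)"
        unfolding degle_def
      proof (intro allI impI)
        fix e assume e: "hcomp e (hcomp m g - g) \<noteq> 0"
        then have "e \<noteq> m" by (auto simp: hcomp_diff hcomp_homogeneous[OF homogeneous_hcomp])
        moreover from this e have "hcomp e g \<noteq> 0" by (simp add: hcomp_diff hcomp_homogeneous[OF homogeneous_hcomp])
        then have "e \<le> m" using hcomp_above_tdeg[of g e] m_def by linarith
        ultimately show "int e \<le> - (1 - int m)" by simp
      qed
      then have "hcomp m g - g \<in> std (1 - int m)" using gV by (intro std_degle pvars_diff pvars_hcomp)
      then have "g + (hcomp m g - g) \<in> std (1 - int m)" using g by (intro std_add)
      then show False using std_symbol[of m "hcomp m g"] pvars_hcomp[OF gV] h(3) by (simp add: m_def g_def)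
    qed
    ultimately have "x \<in> Ft (- int m) - Ft (- int m + 1)" using f(1) gV by (simp add: Ft_iff add.commute)
    then show "x \<in> (\<Union>i. Ft i - Ft (i + 1))" by blast
  qed
  fix fs "is" assume len: "length is = n" and fs: "list_all2 (\<lambda>f i. f \<in> Ft i) fs is"
  then have lf: "length fs = n" by (simp add: list_all2_lengthD)
  have "\<forall>s<n. \<exists>g. g \<in> std (is ! s) \<and> fs ! s = \<pi> g" using fs len lf by (auto simp: list_all2_conv_all_nth Ft_def)
  then obtain g where g: "\<And>s. s < n \<Longrightarrow> g s \<in> std (is ! s)" "\<And>s. s < n \<Longrightarrow> fs ! s = \<pi> (g s)" by metis
  have "fs = map \<pi> (map g [0..<n])" using g(2) lf by (intro nth_equalityI) auto
  moreover have "set (map g [0..<n]) \<subseteq> pvars V" using std_vars[OF g(1)] by auto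
  ultimately have "nbracket P fs = \<pi> (jacobian_det (map g [0..<n] @ [\<Omega>]))"
    using P_bracket[of "map g [0..<n]"] by (simp only: length_map length_upt diff_zero)
  moreover have "jacobian_det (map g [0..<n] @ [\<Omega>]) \<in> std (sum_list is - int d0)"
    using g(1) len by (intro std_bracket) (auto simp: list_all2_conv_all_nth)
  ultimately show "nbracket P fs \<in> Ft (sum_list is - int d0)" by (simp add: Ft_def)
qed

end

section \<open>The graded algebra of the degree filtration\<close>

context potential
begin

section \<open>The symbol map onto the graded algebra\<close>

sublocale W: w_filtration "class_ring :: 'k ring" n "int d0" P Ft
  by (rule w_filtration_Ft)

abbreviation G :: "('k, int \<Rightarrow> 'k mpoly set set) np_algebra"
  where "G \<equiv> gr n (int d0) P Ft"

text \<open>By \<open>phi_surj\<close> and \<open>phi_zero_iff\<close> this map identifies gr with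
  the polynomial ring modulo \<Omega>, without that quotient being formed.\<close>

definition \<phi> :: "'k mpoly \<Rightarrow> int \<Rightarrow> 'k mpoly set set"
  where "\<phi> f = (\<lambda>i. W.cls i (\<pi> (cmp i f)))"

lemma P_mem: "f \<in> pvars V \<Longrightarrow> \<pi> f \<in> carrier P"
  by (simp add: P_carrier)

lemma cmp_std: "f \<in> pvars V \<Longrightarrow> cmp i f \<in> std i"
  using homz_degle[OF homz_cmp] pvars_cmp by (intro std_degle)

lemma cls_pi_eq_iff: "f \<in> pvars V \<Longrightarrow> g \<in> pvars V \<Longrightarrow> W.cls i (\<pi> f) = W.cls i (\<pi> g) \<longleftrightarrow> f - g \<in> std (i + 1)"
  by (simp add: W.cls_eq_iff P_mem P_minus Ft_iff pvars_diff)

lemma cls_pi_eq_Ft: "f \<in> pvars V \<Longrightarrow> W.cls i (\<pi> f) = Ft (i + 1) \<longleftrightarrow> f \<in> std (i + 1)"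
  by (simp add: W.cls_eq_self_iff P_mem Ft_iff)

lemma zero_std: "0 \<in> std i"
  using I_std zero_I by blast

lemma cls_zero_Ft: "W.cls i (\<pi> 0) = Ft (i + 1)"
  using cls_pi_eq_Ft[of 0 i] zero_std by simp

lemma support_phi: "f \<in> pvars V \<Longrightarrow> gr_support Ft (\<phi> f) = {i. cmp i f \<notin> std (i + 1)}"
  by (simp add: gr_support_def \<phi>_def cls_pi_eq_Ft pvars_cmp)

lemma support_phi_subset: "f \<in> pvars V \<Longrightarrow> gr_support Ft (\<phi> f) \<subseteq> {- int (tdeg f)..0}"
  using cmp_outside[of _ f] zero_std by (force simp: support_phi)

lemma std_sum: "(\<And>i. i \<in> S \<Longrightarrow> f i \<in> std k) \<Longrightarrow> sum f S \<in> std k"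
  by (induction S rule: infinite_finite_induct) (auto intro: std_add zero_std)

lemma finsum_P: "finite S \<Longrightarrow> (\<And>s. s \<in> S \<Longrightarrow> f s \<in> pvars V) \<Longrightarrow> finsum P (\<lambda>s. \<pi> (f s)) S = \<pi> (sum f S)"
proof -
  assume S: "finite S" "\<And>s. s \<in> S \<Longrightarrow> f s \<in> pvars V"
  have "\<pi> (finsum Apot f S) = finsum P (\<lambda>s. \<pi> (f s)) S"
    by (rule hom_finsum[OF Ap.M.abelian_monoid_axioms P.M.abelian_monoid_axioms])
      (use S in \<open>auto simp: A_pot_sel P_carrier P_add P_zero\<close>)
  moreover have "finsum Apot f S = sum f S"
    by (rule finsum_polynomials[OF Ap.M.abelian_monoid_axioms]) (use S in \<open>auto simp: A_pot_sel\<close>)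
  ultimately show ?thesis by simp
qed

text \<open>In each degree this is \<open>std_symbol\<close>; and a homogeneous \<Omega> divides f
  precisely when it divides all components of f.\<close>

lemma phi_zero_iff: "f \<in> pvars V \<Longrightarrow> \<phi> f = (\<lambda>i. Ft (i + 1)) \<longleftrightarrow> \<Omega> dvd f"
proof -
  assume f: "f \<in> pvars V"
  have sym: "hcomp m f \<in> std (1 - int m) \<longleftrightarrow> \<Omega> dvd hcomp m f" for m
    using std_symbol[of m "hcomp m f"] pvars_hcomp[OF f] by simp
  have "\<phi> f = (\<lambda>i. Ft (i + 1)) \<longleftrightarrow> (\<forall>i. cmp i f \<in> std (i + 1))"
    using f by (simp add: \<phi>_def fun_eq_iff cls_pi_eq_Ft pvars_cmp)
  also have "\<dots> \<longleftrightarrow> (\<forall>m. \<Omega> dvd hcomp m f)"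
  proof
    assume a: "\<forall>i. cmp i f \<in> std (i + 1)"
    show "\<forall>m. \<Omega> dvd hcomp m f"
    proof
      fix m
      show "\<Omega> dvd hcomp m f" using a[rule_format, of "- int m"] sym[of m] by (simp add: cmp_def add.commute)
    qed
  next
    assume a: "\<forall>m. \<Omega> dvd hcomp m f"
    show "\<forall>i. cmp i f \<in> std (i + 1)"
    proof
      fix i
      show "cmp i f \<in> std (i + 1)"
      proof (cases "i \<le> 0")
        case True
        then show ?thesis using sym[of "nat (- i)"] a by (simp add: cmp_def add.commute)
      qed (simp add: cmp_def zero_std)
    qed
  qed
  also have "\<dots> \<longleftrightarrow> \<Omega> dvd f"
  proof
    assume "\<forall>m. \<Omega> dvd hcomp m f"
    then have "\<Omega> dvd (\<Sum>m\<le>tdeg f. hcomp m f)" by (intro dvd_sum) auto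
    then show "\<Omega> dvd f" by (simp add: sum_hcomp)
  next
    assume "\<Omega> dvd f"
    then obtain u where "f = u * \<Omega>" unfolding dvd_def by (metis mult.commute)
    then show "\<forall>m. \<Omega> dvd hcomp m f" by (simp add: hcomp_mult_homogeneous[OF Om_hom])
  qed
  finally show ?thesis .
qed

lemma G_sel:
  "carrier G = {x. (\<forall>i. x i \<in> W.cls i ` Ft i) \<and> finite (gr_support Ft x)}"
  "\<zero>\<^bsub>G\<^esub> = (\<lambda>i. Ft (i + 1))" "\<one>\<^bsub>G\<^esub> = (\<lambda>i. if i = 0 then Ft 1 +>\<^bsub>P\<^esub> \<one>\<^bsub>P\<^esub> else Ft (i + 1))"
  "x \<oplus>\<^bsub>G\<^esub> y = (\<lambda>i. x i <+>\<^bsub>P\<^esub> y i)"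
  "x \<otimes>\<^bsub>G\<^esub> y = (\<lambda>k. \<Oplus>\<^bsub>P Quot Ft (k + 1)\<^esub> i \<in> gr_support Ft x. rcoset_mult P (Ft (k + 1)) (x i) (y (k - i)))"
  "c \<odot>\<^bsub>G\<^esub> x = (\<lambda>i. rcoset_smult P (Ft (i + 1)) c (x i))"
  "nbracket G xs = (\<lambda>k. \<Oplus>\<^bsub>P Quot Ft (k + 1)\<^esub>
      is \<in> {is. length is = n \<and> list_all2 (\<lambda>i x. i \<in> gr_support Ft x) is xs \<and> sum_list is - int d0 = k}.
        rcoset_bracket P (Ft (k + 1)) (map2 (\<lambda>x i. x i) xs is))"
  by (simp_all add: gr_def)

lemma phi_carrier: "f \<in> pvars V \<Longrightarrow> \<phi> f \<in> carrier G"
  using cmp_std[of f] finite_subset[OF support_phi_subset[of f]]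
  by (auto simp: G_sel(1) \<phi>_def Ft_def)

lemma phi_of_components:
  assumes S: "finite S" and h: "\<And>i. i \<in> S \<Longrightarrow> homz (- i) (h i)"
  shows "\<phi> (sum h S) = (\<lambda>k. if k \<in> S then W.cls k (\<pi> (h k)) else Ft (k + 1))"
proof
  fix k
  have "cmp k (sum h S) = (\<Sum>i\<in>S. if i = k then h k else 0)"
    unfolding cmp_sum using cmp_homz[OF h] by (intro sum.cong) auto
  then show "\<phi> (sum h S) k = (if k \<in> S then W.cls k (\<pi> (h k)) else Ft (k + 1))"
    using S by (simp add: \<phi>_def cls_zero_Ft)
qed

lemma phi_surj: "\<phi> ` pvars V = carrier G"
proof
  show "\<phi> ` pvars V \<subseteq> carrier G" using phi_carrier by blast
  show "carrier G \<subseteq> \<phi> ` pvars V"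
  proof
    fix x assume x: "x \<in> carrier G"
    \<comment> \<open>A representative is reduced modulo \<open>I\<close> to some g of degree at
      most \<open>- i\<close>. The terms of lower degree lie in \<open>std (i + 1)\<close>, so the
      component \<open>cmp i g\<close> represents the class.\<close>
    have "\<exists>c. c \<in> pvars V \<and> homz (- i) c \<and> x i = W.cls i (\<pi> c)" for i
    proof -
      obtain p where p: "p \<in> std i" "x i = W.cls i (\<pi> p)" using x by (force simp: G_sel(1) Ft_def)
      obtain h where h: "h \<in> I" "degle (- i) (p - h)" "p \<in> pvars V" using p(1) unfolding std_def by blast
      define g where "g = p - h"
      have gV: "g \<in> pvars V" using h I_vars pvars_diff g_def by blast
      have "degle (- (i + 1)) (g - cmp i g)"
        unfolding degle_def
      proof (intro allI impI)
        fix m assume m: "hcomp m (g - cmp i g) \<noteq> 0"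
        have "int m \<noteq> - i"
        proof
          assume e: "int m = - i"
          then have "i \<le> 0" "nat (- i) = m" by auto
          then have "cmp i g = hcomp m g" by (simp add: cmp_def)
          then show False using m by (simp add: hcomp_diff hcomp_homogeneous[OF homogeneous_hcomp])
        qed
        moreover from this have "hcomp m (cmp i g) = 0" using homz_cmp[of i g] unfolding homz_def by blast
        then have "int m \<le> - i" using m h(2) unfolding degle_def g_def[symmetric] by (simp add: hcomp_diff)
        ultimately show "int m \<le> - (i + 1)" by linarith
      qed
      then have "g - cmp i g \<in> std (i + 1)" by (intro std_degle pvars_diff pvars_cmp gV)
      then have "h + (g - cmp i g) \<in> std (i + 1)" by (rule std_add[OF subsetD[OF I_std h(1)]])
      then have "p - cmp i g \<in> std (i + 1)" by (simp add: g_def)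
      then have "x i = W.cls i (\<pi> (cmp i g))" using p(2) cls_pi_eq_iff h(3) pvars_cmp[OF gV] by simp
      then show ?thesis using pvars_cmp[OF gV] homz_cmp by blast
    qed
    then obtain c where c: "\<And>i. c i \<in> pvars V" "\<And>i. homz (- i) (c i)" "\<And>i. x i = W.cls i (\<pi> (c i))" by metis
    have fin: "finite (gr_support Ft x)" using x by (simp add: G_sel(1))
    have "\<phi> (sum c (gr_support Ft x)) = x"
      unfolding phi_of_components[OF fin c(2)] using c(3) by (auto simp: gr_support_def fun_eq_iff)
    moreover have "sum c (gr_support Ft x) \<in> pvars V" by (intro pvars_sum c(1))
    ultimately show "x \<in> \<phi> ` pvars V" by (metis imageI)
  qed
qed

lemma phi_add: "f \<in> pvars V \<Longrightarrow> g \<in> pvars V \<Longrightarrow> \<phi> (f + g) = \<phi> f \<oplus>\<^bsub>G\<^esub> \<phi> g"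
  using P.a_rcoset_add[OF W.F_additive_subgroup P_mem P_mem]
  by (simp add: \<phi>_def G_sel(4) cmp_add P_add pvars_cmp)

lemma phi_smult: "f \<in> pvars V \<Longrightarrow> \<phi> (mconst c * f) = c \<odot>\<^bsub>G\<^esub> \<phi> f"
  using W.rcoset_smult_cls[OF P_mem]
  by (simp add: \<phi>_def G_sel(6) cmp_mconst_mult P_smult pvars_cmp)

lemma phi_zero: "\<phi> 0 = \<zero>\<^bsub>G\<^esub>"
  by (simp add: \<phi>_def G_sel(2) cls_zero_Ft)

lemma phi_one: "\<phi> 1 = \<one>\<^bsub>G\<^esub>"
proof -
  have "homz (- 0) (1 :: 'k mpoly)" using homz_homogeneous[OF homogeneous_mconst[of "1::'k"]] by simp
  then have "cmp i (1 :: 'k mpoly) = (if i = 0 then 1 else 0)" for i by (rule cmp_homz)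
  then show ?thesis by (intro ext) (simp add: \<phi>_def G_sel(3) P_one cls_zero_Ft)
qed

text \<open>The product in gr is summed over the support of \<open>\<phi> f\<close>, that of
  polynomials over all components. A component of f outside the support lies one step deeper, so its
  product falls into \<open>std (k + 1)\<close> and is invisible in degree k.\<close>

lemma phi_mult:
  assumes f: "f \<in> pvars V" and g: "g \<in> pvars V"
  shows "\<phi> (f * g) = \<phi> f \<otimes>\<^bsub>G\<^esub> \<phi> g"
proof
  fix k
  define S where "S = {- int (tdeg f)..0}"
  let ?s = "gr_support Ft (\<phi> f)"
  let ?t = "\<lambda>i. cmp i f * cmp (k - i) g"
  have tV: "?t i \<in> pvars V" for i by (intro pvars_mult pvars_cmp f g)
  have sS: "?s \<subseteq> S" unfolding S_def by (rule support_phi_subset[OF f])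
  then have fin: "finite ?s" by (rule finite_subset) (simp add: S_def)
  have "(\<phi> f \<otimes>\<^bsub>G\<^esub> \<phi> g) k = W.cls k (finsum P (\<lambda>i. \<pi> (?t i)) ?s)"
    unfolding G_sel(5)
  proof (rule W.finsum_cls[OF fin])
    show "(\<lambda>i. \<pi> (?t i)) \<in> ?s \<rightarrow> carrier P" using tV P_mem by blast
    fix i
    have "\<pi> (cmp i f) \<in> Ft i" "\<pi> (cmp (k - i) g) \<in> Ft (k - i)"
      using cmp_std f g by (auto simp: Ft_def)
    from W.rcoset_mult_cls[OF this]
    show "rcoset_mult P (Ft (k + 1)) (\<phi> f i) (\<phi> g (k - i)) = W.cls k (\<pi> (?t i))"
      by (simp add: \<phi>_def P_mult pvars_cmp f g)
  qed
  also have "\<dots> = W.cls k (\<pi> (\<Sum>i\<in>?s. ?t i))" using tV by (simp add: finsum_P[OF fin])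
  also have "\<dots> = W.cls k (\<pi> (cmp k (f * g)))"
  proof -
    have "cmp k (f * g) = (\<Sum>i\<in>S. ?t i)" by (rule cmp_mult) (simp_all add: S_def)
    then have eq: "(\<Sum>i\<in>?s. ?t i) - cmp k (f * g) = - (\<Sum>i\<in>S - ?s. ?t i)"
      using sum.subset_diff[OF sS, of ?t] by (simp add: S_def)
    have "?t i \<in> std (k + 1)" if "i \<in> S - ?s" for i
    proof -
      have "cmp i f \<in> std (i + 1)" using that by (simp add: support_phi[OF f])
      from std_mult[OF this cmp_std[OF g, of "k - i"]] show ?thesis by (simp add: algebra_simps)
    qed
    then have "(\<Sum>i\<in>?s. ?t i) - cmp k (f * g) \<in> std (k + 1)"
      unfolding eq by (intro std_uminus std_sum)
    moreover have "(\<Sum>i\<in>?s. ?t i) \<in> pvars V" by (intro pvars_sum tV)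
    ultimately show ?thesis using cls_pi_eq_iff pvars_cmp[OF pvars_mult[OF f g]] by blast
  qed
  finally show "\<phi> (f * g) k = (\<phi> f \<otimes>\<^bsub>G\<^esub> \<phi> g) k" by (simp add: \<phi>_def)
qed

text \<open>As for products: \<open>L'\<close> holds all index lists contributing to degree k,
  \<open>Q\<close> those inside the supports. A list in \<open>L' - Q\<close> has an argument one
  step deeper, which moves its bracket into \<open>std (k + 1)\<close>.\<close>

lemma phi_bracket:
  assumes fs: "length fs = n" "set fs \<subseteq> pvars V"
  shows "\<phi> (jacobian_det (fs @ [\<Omega>])) = nbracket G (map \<phi> fs)"
proof
  fix k
  define S where "S = (\<Union>f\<in>set fs. {- int (tdeg f)..0})"
  define L where "L = {is. set is \<subseteq> S \<and> length is = n}"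
  define L' where "L' = {is \<in> L. sum_list is - int d0 = k}"
  define Q where "Q = {is. length is = n \<and> list_all2 (\<lambda>i x. i \<in> gr_support Ft x) is (map \<phi> fs) \<and> sum_list is - int d0 = k}"
  let ?c = "\<lambda>is. map2 (\<lambda>f i. cmp i f) fs is"
  let ?t = "\<lambda>is. jacobian_det (?c is @ [\<Omega>])"
  have finS: "finite S" by (simp add: S_def)
  have Sf: "{- int (tdeg f)..0} \<subseteq> S" if "f \<in> set fs" for f using that by (auto simp: S_def)
  have finL: "finite L" unfolding L_def using finS by (rule finite_lists_length_eq)
  have fsV: "fs ! s \<in> pvars V" if "s < n" for s using fs that by (simp add: subset_iff)
  have cV: "set (?c is) \<subseteq> pvars V" for "is" using fs(2) pvars_cmp by (auto dest!: set_zip_leftD)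
  have tV: "?t is \<in> pvars V" for "is" by (intro jacobian_pvars cV Om_vars)
  have cstd: "list_all2 (\<lambda>f i. f \<in> std i) (?c is) is" if "length is = n" for "is"
    using that fs fsV cmp_std by (auto simp: list_all2_conv_all_nth)
  have QL: "Q \<subseteq> L'"
  proof
    fix "is" assume q: "is \<in> Q"
    then have len: "length is = n" by (simp add: Q_def)
    have "set is \<subseteq> S"
    proof
      fix i assume "i \<in> set is"
      then obtain s where s: "s < n" "i = is ! s" using len by (auto simp: in_set_conv_nth)
      then have "i \<in> gr_support Ft (\<phi> (fs ! s))" using q fs(1) by (auto simp: Q_def list_all2_conv_all_nth)
      then have "i \<in> {- int (tdeg (fs ! s))..0}" using support_phi_subset[OF fsV[OF s(1)]] by blast
      then show "i \<in> S" using s(1) fs(1) unfolding S_def by (meson UN_I nth_mem)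
    qed
    then show "is \<in> L'" using q by (simp add: L'_def L_def Q_def)
  qed
  have finL': "finite L'" using finL by (simp add: L'_def)
  have finQ: "finite Q" using QL finL' by (rule finite_subset)
  have "cmp k (jacobian_det (fs @ [\<Omega>])) = (\<Sum>is\<in>L. cmp k (?t is))"
    using jacobian_expand[OF finS, of fs "[]" \<Omega>] fs(1) Sf by (simp add: L_def cmp_sum)
  also have "\<dots> = (\<Sum>is\<in>L. if sum_list is - int d0 = k then ?t is else 0)"
  proof (rule sum.cong[OF refl])
    fix "is" assume "is \<in> L"
    then have len: "length is = n" by (simp add: L_def)
    have "list_all2 (\<lambda>f d. homz d f) (?c is) (map uminus is)"
      using len fs(1) homz_cmp by (auto simp: list_all2_conv_all_nth)
    from jacobian_homz[OF this homz_homogeneous[OF Om_hom]]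
    have "homz (sum_list (map uminus is) + int dOm - int n - 1) (?t is)" using len fs(1) by simp
    moreover have "sum_list (map uminus is) = - sum_list is" by (induction "is") simp_all
    then have "sum_list (map uminus is) + int dOm - int n - 1 = - (sum_list is - int d0)" by simp
    ultimately have "homz (- (sum_list is - int d0)) (?t is)" by (simp only:)
    from cmp_homz[OF this, of k] show "cmp k (?t is) = (if sum_list is - int d0 = k then ?t is else 0)" by auto
  qed
  also have "\<dots> = (\<Sum>is\<in>L'. ?t is)" using finL by (simp add: L'_def sum.inter_filter)
  finally have cmpJ: "cmp k (jacobian_det (fs @ [\<Omega>])) = (\<Sum>is\<in>L'. ?t is)" .
  have "nbracket G (map \<phi> fs) k = W.cls k (finsum P (\<lambda>is. \<pi> (?t is)) Q)"
    unfolding G_sel(7) Q_def[symmetric]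
  proof (rule W.finsum_cls[OF finQ])
    show "(\<lambda>is. \<pi> (?t is)) \<in> Q \<rightarrow> carrier P" using tV P_mem by blast
    fix "is" assume "is \<in> Q"
    then have len: "length is = n" and sum: "sum_list is - int d0 = k" by (auto simp: Q_def)
    have "list_all2 (\<lambda>f i. f \<in> Ft i) (map \<pi> (?c is)) is"
      using cstd[OF len] by (auto simp: list_all2_conv_all_nth Ft_def)
    from W.rcoset_bracket_cls[OF len this]
    have "rcoset_bracket P (Ft (k + 1)) (map2 (\<lambda>f i. W.cls i f) (map \<pi> (?c is)) is) = W.cls k (nbracket P (map \<pi> (?c is)))"
      unfolding sum .
    moreover have "map2 (\<lambda>f i. W.cls i f) (map \<pi> (?c is)) is = map2 (\<lambda>x i. x i) (map \<phi> fs) is"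
      using len fs(1) by (intro nth_equalityI) (auto simp: \<phi>_def)
    moreover have "nbracket P (map \<pi> (?c is)) = \<pi> (?t is)" using len fs(1) cV by (intro P_bracket) simp_all
    ultimately show "rcoset_bracket P (Ft (k + 1)) (map2 (\<lambda>x i. x i) (map \<phi> fs) is) = W.cls k (\<pi> (?t is))" by (simp only:)
  qed
  also have "\<dots> = W.cls k (\<pi> (\<Sum>is\<in>Q. ?t is))" using tV by (simp add: finsum_P[OF finQ])
  also have "\<dots> = W.cls k (\<pi> (cmp k (jacobian_det (fs @ [\<Omega>]))))"
  proof -
    have eq: "(\<Sum>is\<in>Q. ?t is) - cmp k (jacobian_det (fs @ [\<Omega>])) = - (\<Sum>is\<in>L' - Q. ?t is)"
      unfolding cmpJ using sum.subset_diff[OF QL finL', of ?t] by simp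
    have "?t is \<in> std (k + 1)" if isLQ: "is \<in> L' - Q" for "is"
    proof -
      have len: "length is = n" and sum: "sum_list is - int d0 = k" using isLQ by (auto simp: L'_def L_def)
      then obtain s where s: "s < n" "is ! s \<notin> gr_support Ft (\<phi> (fs ! s))"
        using isLQ fs(1) by (auto simp: Q_def list_all2_conv_all_nth)
      then have c: "cmp (is ! s) (fs ! s) \<in> std (is ! s + 1)" by (simp add: support_phi fsV)
      have "list_all2 (\<lambda>f i. f \<in> std i) (?c is) (is[s := is ! s + 1])"
        using cstd[OF len] c len fs(1) s(1) by (auto simp: list_all2_conv_all_nth nth_list_update)
      from std_bracket[OF _ this] have "?t is \<in> std (sum_list (is[s := is ! s + 1]) - int d0)" using len by simp
      moreover have "sum_list (is[s := is ! s + 1]) - int d0 = k + 1"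
        using sum s(1) len by (simp add: sum_list_update_group)
      ultimately show ?thesis by simp
    qed
    then have "(\<Sum>is\<in>Q. ?t is) - cmp k (jacobian_det (fs @ [\<Omega>])) \<in> std (k + 1)"
      unfolding eq by (intro std_uminus std_sum)
    moreover have "(\<Sum>is\<in>Q. ?t is) \<in> pvars V" by (intro pvars_sum tV)
    ultimately show ?thesis using cls_pi_eq_iff pvars_cmp[OF jacobian_pvars[OF fs(2) Om_vars]] by blast
  qed
  finally show "\<phi> (jacobian_det (fs @ [\<Omega>])) k = nbracket G (map \<phi> fs) k" by (simp add: \<phi>_def)
qed

lemma np_G: "nambu_poisson_algebra class_ring n G"
proof (rule Ap.hom_image[of \<phi>], unfold A_pot_sel)
  show "0 < n" using n by simp
qed (rule phi_surj phi_add phi_mult phi_one phi_zero phi_smult phi_bracket; assumption)+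

sublocale G: nambu_poisson_algebra "class_ring :: 'k ring" n G
  by (rule np_G)

text \<open>The kernel of \<open>\<phi>\<close> consists of the multiples of the prime
  \<Omega>.\<close>

lemma domain_G: "domain G"
proof (intro domain.intro domain_axioms.intro Module.algebra.axioms(2)[OF G.algebra])
  show "\<one>\<^bsub>G\<^esub> \<noteq> \<zero>\<^bsub>G\<^esub>"
  proof
    assume "\<one>\<^bsub>G\<^esub> = \<zero>\<^bsub>G\<^esub>"
    then have "\<Omega> dvd 1" using phi_zero_iff[of 1] by (simp add: phi_one G_sel(2))
    then show False using Om_irreducible by (simp add: irreducible_def)
  qed
  fix x y assume xy: "x \<otimes>\<^bsub>G\<^esub> y = \<zero>\<^bsub>G\<^esub>" "x \<in> carrier G" "y \<in> carrier G"
  then obtain f g where fg: "x = \<phi> f" "y = \<phi> g" "f \<in> pvars V" "g \<in> pvars V" unfolding phi_surj[symmetric] by blast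
  then have "\<phi> (f * g) = \<zero>\<^bsub>G\<^esub>" using xy(1) by (simp add: phi_mult)
  then have "\<Omega> dvd f * g" using phi_zero_iff[of "f * g"] fg by (simp add: pvars_mult G_sel(2))
  then show "x = \<zero>\<^bsub>G\<^esub> \<or> y = \<zero>\<^bsub>G\<^esub>" using Om_prime[of f g] fg phi_zero_iff by (simp add: G_sel(2))
qed

section \<open>Grading and connectedness\<close>

abbreviation Gc :: "int \<Rightarrow> (int \<Rightarrow> 'k mpoly set set) set"
  where "Gc \<equiv> gr_component n (int d0) P Ft"

lemma phi_homz: "homz (- i) f \<Longrightarrow> \<phi> f = (\<lambda>k. if k = i then W.cls i (\<pi> f) else Ft (k + 1))"
  using phi_of_components[of "{i}" "\<lambda>_. f"] by (auto simp: fun_eq_iff)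

lemma Gc_eq: "Gc i = \<phi> ` {f \<in> pvars V. homz (- i) f}"
proof
  show "\<phi> ` {f \<in> pvars V. homz (- i) f} \<subseteq> Gc i"
    using phi_carrier phi_homz by (auto simp: gr_component_def gr_support_def)
  show "Gc i \<subseteq> \<phi> ` {f \<in> pvars V. homz (- i) f}"
  proof
    fix x assume x: "x \<in> Gc i"
    then obtain f where f: "f \<in> pvars V" "x = \<phi> f" unfolding gr_component_def phi_surj[symmetric] by blast
    have "\<phi> f = \<phi> (cmp i f)"
      unfolding phi_homz[OF homz_cmp] using x f(2)
      by (auto simp: gr_component_def gr_support_def fun_eq_iff \<phi>_def)
    then show "x \<in> \<phi> ` {f \<in> pvars V. homz (- i) f}" using f homz_cmp pvars_cmp by blast
  qed
qed

lemma finsum_G: "finite S \<Longrightarrow> (\<And>s. s \<in> S \<Longrightarrow> f s \<in> pvars V) \<Longrightarrow> finsum G (\<lambda>s. \<phi> (f s)) S = \<phi> (sum f S)"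
proof -
  assume S: "finite S" "\<And>s. s \<in> S \<Longrightarrow> f s \<in> pvars V"
  have "\<phi> (finsum Apot f S) = finsum G (\<lambda>s. \<phi> (f s)) S"
    by (rule hom_finsum[OF Ap.M.abelian_monoid_axioms G.M.abelian_monoid_axioms])
      (use S phi_surj in \<open>auto simp: A_pot_sel phi_add phi_zero\<close>)
  moreover have "finsum Apot f S = sum f S"
    by (rule finsum_polynomials[OF Ap.M.abelian_monoid_axioms]) (use S in \<open>auto simp: A_pot_sel\<close>)
  ultimately show ?thesis by simp
qed

text \<open>Elements of gr are functions of the degree: the component in degree i can only be
  \<open>x i\<close> in place i and zero elsewhere. Uniqueness compares values at i.\<close>

lemma G_direct_sum:
  assumes x: "x \<in> carrier G"
  shows "\<exists>!g. (\<forall>i. g i \<in> Gc i) \<and> finite {i. g i \<noteq> \<zero>\<^bsub>G\<^esub>} \<and> x = (\<Oplus>\<^bsub>G\<^esub>i\<in>{i. g i \<noteq> \<zero>\<^bsub>G\<^esub>}. g i)"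
proof -
  obtain f where f: "f \<in> pvars V" "x = \<phi> f" using x unfolding phi_surj[symmetric] by blast
  let ?g = "\<lambda>i. \<phi> (cmp i f)"
  let ?S = "{i. ?g i \<noteq> \<zero>\<^bsub>G\<^esub>}"
  have g: "?g i = (\<lambda>k. if k = i then x i else Ft (k + 1))" for i
    unfolding phi_homz[OF homz_cmp] by (simp add: f(2) \<phi>_def fun_eq_iff)
  have S: "?S = gr_support Ft x" unfolding g by (auto simp: G_sel(2) gr_support_def fun_eq_iff)
  have fin: "finite ?S" unfolding S using x by (simp add: G_sel(1))
  have "(\<Oplus>\<^bsub>G\<^esub>i\<in>?S. ?g i) = \<phi> (\<Sum>i\<in>?S. cmp i f)" using f(1) by (intro finsum_G fin pvars_cmp)
  also have "\<dots> = x" unfolding phi_of_components[OF fin homz_cmp]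
    unfolding S by (auto simp: f(2) \<phi>_def gr_support_def fun_eq_iff)
  finally have sum: "x = (\<Oplus>\<^bsub>G\<^esub>i\<in>?S. ?g i)" ..
  show ?thesis
  proof (rule ex1I[of _ ?g])
    have "?g i \<in> Gc i" for i using f(1) homz_cmp[of i f] pvars_cmp by (auto simp: Gc_eq)
    then show "(\<forall>i. ?g i \<in> Gc i) \<and> finite ?S \<and> x = (\<Oplus>\<^bsub>G\<^esub>i\<in>?S. ?g i)"
      using fin sum by blast
    fix g' assume g': "(\<forall>i. g' i \<in> Gc i) \<and> finite {i. g' i \<noteq> \<zero>\<^bsub>G\<^esub>} \<and> x = (\<Oplus>\<^bsub>G\<^esub>i\<in>{i. g' i \<noteq> \<zero>\<^bsub>G\<^esub>}. g' i)"
    define T where "T = {i. g' i \<noteq> \<zero>\<^bsub>G\<^esub>}"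
    have "\<forall>i. \<exists>h. h \<in> pvars V \<and> homz (- i) h \<and> g' i = \<phi> h"
    proof
      fix i
      have "g' i \<in> Gc i" using g' by blast
      then show "\<exists>h. h \<in> pvars V \<and> homz (- i) h \<and> g' i = \<phi> h" unfolding Gc_eq by blast
    qed
    then obtain h where h: "\<And>i. h i \<in> pvars V" "\<And>i. homz (- i) (h i)" "\<And>i. g' i = \<phi> (h i)" by metis
    have finT: "finite T" using g' by (simp add: T_def)
    have "x = finsum G g' T" using g' unfolding T_def by blast
    also have "g' = (\<lambda>i. \<phi> (h i))" using h(3) by blast
    finally have xs: "x = \<phi> (sum h T)" using finsum_G[OF finT, of h] h(1) by simp
    show "g' = ?g"
    proof
      fix i
      have "x i = (if i \<in> T then W.cls i (\<pi> (h i)) else Ft (i + 1))"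
        unfolding xs phi_of_components[OF finT h(2)] ..
      also have "\<dots> = W.cls i (\<pi> (h i))"
        using phi_homz[OF h(2)[of i]] by (auto simp: T_def h(3) G_sel(2) fun_eq_iff)
      finally show "g' i = ?g i" unfolding g h(3) by (simp add: phi_homz[OF h(2)[of i]] fun_eq_iff)
    qed
  qed
qed

lemma graded_G: "graded_algebra class_ring G Gc"
proof (rule graded_algebra.intro)
  show "Module.algebra class_ring G" by (rule G.algebra)
  show "VectorSpace.subspace class_ring (Gc i) G" for i
  proof (intro subspace.intro submodule.intro)
    show "vectorspace class_ring G" by (intro vectorspace.intro G.module_axioms class_field)
    show "module class_ring G" by (rule G.module_axioms)
    show "Gc i \<subseteq> carrier G" by (auto simp: gr_component_def)
    show "\<zero>\<^bsub>G\<^esub> \<in> Gc i" unfolding Gc_eq phi_zero[symmetric] by (intro imageI) simp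
    fix v w assume "v \<in> Gc i" "w \<in> Gc i"
    then obtain f g where "v = \<phi> f" "w = \<phi> g" "f \<in> pvars V" "g \<in> pvars V" "homz (- i) f" "homz (- i) g"
      unfolding Gc_eq by blast
    moreover from this have "v \<oplus>\<^bsub>G\<^esub> w = \<phi> (f + g)" by (simp only: phi_add)
    ultimately show "v \<oplus>\<^bsub>G\<^esub> w \<in> Gc i" unfolding Gc_eq using pvars_add homz_add by blast
  next
    fix c v assume "v \<in> Gc i"
    then obtain f where f: "v = \<phi> f" "f \<in> pvars V" "homz (- i) f" unfolding Gc_eq by blast
    have "homz (- i) (mconst c * f)"
      using homz_mult[OF homz_homogeneous[OF homogeneous_mconst[of c]] f(3)] by simp
    moreover have "c \<odot>\<^bsub>G\<^esub> v = \<phi> (mconst c * f)" using f by (simp only: phi_smult)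
    moreover have "mconst c * f \<in> pvars V" using f by (intro pvars_mult) simp_all
    ultimately show "c \<odot>\<^bsub>G\<^esub> v \<in> Gc i" unfolding Gc_eq by blast
  qed
  show "\<exists>!g. (\<forall>i. g i \<in> Gc i) \<and> finite {i. g i \<noteq> \<zero>\<^bsub>G\<^esub>} \<and> a = (\<Oplus>\<^bsub>G\<^esub>i\<in>{i. g i \<noteq> \<zero>\<^bsub>G\<^esub>}. g i)"
    if "a \<in> carrier G" for a using G_direct_sum[OF that] .
  show "\<one>\<^bsub>G\<^esub> \<in> Gc 0" unfolding Gc_eq phi_one[symmetric]
    using homz_homogeneous[OF homogeneous_mconst[of "1::'k"]] by (intro imageI) simp
  fix v w i j assume "v \<in> Gc i" "w \<in> Gc j"
  then obtain f g where fg: "v = \<phi> f" "w = \<phi> g" "f \<in> pvars V" "g \<in> pvars V" "homz (- i) f" "homz (- j) g"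
    unfolding Gc_eq by blast
  have "homz (- (i + j)) (f * g)" using homz_mult[OF fg(5,6)] by (simp add: algebra_simps)
  moreover have "v \<otimes>\<^bsub>G\<^esub> w = \<phi> (f * g)" using fg by (simp only: phi_mult)
  ultimately show "v \<otimes>\<^bsub>G\<^esub> w \<in> Gc (i + j)" unfolding Gc_eq using pvars_mult[OF fg(3,4)] by blast
qed

lemma w_graded_G: "w_graded_np_algebra class_ring n (int d0) G Gc"
proof (intro w_graded_np_algebra.intro np_G graded_G w_graded_np_algebra_axioms.intro)
  fix fs "is" assume len: "length is = n" and fs: "list_all2 (\<lambda>f i. f \<in> Gc i) fs is"
  then have lf: "length fs = n" by (simp add: list_all2_lengthD)
  have "\<forall>s<n. \<exists>h. h \<in> pvars V \<and> homz (- (is ! s)) h \<and> fs ! s = \<phi> h" using fs len lf by (auto simp: list_all2_conv_all_nth Gc_eq)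
  then obtain h where h: "\<And>s. s < n \<Longrightarrow> h s \<in> pvars V" "\<And>s. s < n \<Longrightarrow> homz (- (is ! s)) (h s)" "\<And>s. s < n \<Longrightarrow> fs ! s = \<phi> (h s)" by metis
  define hs where "hs = map h [0..<n]"
  have "fs = map \<phi> hs" using h(3) lf by (intro nth_equalityI) (auto simp: hs_def)
  moreover have hV: "set hs \<subseteq> pvars V" using h(1) by (auto simp: hs_def)
  ultimately have b: "nbracket G fs = \<phi> (jacobian_det (hs @ [\<Omega>]))" by (simp add: phi_bracket hs_def)
  have "list_all2 (\<lambda>f d. homz d f) hs (map uminus is)" using h(2) len by (auto simp: hs_def list_all2_conv_all_nth)
  from jacobian_homz[OF this homz_homogeneous[OF Om_hom]]
  have "homz (sum_list (map uminus is) + int dOm - int n - 1) (jacobian_det (hs @ [\<Omega>]))" by (simp add: hs_def)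
  moreover have "sum_list (map uminus is) = - sum_list is" by (induction "is") simp_all
  then have "sum_list (map uminus is) + int dOm - int n - 1 = - (sum_list is - int d0)" by simp
  ultimately have "homz (- (sum_list is - int d0)) (jacobian_det (hs @ [\<Omega>]))" by (simp only:)
  then show "nbracket G fs \<in> Gc (sum_list is - int d0)"
    unfolding b Gc_eq using jacobian_pvars[OF hV Om_vars] by blast
qed

lemma connected_G: "connected_graded_algebra class_ring G Gc"
proof (intro connected_graded_algebra.intro graded_G connected_graded_algebra_axioms.intro)
  show "Gc i = {\<zero>\<^bsub>G\<^esub>}" if "i > 0" for i
  proof -
    have "f = 0" if "homz (- i) f" for f :: "'k mpoly"
      using degle_negative[OF homz_degle[OF that]] \<open>i > 0\<close> by simp
    moreover have "homz (- i) (0 :: 'k mpoly)" by simp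
    ultimately have *: "{f :: 'k mpoly. f \<in> pvars V \<and> homz (- i) f} = {0}" using pvars_zero by blast
    show ?thesis unfolding Gc_eq * by (simp add: phi_zero)
  qed
  show "Gc 0 = {c \<odot>\<^bsub>G\<^esub> \<one>\<^bsub>G\<^esub> |c. c \<in> carrier class_ring}"
  proof -
    have "f \<in> pvars V \<and> homz 0 f \<longleftrightarrow> (\<exists>c. f = mconst c)" for f :: "'k mpoly"
    proof
      assume f: "f \<in> pvars V \<and> homz 0 f"
      then have "tdeg f \<le> 0" using tdeg_le_degle[of 0 f] homz_degle[of 0 f] by simp
      then show "\<exists>c. f = mconst c" using tdeg_eq_0_mconst[of f] by blast
    qed (use homz_homogeneous[OF homogeneous_mconst] in auto)
    then have "Gc 0 = \<phi> ` range mconst" by (auto simp: Gc_eq)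
    moreover have "\<phi> (mconst c) = c \<odot>\<^bsub>G\<^esub> \<one>\<^bsub>G\<^esub>" for c
      using phi_smult[of 1 c] by (simp add: phi_one)
    ultimately have "Gc 0 = range (\<lambda>c. c \<odot>\<^bsub>G\<^esub> \<one>\<^bsub>G\<^esub>)" by (simp add: image_image)
    then show ?thesis by (auto simp: full_SetCompr_eq)
  qed
  show "\<one>\<^bsub>G\<^esub> \<noteq> \<zero>\<^bsub>G\<^esub>" using domain.one_not_zero[OF domain_G] .
qed

text \<open>Translates the hypotheses to the preimages \<open>F'\<close>, to which
  \<open>std_unique\<close> applies. Every coset in \<open>F i\<close> has a polynomial
  representative, so \<open>F i\<close> is recovered as the image of \<open>F' i\<close>.\<close>

lemma filtration_unique:
  assumes w: "w_filtration class_ring n (int d0) P F"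
    and con: "connected_graded_algebra class_ring (gr n (int d0) P F) (gr_component n (int d0) P F)"
    and dom: "domain (gr n (int d0) P F)"
  shows "F = Ft"
proof
  interpret F: w_filtration "class_ring :: 'k ring" n "int d0" P F by (rule w)
  define F' where "F' i = {f \<in> pvars V. \<pi> f \<in> F i}" for i
  have F: "F i = \<pi> ` F' i" for i using F.F_carrier[of i] by (auto simp: F'_def P_carrier)
  have zF: "\<pi> 0 \<in> F i" for i using additive_subgroup.zero_closed[OF F.F_additive_subgroup] by (simp add: P_zero)
  have piI: "\<pi> f = \<pi> 0 \<longleftrightarrow> f \<in> I" if "f \<in> pvars V" for f using pi_eq_iff[OF that, of 0] by simp
  note con' = F.connected_filtration[OF con]
  fix i
  have "F' i = std i"
  proof (rule std_unique)
    show "F' i \<subseteq> pvars V" for i by (auto simp: F'_def)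
    show "f + g \<in> F' i" if "f \<in> F' i" "g \<in> F' i" for f g i
      using that additive_subgroup.a_closed[OF F.F_additive_subgroup[of i], of "\<pi> f" "\<pi> g"]
      by (simp add: F'_def P_add pvars_add)
    show "mconst c * f \<in> F' i" if "f \<in> F' i" for c f i
      using that F.F_smult[of c "\<pi> f" i] by (simp add: F'_def P_smult pvars_mult)
    show "I \<subseteq> F' i" for i
    proof
      fix f assume f: "f \<in> I"
      then show "f \<in> F' i" using zF piI[OF I_vars[OF f]] I_vars[OF f] by (simp add: F'_def)
    qed
    show "F' (i + 1) \<subseteq> F' i" for i using F.decreasing[of i] by (auto simp: F'_def)
    show "f * g \<in> F' (i + j)" if "f \<in> F' i" "g \<in> F' j" for f g i j
      using that F.mult_mem[of "\<pi> f" i "\<pi> g" j] by (simp add: F'_def P_mult pvars_mult)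
    show "\<exists>i. f \<in> F' i \<and> f \<notin> F' (i + 1)" if f: "f \<in> pvars V" "f \<notin> I" for f
    proof -
      have "\<pi> f \<in> carrier P - {\<zero>\<^bsub>P\<^esub>}" using f piI P_mem by (simp add: P_zero)
      then obtain i where "\<pi> f \<in> F i" "\<pi> f \<notin> F (i + 1)" unfolding F.exhaustive_separated[symmetric] by blast
      then show ?thesis using f(1) by (auto simp: F'_def)
    qed
    show "f * g \<notin> F' (i + j + 1)" if "f \<in> F' i" "f \<notin> F' (i + 1)" "g \<in> F' j" "g \<notin> F' (j + 1)" for f g i j
      using that F.gr_domain_mult[OF dom, of "\<pi> f" i "\<pi> g" j] by (simp add: F'_def P_mult)
    show "1 \<in> F' 0" "1 \<notin> F' 1" using F.one_mem by (auto simp: F'_def P_one)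
    show "\<exists>c. \<exists>h\<in>I. f = mconst c + h" if f: "f \<in> F' 0" for f
    proof -
      obtain c where "\<pi> f = c \<odot>\<^bsub>P\<^esub> \<one>\<^bsub>P\<^esub>" using f con'(2) by (auto simp: F'_def)
      then have "\<pi> f = \<pi> (mconst c)" by (simp add: P_one P_smult)
      then have "f - mconst c \<in> I" using pi_eq_iff f by (simp add: F'_def)
      then show ?thesis by (intro exI[of _ c] bexI[of _ "f - mconst c"]) simp_all
    qed
    show "jacobian_det (fs @ [\<Omega>]) \<in> F' (sum_list is - int d0)"
      if fs: "length fs = n" "list_all2 (\<lambda>f i. f \<in> F' i) fs is" for fs "is"
    proof -
      have fV: "set fs \<subseteq> pvars V" using fs(2) by (fastforce simp: list_all2_conv_all_nth in_set_conv_nth F'_def)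
      have "list_all2 (\<lambda>f i. f \<in> F i) (map \<pi> fs) is" using fs(2) by (auto simp: list_all2_conv_all_nth F'_def)
      moreover have "length is = n" using fs by (simp add: list_all2_lengthD)
      ultimately have "nbracket P (map \<pi> fs) \<in> F (sum_list is - int d0)" by (rule F.bracket_mem[rotated])
      then show ?thesis using P_bracket[OF fs(1) fV] jacobian_pvars[OF fV Om_vars] by (simp add: F'_def)
    qed
  qed
  then show "F i = Ft i" by (simp add: F Ft_def)
qed

end

theorem theorem0p10:
  fixes n d0 :: nat
    and \<Omega> :: "'k::field_char_0 mpoly"
    and \<xi> :: 'k
  assumes "n \<ge> 3"
    and "d0 \<ge> 2"
    and "is_potential n (n + 1 + d0) \<Omega>"
    and "\<xi> \<noteq> 0"
  shows "\<exists>!F :: int \<Rightarrow> 'k mpoly set set.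
    w_filtration class_ring n (int d0) (P_pot n \<Omega> \<xi>) F \<and>
    w_graded_np_algebra class_ring n (int d0)
      (gr n (int d0) (P_pot n \<Omega> \<xi>) F) (gr_component n (int d0) (P_pot n \<Omega> \<xi>) F) \<and>
    connected_graded_algebra class_ring
      (gr n (int d0) (P_pot n \<Omega> \<xi>) F) (gr_component n (int d0) (P_pot n \<Omega> \<xi>) F) \<and>
    domain (gr n (int d0) (P_pot n \<Omega> \<xi>) F)"
proof -
  have O: "\<Omega> \<in> pvars {..<n + 1}" "homogeneous (n + 1 + d0) \<Omega>"
    using assms(3) by (simp_all add: is_potential_def carrier_poly_algebra)
  have fd: "vectorspace.fin_dim class_ring (quot_algebra (poly_algebra (n + 1))
      (genideal (poly_algebra (n + 1)) {partial_deriv i \<Omega> | i. i < n + 1}))"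
    using assms(3) by (simp add: is_potential_def)
  from fin_dim_imp_powers[OF O fd] obtain M
    where M: "\<forall>i<n + 1. \<exists>q. (\<forall>l<n + 1. q l \<in> pvars {..<n + 1}) \<and>
      tvar i ^ M = (\<Sum>l<n + 1. q l * partial_deriv l \<Omega>)" by blast
  interpret potential n d0 \<Omega> \<xi> M
    using assms O M by unfold_locales auto
  show ?thesis
    by (rule ex1I[of _ Ft])
      (use w_filtration_Ft w_graded_G connected_G domain_G filtration_unique in blast)+
qed

end
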